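(* For each $n$ let $G$ be a random $(d_L,d_R)$-biregular bipartite graph on $m+n$ vertices with adjacency matrix $A$, and suppose that (i) $\lim_{n\to\infty} d_R=\infty$; (ii) for any fixed $\epsilon'>0$, $d_R=o(n^{\epsilon'})$; (iii) $d_R/d_L\to y$ as $n\to\infty$, where $1\le y<\infty$; (iv) $d_R=\exp\big(o(1)\sqrt{\log n}\big)$. Let $\mu_n$ be the empirical spectral distribution of $(d_R-1)^{-1/2}A$, and let $\mu$ be the probability measure on $\mathbb{R}$ consisting of the density $\frac{y}{(1+y)\pi|x|}\sqrt{(\beta^2-x^2)(x^2-\gamma^2)}$ on $[-\beta,-\gamma]\cup[\gamma,\beta]$, where $\gamma=1-y^{-1/2}$ and $\beta=1+y^{-1/2}$, along with a point mass of $\frac{y-1}{y+1}$ at $0$. Define (depending on $n$) $$a=\min\left(\frac{\log n}{9(\log d_R)^2},\,d_R\right),\qquad r=e^{1/a},\qquad \eta=r^{1/2}-r^{-1/2}.$$ Fix $\epsilon>0$. Then there exists a constant $C_\epsilon$ such that for every $\delta>0$ and all sufficiently large $n$, for any interval $I\subset\mathbb{R}$ disjoint from $[-\epsilon,\epsilon]$ and with length $|I|\ge\max\big(2\eta,\ \eta/(-\delta\log\delta)\big)$, it holds that $$|\mu_n(I)-\mu(I)|<\delta C_\epsilon|I|$$ with probability $1-o(1/n)$.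
   Context: Graphs have no loops or parallel edges. A bipartite graph with vertex classes $L$ (left) and $R$ (right) is $(d_L,d_R)$-biregular if every vertex in $L$ has degree $d_L$ and every vertex in $R$ has degree $d_R$. It is always assumed that $d_R\ge d_L$ (hence $|L|\ge|R|$). A random $(d_L,d_R)$-biregular bipartite graph on $m+n$ vertices is a graph chosen uniformly from all $(d_L,d_R)$-biregular bipartite graphs with $|L|=m$, $|R|=n$ (so $md_L=nd_R$). One considers a sequence of such random graphs indexed by $n\to\infty$, where $m,d_L,d_R$ depend on $n$. Asymptotic notation is as $n\to\infty$; the interval $I$ may depend on $n$ (its admissible length depends on $n$ through $\eta$). The constant $C_\epsilon$ does not depend on $\delta$, $n$ or $I$. The empirical spectral distribution of a symmetric $N\times N$ matrix with eigenvalues $\lambda_1,\dots,\lambda_N$ is the probability measure $\frac1N\sum_{i=1}^N\delta_{\lambda_i}$. *)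

theory Defs
  imports
    "HOL-Probability.Probability"
    "HOL-Library.Landau_Symbols"
    "Jordan_Normal_Form.Char_Poly"
begin

text \<open>
  A simple graph is given by its set of edges, an edge being a two-element set of vertices.
  The left class is \<open>{..<m}\<close> and the right class is \<open>{m..<m + n}\<close>.
\<close>

definition biregular_graphs :: "nat \<Rightarrow> nat \<Rightarrow> nat \<Rightarrow> nat \<Rightarrow> nat set set set" where
  "biregular_graphs m n dL dR =
     {E. E \<subseteq> {{u, v} | u v. u \<in> {..<m} \<and> v \<in> {m..<m + n}} \<and>
         (\<forall>u\<in>{..<m}. card {e \<in> E. u \<in> e} = dL) \<and>
         (\<forall>v\<in>{m..<m + n}. card {e \<in> E. v \<in> e} = dR)}"

lemma finite_biregular_graphs: "finite (biregular_graphs m n dL dR)"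
proof (rule finite_subset)
  show "biregular_graphs m n dL dR \<subseteq> Pow (Pow {..<m + n})"
    by (fastforce simp: biregular_graphs_def)
qed simp

definition random_biregular_graph :: "nat \<Rightarrow> nat \<Rightarrow> nat \<Rightarrow> nat \<Rightarrow> nat set set pmf" where
  "random_biregular_graph m n dL dR = pmf_of_set (biregular_graphs m n dL dR)"

definition adjacency_matrix :: "nat \<Rightarrow> nat set set \<Rightarrow> real mat" where
  "adjacency_matrix N E = mat N N (\<lambda>(i, j). if {i, j} \<in> E then 1 else 0)"

lemma transpose_adjacency_matrix:
  "transpose_mat (c \<cdot>\<^sub>m adjacency_matrix N E) = c \<cdot>\<^sub>m adjacency_matrix N E"
  by (intro eq_matI) (auto simp: adjacency_matrix_def insert_commute)

text \<open>
  The eigenvalues are the roots of the characteristic polynomial, with multiplicity. For a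
  symmetric matrix all of them are real, see \<open>size_eigenvalues_symmetric\<close> below, so that
  the weight of each is the reciprocal of the dimension.
\<close>

definition eigenvalue_mset :: "real mat \<Rightarrow> real multiset" where
  "eigenvalue_mset A = proots (char_poly A)"

definition empirical_spectral_distribution :: "real mat \<Rightarrow> real measure" where
  "empirical_spectral_distribution A = measure_pmf (pmf_of_multiset (eigenvalue_mset A))"

lemma symmetric_eigenvalue_real:
  fixes A :: "real mat"
  assumes A: "A \<in> carrier_mat n n" and sym: "transpose_mat A = A"
    and ev: "eigenvalue (map_mat complex_of_real A) z"
  shows "z \<in> \<real>"
proof -
  let ?B = "map_mat complex_of_real A"
  have B: "?B \<in> carrier_mat n n" using A by simp
  obtain v where v: "v \<in> carrier_vec n" "v \<noteq> 0\<^sub>v n" "?B *\<^sub>v v = z \<cdot>\<^sub>v v"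
    using ev A unfolding eigenvalue_def eigenvector_def by auto
  have symij: "A $$ (i, j) = A $$ (j, i)" if "i < n" "j < n" for i j
    using sym A that by (metis carrier_matD index_transpose_mat(1))
  have row: "(\<Sum>j<n. complex_of_real (A $$ (i, j)) * v $ j) = z * v $ i" if "i < n" for i
  proof -
    have "(?B *\<^sub>v v) $ i = (\<Sum>j<n. complex_of_real (A $$ (i, j)) * v $ j)"
      using that A v(1) by (auto simp: scalar_prod_def atLeast0LessThan intro!: sum.cong)
    then show ?thesis using v that by simp
  qed
  define q where "q = (\<Sum>i<n. \<Sum>j<n. cnj (v $ i) * (complex_of_real (A $$ (i, j)) * v $ j))"
  define s where "s = (\<Sum>i<n. (cmod (v $ i))\<^sup>2)"
  have qz: "q = z * complex_of_real s"
  proof -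
    have "q = (\<Sum>i<n. cnj (v $ i) * (z * v $ i))"
      unfolding q_def by (simp add: row flip: sum_distrib_left)
    also have "\<dots> = z * complex_of_real s"
      unfolding s_def of_real_sum sum_distrib_left
      by (intro sum.cong refl) (simp only: complex_norm_square, simp add: mult_ac)
    finally show ?thesis .
  qed
  have "cnj q = (\<Sum>i<n. \<Sum>j<n. cnj (v $ j) * (complex_of_real (A $$ (i, j)) * v $ i))"
    unfolding q_def by (simp add: mult_ac)
  also have "\<dots> = (\<Sum>j<n. \<Sum>i<n. cnj (v $ j) * (complex_of_real (A $$ (i, j)) * v $ i))"
    by (rule sum.swap)
  also have "\<dots> = q"
    unfolding q_def by (intro sum.cong refl) (simp add: symij)
  finally have "cnj z * complex_of_real s = z * complex_of_real s"
    by (simp add: qz)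
  moreover have "s \<noteq> 0"
  proof
    assume "s = 0"
    then have "\<forall>i<n. v $ i = 0"
      unfolding s_def by (subst (asm) sum_nonneg_eq_0_iff) auto
    then have "v = 0\<^sub>v n" using v(1) by (intro eq_vecI) auto
    with v(2) show False by simp
  qed
  ultimately have "cnj z = z" by simp
  then show ?thesis by (simp add: Reals_cnj_iff)
qed

lemma size_eigenvalues_symmetric:
  fixes A :: "real mat"
  assumes A: "A \<in> carrier_mat n n" and sym: "transpose_mat A = A"
  shows "size (eigenvalue_mset A) = n"
proof -
  let ?B = "map_mat complex_of_real A"
  have B: "?B \<in> carrier_mat n n" using A by simp
  obtain as where as: "char_poly ?B = (\<Prod>a\<leftarrow>as. [:- a, 1:])" "length as = n"
    using char_poly_factorized[OF B] by auto
  have "a \<in> \<real>" if "a \<in> set as" for a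
  proof -
    have "poly (char_poly ?B) a = 0"
      unfolding as poly_prod_list using that by (auto simp: prod_list_zero_iff)
    then show ?thesis
      using eigenvalue_root_char_poly[OF B] symmetric_eigenvalue_real[OF A sym] by blast
  qed
  then have "map (complex_of_real \<circ> Re) as = as"
    by (intro map_idI) (auto elim: Reals_cases)
  then obtain bs where bs: "as = map complex_of_real bs"
    by (metis map_map)
  interpret map_poly_of_real: map_poly_comm_ring_hom complex_of_real ..
  have "map_poly complex_of_real (char_poly A) = char_poly ?B"
    by (rule of_real_hom.char_poly_hom[OF A, symmetric])
  also have "\<dots> = map_poly complex_of_real (\<Prod>b\<leftarrow>bs. [:- b, 1:])"
    unfolding as bs
  proof (induction bs)
    case (Cons b bs)
    have "map_poly complex_of_real [:- b, 1:] = [:- complex_of_real b, 1:]"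
      by (simp add: map_poly_pCons)
    with Cons show ?case
      by (simp only: list.map prod_list.Cons map_poly_of_real.hom_mult)
  qed simp
  finally have "char_poly A = (\<Prod>b\<leftarrow>bs. [:- b, 1:])"
    by (simp add: poly_eq_iff coeff_map_poly)
  moreover have "proots (\<Prod>b\<leftarrow>bs. [:- b, 1:]) = mset bs"
  proof (induction bs)
    case (Cons b bs)
    have "(\<Prod>b\<leftarrow>bs. [:- b, 1:]) \<noteq> 0"
      by (auto simp: prod_list_zero_iff)
    then have "proots ([:- b, 1:] * (\<Prod>b\<leftarrow>bs. [:- b, 1:])) = {#b#} + mset bs"
      by (subst proots_mult) (simp_all add: Cons.IH del: mult_pCons_left)
    then show ?case
      by (simp only: list.map prod_list.Cons) simp
  qed simp
  ultimately show ?thesis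
    using as(2) by (simp add: eigenvalue_mset_def bs)
qed

definition limit_density :: "real \<Rightarrow> real \<Rightarrow> real" where
  "limit_density y x =
     (let \<gamma> = 1 - y powr (-1/2); \<beta> = 1 + y powr (-1/2)
      in y / ((1 + y) * pi * \<bar>x\<bar>) * sqrt ((\<beta>\<^sup>2 - x\<^sup>2) * (x\<^sup>2 - \<gamma>\<^sup>2)) *
         indicator ({-\<beta>..-\<gamma>} \<union> {\<gamma>..\<beta>}) x)"

text \<open>
  \<open>measure_of\<close> gives the zero measure if its argument is not countably additive; that this
  does not happen is \<open>emeasure_limit_law\<close>.
\<close>

definition limit_law :: "real \<Rightarrow> real measure" where
  "limit_law y = measure_of UNIV (sets borel)
     (\<lambda>B. emeasure (density lborel (\<lambda>x. ennreal (limit_density y x))) B +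
          ennreal ((y - 1) / (y + 1)) * indicator B 0)"

lemma sets_limit_law [simp]: "sets (limit_law y) = sets borel"
  unfolding limit_law_def using sets.sigma_sets_eq[of borel] by (simp add: sets_measure_of_conv)

lemma emeasure_limit_law:
  assumes "B \<in> sets borel"
  shows "emeasure (limit_law y) B =
    (\<integral>\<^sup>+x\<in>B. ennreal (limit_density y x) \<partial>lborel) + ennreal ((y - 1) / (y + 1)) * indicator B 0"
proof -
  let ?D = "density lborel (\<lambda>x. ennreal (limit_density y x))"
  have meas: "(\<lambda>x. ennreal (limit_density y x)) \<in> borel_measurable lborel"
    unfolding limit_density_def Let_def by measurable
  have "emeasure (limit_law y) B = emeasure ?D B + ennreal ((y - 1) / (y + 1)) * indicator B 0"
    using limit_law_def
  proof (rule emeasure_measure_of)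
    show "countably_additive (sets (limit_law y))
      (\<lambda>B. emeasure ?D B + ennreal ((y - 1) / (y + 1)) * indicator B 0)"
    proof (rule countably_additiveI)
      fix F :: "nat \<Rightarrow> real set"
      assume F: "range F \<subseteq> sets (limit_law y)" "disjoint_family F"
      have "(\<Sum>i. emeasure ?D (F i)) = emeasure ?D (\<Union>i. F i)"
        using F by (intro suminf_emeasure) auto
      moreover have "(\<Sum>i. indicator (F i) 0 :: ennreal) = indicator (\<Union>i. F i) 0"
        using F(2) by (rule suminf_indicator)
      ultimately show "(\<Sum>i. emeasure ?D (F i) + ennreal ((y - 1) / (y + 1)) * indicator (F i) 0) =
          emeasure ?D (\<Union>i. F i) + ennreal ((y - 1) / (y + 1)) * indicator (\<Union>i. F i) 0"
        by (simp add: suminf_add[symmetric])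
    qed
  qed (use assms in \<open>auto simp: positive_def\<close>)
  then show ?thesis
    using assms meas by (simp add: emeasure_density)
qed

definition scale_a :: "nat \<Rightarrow> nat \<Rightarrow> real" where
  "scale_a n d = min (ln (real n) / (9 * (ln (real d))\<^sup>2)) (real d)"

definition scale_r :: "nat \<Rightarrow> nat \<Rightarrow> real" where
  "scale_r n d = exp (1 / scale_a n d)"

definition scale_eta :: "nat \<Rightarrow> nat \<Rightarrow> real" where
  "scale_eta n d = scale_r n d powr (1/2) - scale_r n d powr (-1/2)"

end

theory Submission
  imports Defs "Jordan_Normal_Form.Schur_Decomposition" "HOL-Real_Asymp.Real_Asymp"
begin

text \<open>
  Non-backtracking walks between two vertices are counted by polynomials in the adjacency matrix
  that are essentially Chebyshev polynomials \<open>U\<^sub>k\<close> of the second kind in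
  \<open>t = (x\<^sup>2 - 1 - s\<^sup>2) / s\<close>, \<open>x\<close> an eigenvalue of the scaled matrix and
  \<open>s\<^sup>2 = (d\<^sub>L - 1) / (d\<^sub>R - 1)\<close>. Hence the empirical measure of the values \<open>t\<close>, weighted
  by \<open>x\<^sup>2\<close>, has nearly the moments \<open>\<integral> U\<^sub>k = e\<^sup>k\<close> with \<open>e\<close> of order \<open>1 / d\<^sub>R\<close>, for all \<open>k\<close>
  up to the depth to which most vertices lie on no closed non-backtracking walk: the
  Marchenko--Pastur law becomes the semicircle law up to \<open>O(e)\<close>. The one-sided polynomial
  approximations of Chebyshev, Markov and Stieltjes, which are valid on the whole line and therefore
  insensitive to outlying eigenvalues, turn moments up to order \<open>D\<close> into a bound of order
  \<open>1 / D + e\<^sup>2\<close> for the difference of the distribution functions. As \<open>D\<close> is of order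
  \<open>log n / log d\<^sub>R\<close>, this is \<open>o(\<eta>)\<close>.

  If many vertices lie on short closed non-backtracking walks, the graph has many pairwise
  disjoint short cycles. A switching argument bounds the expected number of pairs of disjoint short
  cycles by \<open>n\<^sup>o\<^sup>(\<^sup>1\<^sup>)\<close>, so Markov's inequality for pairs gives failure probability \<open>o(1 / n)\<close>.
\<close>


section \<open>One-sided polynomial approximation\<close>

text \<open>The moments \<open>A * e ^ k\<close> belong to the semicircle law times
  \<open>A / (1 - e * t + e^2)\<close>, of which only \<open>A * (1 + e * t)\<close> is kept.
  Dropping \<open>e * t\<close> as well would cost an additive error of order
  \<open>1 / d_R\<close>, which need not be smaller than eta, since \<open>a\<close> can be as large
  as \<open>d_R\<close>. Kept in the density, this term contributes o(1) times |I|, while the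
  remainder of order \<open>e^2\<close> is o(eta). The weight \<open>x^2\<close> arises because the
  polynomials for walks of odd length are odd in \<open>x\<close>: one more factor \<open>x\<close>
  under the trace makes them \<open>x^2\<close> times a polynomial in \<open>x^2\<close>. The weight
  is removed again by a layer cake over \<open>u < 1 / x^2\<close>, at the price of
  \<open>1 / epsilon^2\<close>; this is where the distance of I from 0 enters. Markov's inequality
  for single cycles with threshold T gives only n^o(1) / T, which is not o(1 / n) as T has to stay
  well below n. For pairs the threshold is T^2, and n^o(1) / T^2 is small enough. The exceptional
  graphs are described by their cycles alone, so one event serves all intervals and all
  delta.\<close>

fun chebU :: "nat \<Rightarrow> real \<Rightarrow> real" where
  "chebU 0 t = 1"
| "chebU (Suc 0) t = t"
| "chebU (Suc (Suc k)) t = t * chebU (Suc k) t - chebU k t"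

text \<open>In this normalisation \<open>chebU k t\<close> is the usual polynomial of the second
  kind at \<open>t / 2\<close>. Its natural interval is [-2, 2], and its recursion has coefficients
  1, like the rescaled recursion of the walk counts. The factor \<open>sin\<close> keeps the
  identity valid where the sine vanishes.\<close>

lemma chebU_2cos: "sin \<theta> * chebU k (2 * cos \<theta>) = sin (real (Suc k) * \<theta>)"
proof (induction k "2 * cos \<theta>" rule: chebU.induct)
  case 2
  show ?case by (simp add: sin_double)
next
  case (3 k)
  have "sin \<theta> * chebU (Suc (Suc k)) (2 * cos \<theta>) =
      2 * cos \<theta> * sin (real (Suc (Suc k)) * \<theta>) - sin (real (Suc k) * \<theta>)"
    using 3 by (simp add: algebra_simps)
  also have "\<dots> = sin (real (Suc (Suc k)) * \<theta> + \<theta>)"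
  proof -
    have "real (Suc k) * \<theta> = real (Suc (Suc k)) * \<theta> - \<theta>" by (simp add: algebra_simps)
    then show ?thesis by (simp only: sin_add sin_diff) simp
  qed
  finally show ?case by (simp add: algebra_simps)
qed simp

lemma chebU_uminus: "chebU k (- t) = (-1) ^ k * chebU k t"
  by (induction k t rule: chebU.induct) (auto simp: algebra_simps)

lemma abs_sin_mult_le: "\<bar>sin (real n * x)\<bar> \<le> real n * \<bar>sin x\<bar>"
proof (induction n)
  case (Suc n)
  have "\<bar>sin (real (Suc n) * x)\<bar> \<le> \<bar>sin (real n * x)\<bar> * \<bar>cos x\<bar> + \<bar>cos (real n * x)\<bar> * \<bar>sin x\<bar>"
    by (simp add: algebra_simps sin_add flip: abs_mult)
  also have "\<dots> \<le> \<bar>sin (real n * x)\<bar> * 1 + 1 * \<bar>sin x\<bar>"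
    by (intro add_mono mult_mono) auto
  finally show ?case using Suc by (simp add: algebra_simps)
qed simp

lemma abs_chebU_2cos_le:
  assumes "sin \<theta> > 0"
  shows "\<bar>chebU k (2 * cos \<theta>)\<bar> \<le> real (Suc k)"
proof -
  have "sin \<theta> * \<bar>chebU k (2 * cos \<theta>)\<bar> \<le> sin \<theta> * real (Suc k)"
    using abs_sin_mult_le[of "Suc k" \<theta>] assms chebU_2cos[of \<theta> k]
    by (metis abs_mult abs_of_pos mult.commute)
  then show ?thesis using assms by simp
qed

text \<open>
  This cone of completely monotone functions is closed under \<open>f \<mapsto> (\<lambda>t. (f x - f t) / (t - x))\<close>, so
  that the signs of all terms of a Newton interpolation are known.
\<close>

inductive posfrac :: "real \<Rightarrow> (real \<Rightarrow> real) \<Rightarrow> bool" for u where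
  const: "c \<ge> 0 \<Longrightarrow> posfrac u (\<lambda>t. c)"
| add: "posfrac u f \<Longrightarrow> posfrac u g \<Longrightarrow> posfrac u (\<lambda>t. f t + g t)"
| div: "posfrac u f \<Longrightarrow> a < u \<Longrightarrow> posfrac u (\<lambda>t. f t / (t - a))"

lemma posfrac_nonneg: "posfrac u f \<Longrightarrow> t \<ge> u \<Longrightarrow> f t \<ge> 0"
  by (induction rule: posfrac.induct) auto

lemma posfrac_divided_difference:
  assumes "posfrac u f" "x \<ge> u"
  shows "\<exists>g. posfrac u g \<and> (\<forall>t\<ge>u. f t = f x + (x - t) * g t)"
  using assms(1)
proof induction
  case (const c)
  have "posfrac u (\<lambda>t. 0)" by (rule posfrac.const) simp
  then show ?case by (intro exI[of _ "\<lambda>t. 0"]) auto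
next
  case (add f1 f2)
  then obtain g1 g2 where "posfrac u g1" "\<forall>t\<ge>u. f1 t = f1 x + (x - t) * g1 t"
    "posfrac u g2" "\<forall>t\<ge>u. f2 t = f2 x + (x - t) * g2 t"
    by blast
  then show ?case
    by (intro exI[of _ "\<lambda>t. g1 t + g2 t"]) (auto intro: posfrac.add simp: algebra_simps)
next
  case (div f a)
  then obtain g where g: "posfrac u g" "\<forall>t\<ge>u. f t = f x + (x - t) * g t" by blast
  \<comment> \<open>From 1 / (t - a) = 1 / (x - a) + (x - t) / ((x - a) * (t - a)): the value
    \<open>f x / (x - a)\<close> is a nonnegative constant, so both parts of the new quotient stay
    in the cone.\<close>
  have "f x / (x - a) \<ge> 0"
    using posfrac_nonneg[OF div(1) assms(2)] div(2) assms(2) by simp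
  then have "posfrac u (\<lambda>t. f x / (x - a) / (t - a) + g t / (t - a))"
    by (intro posfrac.intros g div)
  moreover have "f t / (t - a) = f x / (x - a) + (x - t) * (f x / (x - a) / (t - a) + g t / (t - a))"
    if "t \<ge> u" for t
  proof -
    have *: "x - a \<noteq> 0" "t - a \<noteq> 0" using that div(2) assms(2) by auto
    have "f t / (t - a) = f x / (t - a) + (x - t) * (g t / (t - a))"
      using g(2) that by (simp add: add_divide_distrib)
    moreover have "f x / (t - a) = f x / (x - a) + (x - t) * (f x / (x - a) / (t - a))"
      using * by (simp add: divide_simps) (simp add: algebra_simps)
    ultimately show ?thesis by (simp add: algebra_simps)
  qed
  ultimately show ?case by blast
qed

text \<open>As \<open>chebU k\<close> has degree \<open>k\<close>, these are the polynomials of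
  degree at most \<open>D\<close>. They are expressed in this basis because the moments are known
  for it.\<close>

definition chebspan :: "nat \<Rightarrow> (real \<Rightarrow> real) \<Rightarrow> bool" where
  "chebspan D f \<longleftrightarrow> (\<exists>c. \<forall>t. f t = (\<Sum>k\<le>D. c k * chebU k t))"

lemma chebspan_mono:
  assumes "chebspan D f" "D \<le> D'"
  shows "chebspan D' f"
proof -
  obtain c where c: "\<And>t. f t = (\<Sum>k\<le>D. c k * chebU k t)"
    using assms(1) by (auto simp: chebspan_def)
  have "f t = (\<Sum>k\<le>D'. (if k \<le> D then c k else 0) * chebU k t)" for t
    unfolding c by (rule sum.mono_neutral_cong_left) (use assms(2) in auto)
  then show ?thesis
    unfolding chebspan_def by (intro exI[of _ "\<lambda>k. if k \<le> D then c k else 0"]) auto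
qed

lemma chebspan_const: "chebspan D (\<lambda>t. c)"
proof -
  have "chebspan 0 (\<lambda>t. c)" unfolding chebspan_def by (intro exI[of _ "\<lambda>_. c"]) simp
  then show ?thesis by (rule chebspan_mono) simp
qed

lemma chebspan_add:
  assumes "chebspan D f" "chebspan D g"
  shows "chebspan D (\<lambda>t. f t + g t)"
proof -
  obtain c d where "\<And>t. f t = (\<Sum>k\<le>D. c k * chebU k t)" "\<And>t. g t = (\<Sum>k\<le>D. d k * chebU k t)"
    using assms by (auto simp: chebspan_def)
  then show ?thesis unfolding chebspan_def
    by (intro exI[of _ "\<lambda>k. c k + d k"]) (simp add: sum.distrib algebra_simps)
qed

lemma chebspan_scale:
  assumes "chebspan D f"
  shows "chebspan D (\<lambda>t. a * f t)"
proof -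
  obtain c where "\<And>t. f t = (\<Sum>k\<le>D. c k * chebU k t)"
    using assms by (auto simp: chebspan_def)
  then show ?thesis unfolding chebspan_def
    by (intro exI[of _ "\<lambda>k. a * c k"]) (simp add: sum_distrib_left algebra_simps)
qed

lemma chebspan_sum:
  assumes "finite S" "\<And>k. k \<in> S \<Longrightarrow> chebspan D (f k)"
  shows "chebspan D (\<lambda>t. \<Sum>k\<in>S. f k t)"
  using assms by (induction S rule: finite_induct) (auto intro: chebspan_const chebspan_add)

lemma chebspan_chebU: "k \<le> D \<Longrightarrow> chebspan D (chebU k)"
  unfolding chebspan_def
  by (intro exI[of _ "\<lambda>j. if j = k then 1 else 0"]) (auto simp: if_distrib[of "\<lambda>x. x * _"] cong: if_cong)

text \<open>The recursion read backwards: \<open>t * chebU k t\<close> is the sum of the two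
  neighbouring polynomials.\<close>

lemma chebspan_times_arg:
  assumes "chebspan D f"
  shows "chebspan (Suc D) (\<lambda>t. t * f t)"
proof -
  obtain c where c: "\<And>t. f t = (\<Sum>k\<le>D. c k * chebU k t)"
    using assms by (auto simp: chebspan_def)
  have U: "chebspan (Suc D) (\<lambda>t. t * chebU k t)" if "k \<le> D" for k
  proof (cases k)
    case 0
    have "(\<lambda>t. t * chebU k t) = chebU 1" using 0 by auto
    then show ?thesis using chebspan_chebU[of 1 "Suc D"] by simp
  next
    case (Suc l)
    have "(\<lambda>t. t * chebU k t) = (\<lambda>t. chebU (Suc k) t + 1 * chebU l t)"
      using Suc by auto
    then show ?thesis using that Suc
      by (simp only:) (intro chebspan_add chebspan_scale chebspan_chebU, auto)
  qed
  have "(\<lambda>t. t * f t) = (\<lambda>t. \<Sum>k\<in>{..D}. c k * (t * chebU k t))"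
    unfolding c by (simp add: sum_distrib_left algebra_simps)
  then show ?thesis
    by (simp only:) (intro chebspan_sum chebspan_scale U, auto)
qed

lemma chebspan_times_linear:
  assumes "chebspan D f"
  shows "chebspan (Suc D) (\<lambda>t. (a - t) * f t)"
proof -
  have "chebspan (Suc D) (\<lambda>t. a * f t + (-1) * (t * f t))"
    by (intro chebspan_add chebspan_scale chebspan_times_arg chebspan_mono[OF assms] assms) simp
  then show ?thesis by (simp add: algebra_simps)
qed

text \<open>Newton interpolation by iterating \<open>posfrac_divided_difference\<close>; repeated
  nodes give Hermite interpolation. With factors \<open>x - t\<close> in place of
  \<open>t - x\<close> all Newton coefficients are nonnegative. Hence the remainder has the sign of
  the product for \<open>t\<close> right of \<open>u\<close>, and \<open>Z\<close> is nonnegative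
  left of \<open>u\<close>, where all factors are.\<close>

lemma posfrac_interpolation:
  assumes "posfrac u f" "\<And>x. x \<in> set xs \<Longrightarrow> x \<ge> u"
  shows "\<exists>Z g. posfrac u g \<and> chebspan (length xs - 1) Z \<and> (xs = [] \<longrightarrow> Z = (\<lambda>_. 0)) \<and>
    (\<forall>t\<ge>u. f t = Z t + (\<Prod>x\<leftarrow>xs. x - t) * g t) \<and> (\<forall>t\<le>u. Z t \<ge> 0)"
  using assms
proof (induction xs arbitrary: f)
  case Nil
  then show ?case
    by (intro exI[of _ "\<lambda>_. 0"] exI[of _ f]) (auto intro: chebspan_const)
next
  case (Cons x xs)
  have xu: "x \<ge> u" using Cons.prems by simp
  obtain f1 where f1: "posfrac u f1" "\<forall>t\<ge>u. f t = f x + (x - t) * f1 t"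
    using posfrac_divided_difference[OF Cons.prems(1) xu] by blast
  obtain Z g where Z: "posfrac u g" "chebspan (length xs - 1) Z" "xs = [] \<longrightarrow> Z = (\<lambda>_. 0)"
    "\<forall>t\<ge>u. f1 t = Z t + (\<Prod>x\<leftarrow>xs. x - t) * g t" "\<forall>t\<le>u. Z t \<ge> 0"
    using Cons.IH[OF f1(1)] Cons.prems(2) by auto
  \<comment> \<open>For \<open>xs = []\<close> the truncated \<open>length xs - 1\<close> would only
    give degree 1 here; the clause \<open>Z = 0\<close> in the claim saves the missing
    degree.\<close>
  have "chebspan (length xs) (\<lambda>t. (x - t) * Z t)"
  proof (cases xs)
    case Nil then show ?thesis using Z(3) by (simp add: chebspan_const)
  next
    case (Cons a list)
    then show ?thesis using chebspan_times_linear[OF Z(2)] by simp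
  qed
  then have "chebspan (length xs) (\<lambda>t. f x + (x - t) * Z t)"
    by (intro chebspan_add chebspan_const)
  moreover have "f x \<ge> 0" using posfrac_nonneg[OF Cons.prems(1) xu] .
  moreover have "f t = f x + (x - t) * Z t + (\<Prod>y\<leftarrow>x # xs. y - t) * g t" if "t \<ge> u" for t
    using f1(2) Z(4) that by (simp add: algebra_simps)
  moreover have "(x - t) * Z t \<ge> 0" if "t \<le> u" for t
    using that xu Z(5) by (intro mult_nonneg_nonneg) auto
  ultimately show ?case using Z(1)
    by (intro exI[of _ "\<lambda>t. f x + (x - t) * Z t"] exI[of _ g]) simp
qed

lemma chebspan_times_squares:
  assumes "chebspan D f"
  shows "chebspan (D + 2 * length xs) (\<lambda>t. (\<Prod>x\<leftarrow>xs. (x - t)\<^sup>2) * f t)"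
proof (induction xs)
  case Nil
  then show ?case using assms by simp
next
  case (Cons x xs)
  have "(\<lambda>t. (\<Prod>y\<leftarrow>x # xs. (y - t)\<^sup>2) * f t) =
    (\<lambda>t. (x - t) * ((x - t) * ((\<Prod>y\<leftarrow>xs. (y - t)\<^sup>2) * f t)))"
    by (rule ext) (simp only: power2_eq_square list.map prod_list.Cons mult.assoc)
  then show ?case
    using chebspan_times_linear[OF chebspan_times_linear[OF Cons, of x], of x] by (simp only:) simp
qed

lemma posfrac_inverse_squares:
  assumes "\<And>x. x \<in> set xs \<Longrightarrow> x < u"
  shows "posfrac u (\<lambda>t. 1 / (\<Prod>x\<leftarrow>xs. (x - t)\<^sup>2))"
  using assms
proof (induction xs)
  case Nil
  then show ?case by (auto intro: posfrac.const)
next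
  case (Cons x xs)
  have "posfrac u (\<lambda>t. 1 / (\<Prod>x\<leftarrow>xs. (x - t)\<^sup>2) / (t - x) / (t - x))"
    using Cons by (intro posfrac.div) auto
  moreover have "(\<lambda>t. 1 / (\<Prod>x\<leftarrow>xs. (x - t)\<^sup>2) / (t - x) / (t - x)) =
      (\<lambda>t. 1 / (\<Prod>y\<leftarrow>x # xs. (y - t)\<^sup>2))"
    by (rule ext) (simp add: power2_eq_square algebra_simps)
  ultimately show ?case by simp
qed

text \<open>
  The majorant is \<open>A * Z\<close>, where \<open>A\<close> is the product of the squares \<open>(x k - t)\<^sup>2\<close> over the nodes to
  the left of \<open>x j\<close>, and \<open>Z\<close> interpolates \<open>1 / A\<close> at \<open>x j\<close> and, doubly, at the nodes to the right.
\<close>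

lemma half_line_majorant:
  fixes x :: "nat \<Rightarrow> real"
  assumes dec: "\<And>k l. 1 \<le> k \<Longrightarrow> k < l \<Longrightarrow> l \<le> D \<Longrightarrow> x l < x k" and j: "1 \<le> j" "j \<le> D"
  shows "\<exists>P. chebspan (2 * D - 2) P \<and> (\<forall>t. P t \<ge> 0) \<and> (\<forall>t\<ge>x j. P t \<ge> 1) \<and>
    (\<forall>k\<in>{1..j}. P (x k) = 1) \<and> (\<forall>k\<in>{j<..D}. P (x k) = 0)"
proof -
  define as where "as = map x [Suc j..<Suc D]"
  define xs where "xs = map x [1..<j]"
  define ys where "ys = x j # xs @ xs"
  have asu: "a < x j" if "a \<in> set as" for a
    using that dec j unfolding as_def by auto
  have xsu: "y > x j" if "y \<in> set xs" for y
    using that dec j unfolding xs_def by auto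
  then have ysu: "y \<ge> x j" if "y \<in> set ys" for y
    using that unfolding ys_def by fastforce
  define A where "A = (\<lambda>t. \<Prod>a\<leftarrow>as. (a - t)\<^sup>2)"
  have A0: "A t \<ge> 0" for t unfolding A_def by (intro prod_list_nonneg) auto
  have Apos: "A t > 0" if "t \<ge> x j" for t
    unfolding A_def using asu that by (induction as) (force intro!: mult_pos_pos)+
  obtain Z g where Z: "posfrac (x j) g" "chebspan (length ys - 1) Z"
    "\<forall>t\<ge>x j. 1 / A t = Z t + (\<Prod>y\<leftarrow>ys. y - t) * g t" "\<forall>t\<le>x j. Z t \<ge> 0"
    using posfrac_interpolation[OF posfrac_inverse_squares[of as "x j"] ysu] asu
    unfolding A_def by blast
  \<comment> \<open>The node \<open>x j\<close> occurs once and the nodes to its right twice, so the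
    remainder is nonpositive to the right of \<open>x j\<close>, and \<open>Z\<close> lies above
    \<open>1 / A\<close> there.\<close>
  have prod: "(\<Prod>y\<leftarrow>ys. y - t) = (x j - t) * (\<Prod>y\<leftarrow>xs. y - t)\<^sup>2" for t
    unfolding ys_def by (simp add: power2_eq_square)
  have ZA: "Z t \<ge> 1 / A t" if "t \<ge> x j" for t
  proof -
    have "(\<Prod>y\<leftarrow>ys. y - t) * g t \<le> 0"
      unfolding prod using that posfrac_nonneg[OF Z(1) that]
      by (intro mult_nonpos_nonneg) auto
    then show ?thesis using Z(3) that by fastforce
  qed
  have Z0: "Z t \<ge> 0" for t
    using Z(4) ZA[of t] Apos[of t] by (cases "t \<le> x j") (force, smt (verit) divide_pos_pos)
  \<comment> \<open>\<open>Z\<close> contributes \<open>2 * (j - 1)\<close> and \<open>A\<close>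
    contributes \<open>2 * (D - j)\<close>. The sum is one less than the degree up to which the
    quadrature with \<open>D\<close> nodes is exact.\<close>
  have "length ys - 1 + 2 * length as = 2 * D - 2"
    using j unfolding ys_def xs_def as_def by (simp del: upt_Suc)
  then have "chebspan (2 * D - 2) (\<lambda>t. A t * Z t)"
    using chebspan_times_squares[OF Z(2), of as] unfolding A_def by simp
  moreover have "A t * Z t \<ge> 1" if "t \<ge> x j" for t
    using ZA[OF that] Apos[OF that] by (simp add: field_simps)
  moreover have "A (x k) * Z (x k) = 1" if "k \<in> {1..j}" for k
  proof -
    have "x k \<in> set ys" using that unfolding ys_def xs_def by (cases "k = j") auto
    then have "(\<Prod>y\<leftarrow>ys. y - x k) = 0" by (auto simp: prod_list_zero_iff)
    then have "1 / A (x k) = Z (x k)" using Z(3) ysu[OF \<open>x k \<in> set ys\<close>] by simp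
    then show ?thesis using Apos[OF ysu[OF \<open>x k \<in> set ys\<close>]] by (simp add: field_simps)
  qed
  moreover have "A (x k) = 0" if "k \<in> {j<..D}" for k
  proof -
    have "k \<in> set [Suc j..<Suc D]" using that by (auto simp del: upt_Suc)
    then have "x k \<in> set as" unfolding as_def by (simp del: upt_Suc)
    then show ?thesis unfolding A_def by (auto simp: prod_list_zero_iff)
  qed
  ultimately show ?thesis
    using A0 Z0 by (intro exI[of _ "\<lambda>t. A t * Z t"]) auto
qed

section \<open>Gauss quadrature for the semicircle law\<close>

lemma sum_cos_telescope:
  "2 * sin (\<beta> / 2) * (\<Sum>m=1..D. cos (real m * \<beta>)) = sin ((real D + 1 / 2) * \<beta>) - sin (\<beta> / 2)"
proof (induction D)
  case (Suc D)
  have "2 * sin (\<beta> / 2) * cos (real (Suc D) * \<beta>) =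
      sin (\<beta> / 2 + real (Suc D) * \<beta>) + sin (\<beta> / 2 - real (Suc D) * \<beta>)"
    by (simp only: sin_add sin_diff)
  moreover have "\<beta> / 2 + real (Suc D) * \<beta> = (real (Suc D) + 1 / 2) * \<beta>"
    "\<beta> / 2 - real (Suc D) * \<beta> = - ((real D + 1 / 2) * \<beta>)" by (simp_all add: algebra_simps)
  ultimately have *: "2 * sin (\<beta> / 2) * cos (real (Suc D) * \<beta>) =
      sin ((real (Suc D) + 1 / 2) * \<beta>) - sin ((real D + 1 / 2) * \<beta>)" by simp
  have "2 * sin (\<beta> / 2) * (\<Sum>m=1..Suc D. cos (real m * \<beta>)) =
    2 * sin (\<beta> / 2) * (\<Sum>m=1..D. cos (real m * \<beta>)) + 2 * sin (\<beta> / 2) * cos (real (Suc D) * \<beta>)"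
    by (simp add: distrib_left)
  also have "\<dots> = sin ((real (Suc D) + 1 / 2) * \<beta>) - sin (\<beta> / 2)"
    by (simp only: Suc.IH *)
  finally show ?case .
qed simp

lemma sum_cos_equidistant:
  assumes "0 < k" "k < 2 * Suc D"
  shows "(\<Sum>m=1..D. cos (real k * (real m * pi / real (Suc D)))) = - (1 + (-1) ^ k) / 2"
proof -
  define \<beta> where "\<beta> = real k * pi / real (Suc D)"
  have "\<beta> / 2 = (real k / (2 * real (Suc D))) * pi" by (simp add: \<beta>_def)
  moreover have "0 < real k / (2 * real (Suc D))" using assms by simp
  moreover have "real k < real (2 * Suc D)" using assms by (simp only: of_nat_less_iff)
  then have "real k / (2 * real (Suc D)) < 1" by simp
  ultimately have "0 < \<beta> / 2" "\<beta> / 2 < 1 * pi"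
    by (metis mult_pos_pos pi_gt_zero, metis mult_strict_right_mono pi_gt_zero)
  then have s: "sin (\<beta> / 2) \<noteq> 0" using sin_gt_zero[of "\<beta> / 2"] by simp
  have "(real D + 1 / 2) * \<beta> = (real D + 1) * \<beta> - \<beta> / 2" by (simp add: algebra_simps)
  also have "(real D + 1) * \<beta> = real k * pi" by (simp add: \<beta>_def field_simps)
  finally have "sin ((real D + 1 / 2) * \<beta>) = - ((-1) ^ k) * sin (\<beta> / 2)"
    by (simp add: sin_diff cos_npi sin_npi)
  then have "2 * sin (\<beta> / 2) * (\<Sum>m=1..D. cos (real m * \<beta>)) = sin (\<beta> / 2) * (- (1 + (-1) ^ k))"
    unfolding sum_cos_telescope by (simp add: algebra_simps)
  then have "(\<Sum>m=1..D. cos (real m * \<beta>)) = - (1 + (-1) ^ k) / 2"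
    using s by simp
  moreover have "real k * (real m * pi / real (Suc D)) = real m * \<beta>" for m
    by (simp add: \<beta>_def)
  ultimately show ?thesis by simp
qed

text \<open>Together with \<open>gauss_weight\<close> and \<open>gauss_node\<close> this is the
  Gauss quadrature for the density \<open>sqrt (4 - t^2) / (2 * pi)\<close>: the nodes
  \<open>2 * cos (m * pi / (D + 1))\<close> are the \<open>D\<close> zeros of
  \<open>chebU D\<close>.\<close>

definition gauss_angle :: "nat \<Rightarrow> nat \<Rightarrow> real" where
  "gauss_angle D m = real m * pi / real (Suc D)"

definition gauss_weight :: "nat \<Rightarrow> nat \<Rightarrow> real" where
  "gauss_weight D m = 2 / real (Suc D) * (sin (gauss_angle D m))\<^sup>2"

definition gauss_node :: "nat \<Rightarrow> nat \<Rightarrow> real" where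
  "gauss_node D m = 2 * cos (gauss_angle D m)"

lemma gauss_angle_bounds:
  assumes "1 \<le> m" "m \<le> D"
  shows "0 < gauss_angle D m" "gauss_angle D m < pi"
proof -
  show "0 < gauss_angle D m" using assms by (simp add: gauss_angle_def)
  have "real m < real (Suc D)" using assms by simp
  then have "real m / real (Suc D) < 1" by simp
  then have "(real m / real (Suc D)) * pi < 1 * pi" by (intro mult_strict_right_mono) auto
  then show "gauss_angle D m < pi" by (simp add: gauss_angle_def)
qed

lemma sin_gauss_angle_pos: "1 \<le> m \<Longrightarrow> m \<le> D \<Longrightarrow> sin (gauss_angle D m) > 0"
  by (intro sin_gt_zero gauss_angle_bounds)

lemma gauss_weight_nonneg: "gauss_weight D m \<ge> 0"
  by (simp add: gauss_weight_def)

lemma gauss_node_decreasing: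
  assumes "1 \<le> k" "k < l" "l \<le> D"
  shows "gauss_node D l < gauss_node D k"
proof -
  have "gauss_angle D k < gauss_angle D l"
    using assms unfolding gauss_angle_def
    by (intro divide_strict_right_mono mult_strict_right_mono) auto
  then show ?thesis
    using gauss_angle_bounds[of k D] gauss_angle_bounds[of l D] assms
    by (simp add: gauss_node_def cos_monotone_0_pi)
qed

text \<open>Product to sum leaves cosines of frequencies \<open>k - l\<close> and
  \<open>k + l + 2\<close>. These have the same parity, so their equidistant sums cancel if
  \<open>k - l\<close> is positive. For \<open>k = l\<close> the sums are \<open>D\<close> and -1,
  and the difference \<open>D + 1\<close> cancels the normalisation.\<close>

lemma gauss_orthogonality_le:
  assumes "l \<le> k" "k + l < 2 * D"
  shows "(\<Sum>m=1..D. gauss_weight D m * (chebU k (gauss_node D m) * chebU l (gauss_node D m))) =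
    (if k = l then 1 else 0)"
proof -
  let ?\<theta> = "gauss_angle D"
  have "gauss_weight D m * (chebU k (gauss_node D m) * chebU l (gauss_node D m)) =
      (cos (real (k - l) * ?\<theta> m) - cos (real (k + l + 2) * ?\<theta> m)) / real (Suc D)" for m
  proof -
    have "gauss_weight D m * (chebU k (gauss_node D m) * chebU l (gauss_node D m)) =
      2 / real (Suc D) * ((sin (?\<theta> m) * chebU k (2 * cos (?\<theta> m))) * (sin (?\<theta> m) * chebU l (2 * cos (?\<theta> m))))"
      by (simp add: gauss_weight_def gauss_node_def power2_eq_square algebra_simps)
    also have "\<dots> = 2 / real (Suc D) * (sin (real (Suc k) * ?\<theta> m) * sin (real (Suc l) * ?\<theta> m))"
      by (simp only: chebU_2cos)
    also have "\<dots> = (cos (real (Suc k) * ?\<theta> m - real (Suc l) * ?\<theta> m) -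
        cos (real (Suc k) * ?\<theta> m + real (Suc l) * ?\<theta> m)) / real (Suc D)"
      by (simp only: sin_times_sin) (simp add: field_simps del: of_nat_Suc)
    also have "real (Suc k) * ?\<theta> m - real (Suc l) * ?\<theta> m = real (k - l) * ?\<theta> m"
      using assms by (simp add: of_nat_diff algebra_simps)
    also have "real (Suc k) * ?\<theta> m + real (Suc l) * ?\<theta> m = real (k + l + 2) * ?\<theta> m"
      by (simp add: algebra_simps)
    finally show ?thesis .
  qed
  then have eq: "(\<Sum>m=1..D. gauss_weight D m * (chebU k (gauss_node D m) * chebU l (gauss_node D m))) =
      ((\<Sum>m=1..D. cos (real (k - l) * ?\<theta> m)) - (\<Sum>m=1..D. cos (real (k + l + 2) * ?\<theta> m))) / real (Suc D)"
    by (simp add: sum_subtractf flip: sum_divide_distrib)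
  have 2: "(\<Sum>m=1..D. cos (real (k + l + 2) * ?\<theta> m)) = - (1 + (-1) ^ (k + l + 2)) / 2"
    unfolding gauss_angle_def using assms by (intro sum_cos_equidistant) auto
  show ?thesis
  proof (cases "k = l")
    case True
    have "(-1 :: real) ^ (l + l + 2) = 1" by (simp flip: mult_2)
    then show ?thesis using eq 2 True by simp
  next
    case False
    then have 1: "(\<Sum>m=1..D. cos (real (k - l) * ?\<theta> m)) = - (1 + (-1) ^ (k - l)) / 2"
      unfolding gauss_angle_def using assms by (intro sum_cos_equidistant) auto
    have "k + l + 2 = (k - l) + 2 * (l + 1)" using assms by simp
    then have "(-1 :: real) ^ (k + l + 2) = (-1) ^ (k - l)" by (simp only: power_add power_mult) simp
    then show ?thesis using eq 1 2 False by simp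
  qed
qed

lemma gauss_orthogonality:
  assumes "k + l < 2 * D"
  shows "(\<Sum>m=1..D. gauss_weight D m * (chebU k (gauss_node D m) * chebU l (gauss_node D m))) =
    (if k = l then 1 else 0)"
  using gauss_orthogonality_le[of l k D] gauss_orthogonality_le[of k l D] assms
  by (cases "l \<le> k") (auto simp: mult_ac add_ac)

lemma gauss_coefficient:
  assumes "\<And>t. P t = (\<Sum>k\<le>n. c k * chebU k t)" "n + l < 2 * D" "l \<le> n"
  shows "(\<Sum>m=1..D. gauss_weight D m * (P (gauss_node D m) * chebU l (gauss_node D m))) = c l"
proof -
  have "(\<Sum>m=1..D. gauss_weight D m * (P (gauss_node D m) * chebU l (gauss_node D m))) =
    (\<Sum>m=1..D. \<Sum>k\<le>n. c k * (gauss_weight D m * (chebU k (gauss_node D m) * chebU l (gauss_node D m))))"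
    unfolding assms(1) by (simp add: sum_distrib_left sum_distrib_right algebra_simps)
  also have "\<dots> = (\<Sum>k\<le>n. c k * (\<Sum>m=1..D. gauss_weight D m * (chebU k (gauss_node D m) * chebU l (gauss_node D m))))"
    by (subst sum.swap) (simp add: sum_distrib_left)
  also have "\<dots> = (\<Sum>k\<le>n. c k * (if k = l then 1 else 0))"
    using assms(2) by (intro sum.cong refl, subst gauss_orthogonality) auto
  also have "\<dots> = c l" using assms(3) by (simp add: if_distrib[of "\<lambda>x. _ * x"] cong: if_cong)
  finally show ?thesis .
qed

text \<open>
  The quadrature formula is exact for the terms \<open>k = 0\<close> and \<open>k = 1\<close> of the expansion of the
  majorant; the others contribute the error \<open>8 * A * e\<^sup>2\<close>.
\<close>

lemma half_line_weight_le:
  fixes w t :: "'i \<Rightarrow> real"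
  assumes I: "finite I" "\<And>i. i \<in> I \<Longrightarrow> w i \<ge> 0"
    and mom: "\<And>k. k \<le> 2 * D - 2 \<Longrightarrow> \<bar>(\<Sum>i\<in>I. w i * chebU k (t i)) - A * e ^ k\<bar> \<le> E"
    and e: "\<bar>e\<bar> \<le> 1 / 4" and A: "A \<ge> 0" and j: "1 \<le> j" "j \<le> D"
  shows "(\<Sum>i\<in>{i\<in>I. t i \<ge> gauss_node D j}. w i) \<le>
    A * (\<Sum>m=1..j. gauss_weight D m * (1 + e * gauss_node D m)) + 8 * A * e\<^sup>2 + 4 * (real D)\<^sup>2 * E"
proof -
  let ?x = "gauss_node D" and ?g = "gauss_weight D"
  obtain P where P: "chebspan (2 * D - 2) P" "\<And>t. P t \<ge> 0" "\<And>t. t \<ge> ?x j \<Longrightarrow> P t \<ge> 1"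
      "\<And>k. k \<in> {1..j} \<Longrightarrow> P (?x k) = 1" "\<And>k. k \<in> {j<..D} \<Longrightarrow> P (?x k) = 0"
    using half_line_majorant[of D ?x j] gauss_node_decreasing j by blast
  obtain c where c: "\<And>t. P t = (\<Sum>k\<le>2 * D - 2. c k * chebU k t)"
    using P(1) by (auto simp: chebspan_def)
  have E0: "E \<ge> 0" using mom[of 0] by linarith
  have nodes: "(\<Sum>m=1..D. ?g m * (P (?x m) * f m)) = (\<Sum>m=1..j. ?g m * f m)" for f
  proof -
    have "{1..D} = {1..j} \<union> {j<..D}" using j by auto
    then have "(\<Sum>m=1..D. ?g m * (P (?x m) * f m)) =
        (\<Sum>m=1..j. ?g m * (P (?x m) * f m)) + (\<Sum>m\<in>{j<..D}. ?g m * (P (?x m) * f m))"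
      by (simp only:) (rule sum.union_disjoint, auto)
    also have "\<dots> = (\<Sum>m=1..j. ?g m * f m)" using P(4,5) by simp
    finally show ?thesis .
  qed
  have c0: "c 0 = (\<Sum>m=1..j. ?g m)"
    using gauss_coefficient[of P c "2 * D - 2" 0 D, OF c] nodes[of "\<lambda>_. 1"] j by simp
  \<comment> \<open>Here the spare degree is used: \<open>P * chebU 1\<close> has degree
    \<open>2 * D - 1\<close> and is still integrated exactly, so the coefficients 0 and 1 are both
    sums over the nodes where \<open>P\<close> is 0 or 1.\<close>
  have c1: "c 1 = (\<Sum>m=1..j. ?g m * ?x m)" if "D \<ge> 2"
    using gauss_coefficient[of P c "2 * D - 2" 1 D, OF c] nodes[of ?x] that by simp
  \<comment> \<open>The only node is \<open>2 * cos (pi / 2) = 0\<close>.\<close>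
  have c1': "(\<Sum>m=1..j. ?g m * ?x m) = 0" if "D = 1"
    using that j by (simp add: gauss_node_def gauss_angle_def)
  have "c 0 \<le> (\<Sum>m=1..D. ?g m)"
    unfolding c0 using j by (intro sum_mono2) (auto simp: gauss_weight_nonneg)
  also have "\<dots> = 1" using gauss_orthogonality[of 0 0 D] j by simp
  finally have c0_le: "c 0 \<le> 1" .
  have c0_ge: "c 0 \<ge> 0" unfolding c0 by (intro sum_nonneg) (auto simp: gauss_weight_nonneg)
  have ck: "\<bar>c k\<bar> \<le> real (Suc k)" if k: "k \<le> 2 * D - 2" for k
  proof -
    \<comment> \<open>Higher coefficients need exactness up to degree \<open>4 * D - 4\<close>,
      hence twice as many nodes. There \<open>P\<close> is nonnegative with integral
      \<open>c 0\<close>, at most 1, and \<open>chebU k\<close> is at most \<open>k + 1\<close> on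
      the nodes.\<close>
    let ?x' = "gauss_node (2 * D)" and ?g' = "gauss_weight (2 * D)"
    have "c k = (\<Sum>m=1..2*D. ?g' m * (P (?x' m) * chebU k (?x' m)))"
      using gauss_coefficient[of P c "2 * D - 2" k "2 * D", OF c] k j by simp
    also have "\<bar>\<dots>\<bar> \<le> (\<Sum>m=1..2*D. ?g' m * (P (?x' m) * real (Suc k)))"
    proof (rule order_trans[OF sum_abs], rule sum_mono)
      fix m assume m: "m \<in> {1..2*D}"
      have "\<bar>chebU k (?x' m)\<bar> \<le> real (Suc k)"
        unfolding gauss_node_def using m by (intro abs_chebU_2cos_le sin_gauss_angle_pos) auto
      then show "\<bar>?g' m * (P (?x' m) * chebU k (?x' m))\<bar> \<le> ?g' m * (P (?x' m) * real (Suc k))"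
        using gauss_weight_nonneg[of "2 * D" m] P(2)[of "?x' m"]
        by (simp only: abs_mult abs_of_nonneg) (intro mult_left_mono)
    qed
    also have "\<dots> = real (Suc k) * (\<Sum>m=1..2*D. ?g' m * (P (?x' m) * chebU 0 (?x' m)))"
      by (simp add: sum_distrib_left algebra_simps)
    also have "(\<Sum>m=1..2*D. ?g' m * (P (?x' m) * chebU 0 (?x' m))) = c 0"
      using gauss_coefficient[of P c "2 * D - 2" 0 "2 * D", OF c] j by simp
    finally show ?thesis using c0_le by (smt (verit) mult_left_le of_nat_0_le_iff)
  qed
  have "(\<Sum>i\<in>{i\<in>I. t i \<ge> ?x j}. w i) \<le> (\<Sum>i\<in>I. w i * P (t i))"
  proof -
    have "(\<Sum>i\<in>{i\<in>I. t i \<ge> ?x j}. w i) \<le> (\<Sum>i\<in>{i\<in>I. t i \<ge> ?x j}. w i * P (t i))"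
      using mult_left_mono[OF P(3) I(2)] by (intro sum_mono) simp
    also have "\<dots> \<le> (\<Sum>i\<in>I. w i * P (t i))"
      using I P(2) by (intro sum_mono2) auto
    finally show ?thesis .
  qed
  also have "\<dots> = (\<Sum>k\<le>2 * D - 2. c k * (\<Sum>i\<in>I. w i * chebU k (t i)))"
    unfolding c by (simp add: sum_distrib_left algebra_simps) (rule sum.swap)
  also have "\<dots> \<le> (\<Sum>k\<le>2 * D - 2. c k * (A * e ^ k) + real (Suc k) * E)"
  proof (rule sum_mono)
    fix k assume "k \<in> {..2 * D - 2}"
    then have "\<bar>c k\<bar> * \<bar>(\<Sum>i\<in>I. w i * chebU k (t i)) - A * e ^ k\<bar> \<le> real (Suc k) * E"
      using mom[of k] ck[of k] by (intro mult_mono) auto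
    then have "c k * ((\<Sum>i\<in>I. w i * chebU k (t i)) - A * e ^ k) \<le> real (Suc k) * E"
      using abs_ge_self[of "c k * ((\<Sum>i\<in>I. w i * chebU k (t i)) - A * e ^ k)"]
      by (simp only: abs_mult)
    then show "c k * (\<Sum>i\<in>I. w i * chebU k (t i)) \<le> c k * (A * e ^ k) + real (Suc k) * E"
      by (simp add: algebra_simps)
  qed
  also have "\<dots> = A * (\<Sum>k\<le>2 * D - 2. c k * e ^ k) + E * (\<Sum>k\<le>2 * D - 2. real (Suc k))"
    by (simp add: sum.distrib sum_distrib_left algebra_simps)
  also have "\<dots> \<le> A * ((\<Sum>m=1..j. ?g m * (1 + e * ?x m)) + 8 * e\<^sup>2) + E * (4 * (real D)\<^sup>2)"
  proof (intro add_mono mult_left_mono A E0)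
    have "(\<Sum>k\<le>2 * D - 2. real (Suc k)) \<le> (\<Sum>k\<le>2 * D - 2. 2 * real D)"
      using j by (intro sum_mono) auto
    also have "\<dots> = real (2 * D - 1) * (2 * real D)" using j by (simp add: of_nat_diff)
    also have "\<dots> \<le> (2 * real D) * (2 * real D)" by (intro mult_right_mono) auto
    finally show "(\<Sum>k\<le>2 * D - 2. real (Suc k)) \<le> 4 * (real D)\<^sup>2" by (simp add: power2_eq_square)
    have S: "(\<Sum>m=1..j. ?g m * (1 + e * ?x m)) = c 0 + e * (\<Sum>m=1..j. ?g m * ?x m)"
      unfolding c0 by (simp add: distrib_left sum.distrib sum_distrib_left algebra_simps)
    show "(\<Sum>k\<le>2 * D - 2. c k * e ^ k) \<le> (\<Sum>m=1..j. ?g m * (1 + e * ?x m)) + 8 * e\<^sup>2"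
    proof (cases "D = 1")
      case True
      then show ?thesis using S c1' by simp
    next
      case False
      then have D2: "D \<ge> 2" using j by simp
      have "{..2 * D - 2} = {0, 1} \<union> {2..2 * D - 2}" using D2 by auto
      then have "(\<Sum>k\<le>2 * D - 2. c k * e ^ k) = (\<Sum>k\<in>{0, 1}. c k * e ^ k) + (\<Sum>k=2..2 * D - 2. c k * e ^ k)"
        by (simp only:) (rule sum.union_disjoint, auto)
      also have "(\<Sum>k\<in>{0, 1}. c k * e ^ k) = (\<Sum>m=1..j. ?g m * (1 + e * ?x m))"
        unfolding S using c1[OF D2] by simp
      also have "(\<Sum>k=2..2 * D - 2. c k * e ^ k) \<le> (\<Sum>k=2..2 * D - 2. (2 * \<bar>e\<bar>) ^ k)"
      proof (rule sum_mono)
        fix k assume k: "k \<in> {2..2 * D - 2}"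
        \<comment> \<open>This absorbs the bound of the coefficients into a geometric series of
          ratio at most 1/2; it starts at \<open>k = 2\<close> and thus is of order
          \<open>e^2\<close>.\<close>
        have "real (Suc k) \<le> 2 ^ k" using k
          by (metis Suc_leI less_exp of_nat_le_iff of_nat_numeral of_nat_power)
        then have "\<bar>c k\<bar> * \<bar>e\<bar> ^ k \<le> 2 ^ k * \<bar>e\<bar> ^ k"
          using ck[of k] k by (intro mult_right_mono) auto
        then show "c k * e ^ k \<le> (2 * \<bar>e\<bar>) ^ k"
          using abs_ge_self[of "c k * e ^ k"] by (simp only: abs_mult power_abs power_mult_distrib)
      qed
      also have "\<dots> \<le> 8 * e\<^sup>2"
      proof -
        have "(\<Sum>k=2..2 * D - 2. (2 * \<bar>e\<bar>) ^ k) = (2 * \<bar>e\<bar>)\<^sup>2 * (\<Sum>k=2..2 * D - 2. (2 * \<bar>e\<bar>) ^ (k - 2))"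
          unfolding sum_distrib_left
          by (intro sum.cong refl) (metis atLeastAtMost_iff le_add_diff_inverse power_add)
        also have "\<dots> \<le> (2 * \<bar>e\<bar>)\<^sup>2 * (\<Sum>k=2..2 * D - 2. (1 / 2) ^ (k - 2))"
          using e by (intro mult_left_mono sum_mono power_mono) auto
        also have "\<dots> \<le> (2 * \<bar>e\<bar>)\<^sup>2 * 2"
        proof (rule mult_left_mono)
          have "(\<Sum>k=2..2 * D - 2. (1 / 2 :: real) ^ (k - 2)) = (\<Sum>k\<le>2 * D - 4. (1 / 2) ^ k)"
            using D2 by (intro sum.reindex_bij_witness[of _ "\<lambda>k. k + 2" "\<lambda>k. k - 2"]) auto
          also have "\<dots> = (\<Sum>k<Suc (2 * D - 4). (1 / 2 :: real) ^ k)" by (simp only: lessThan_Suc_atMost)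
          also have "\<dots> \<le> 2" by (subst geometric_sum) auto
          finally show "(\<Sum>k=2..2 * D - 2. (1 / 2 :: real) ^ (k - 2)) \<le> 2" .
        qed simp
        finally show ?thesis by (simp add: power_mult_distrib)
      qed
      finally show ?thesis by simp
    qed
  qed
  finally show ?thesis by (simp add: algebra_simps)
qed

section \<open>Measures with nearly semicircular moments\<close>

text \<open>The mass that the density \<open>sqrt (4 - t^2) * (1 + e * t) / (2 * pi)\<close> puts on
  \<open>t\<close> above \<open>2 * cos \<theta>\<close>: an upper tail in \<open>t\<close>, but
  increasing in the angle.\<close>

definition semicircle_cdf :: "real \<Rightarrow> real \<Rightarrow> real" where
  "semicircle_cdf e \<theta> = (\<theta> - sin \<theta> * cos \<theta>) / pi + 4 * e / (3 * pi) * (sin \<theta>) ^ 3"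

lemma semicircle_cdf_deriv:
  "(semicircle_cdf e has_real_derivative 2 / pi * ((sin \<theta>)\<^sup>2 * (1 + 2 * e * cos \<theta>))) (at \<theta>)"
proof -
  have "(semicircle_cdf e has_real_derivative
      (1 - (cos \<theta> * cos \<theta> - sin \<theta> * sin \<theta>)) / pi + 4 * e / (3 * pi) * (3 * (sin \<theta>)\<^sup>2 * cos \<theta>)) (at \<theta>)"
    unfolding semicircle_cdf_def [abs_def]
    by (auto intro!: derivative_eq_intros simp: power2_eq_square)
  moreover have "1 - (cos \<theta> * cos \<theta> - sin \<theta> * sin \<theta>) = 2 * (sin \<theta>)\<^sup>2"
    using sin_cos_squared_add[of \<theta>] by (simp add: power2_eq_square)
  ultimately have "(semicircle_cdf e has_real_derivative
      2 * (sin \<theta>)\<^sup>2 / pi + 4 * e / (3 * pi) * (3 * (sin \<theta>)\<^sup>2 * cos \<theta>)) (at \<theta>)"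
    by simp
  moreover have "2 * (sin \<theta>)\<^sup>2 / pi + 4 * e / (3 * pi) * (3 * (sin \<theta>)\<^sup>2 * cos \<theta>) =
      2 / pi * ((sin \<theta>)\<^sup>2 * (1 + 2 * e * cos \<theta>))" by (simp add: field_simps)
  ultimately show ?thesis by simp
qed

lemma semicircle_cdf_0 [simp]: "semicircle_cdf e 0 = 0"
  and semicircle_cdf_pi [simp]: "semicircle_cdf e pi = 1"
  by (simp_all add: semicircle_cdf_def)

lemma semicircle_cdf_reflect: "semicircle_cdf (- e) (pi - \<theta>) = 1 - semicircle_cdf e \<theta>"
  by (simp add: semicircle_cdf_def sin_diff cos_diff field_simps)

lemma semicircle_density_bounds:
  assumes "\<bar>e\<bar> \<le> 1 / 4"
  shows "0 \<le> 2 / pi * ((sin \<theta>)\<^sup>2 * (1 + 2 * e * cos \<theta>))" (is "0 \<le> ?f")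
    and "2 / pi * ((sin \<theta>)\<^sup>2 * (1 + 2 * e * cos \<theta>)) \<le> 1"
proof -
  have "\<bar>e * cos \<theta>\<bar> \<le> 1 / 4 * 1"
    unfolding abs_mult using assms by (intro mult_mono) auto
  then have *: "1 / 2 \<le> 1 + 2 * e * cos \<theta>" "1 + 2 * e * cos \<theta> \<le> 3 / 2" by auto
  then show "0 \<le> ?f" by (intro mult_nonneg_nonneg) auto
  have "(sin \<theta>)\<^sup>2 * (1 + 2 * e * cos \<theta>) \<le> 1 * (3 / 2)"
    using * by (intro mult_mono) (auto simp: abs_square_le_1)
  then have "?f \<le> 2 / pi * (3 / 2)" by (intro mult_left_mono) auto
  also have "\<dots> \<le> 1" using pi_gt3 by simp
  finally show "?f \<le> 1" .
qed

lemma semicircle_cdf_increment: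
  assumes "\<bar>e\<bar> \<le> 1 / 4" "a \<le> b"
  shows "0 \<le> semicircle_cdf e b - semicircle_cdf e a" "semicircle_cdf e b - semicircle_cdf e a \<le> b - a"
proof -
  have "\<exists>z. semicircle_cdf e b - semicircle_cdf e a = (b - a) * (2 / pi * ((sin z)\<^sup>2 * (1 + 2 * e * cos z)))"
  proof (cases "a = b")
    case False
    then show ?thesis
      using MVT2[of a b "semicircle_cdf e"] assms(2) semicircle_cdf_deriv by fastforce
  qed auto
  then obtain z where z: "semicircle_cdf e b - semicircle_cdf e a = (b - a) * (2 / pi * ((sin z)\<^sup>2 * (1 + 2 * e * cos z)))"
    by blast
  show "0 \<le> semicircle_cdf e b - semicircle_cdf e a"
    unfolding z using semicircle_density_bounds[OF assms(1), of z] assms(2)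
    by (intro mult_nonneg_nonneg[of "b - a"]) simp_all
  show "semicircle_cdf e b - semicircle_cdf e a \<le> b - a"
    unfolding z using semicircle_density_bounds[OF assms(1), of z] assms(2)
      mult_left_mono[of "2 / pi * ((sin z)\<^sup>2 * (1 + 2 * e * cos z))" 1 "b - a"] by simp
qed

lemma semicircle_density_lipschitz:
  fixes e a b :: real
  assumes e: "\<bar>e\<bar> \<le> 1 / 4" and "a < b"
  shows "\<bar>(sin b)\<^sup>2 * (1 + 2 * e * cos b) - (sin a)\<^sup>2 * (1 + 2 * e * cos a)\<bar> \<le> 7 / 2 * (b - a)"
proof -
  let ?f = "\<lambda>x::real. (sin x)\<^sup>2 * (1 + 2 * e * cos x)"
  let ?f' = "\<lambda>x::real. 2 * (sin x * cos x) * (1 + 2 * (e * cos x)) - 2 * (e * (sin x) ^ 3)"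
  have "(?f has_real_derivative ?f' x) (at x)" for x
    by (auto intro!: derivative_eq_intros simp: power2_eq_square power3_eq_cube algebra_simps)
  then obtain z where z: "?f b - ?f a = (b - a) * ?f' z"
    using MVT2[OF assms(2), of ?f ?f'] by blast
  have "\<bar>e * cos z\<bar> \<le> 1 / 4 * 1" unfolding abs_mult using e by (intro mult_mono) auto
  then have "\<bar>1 + 2 * (e * cos z)\<bar> \<le> 3 / 2" by auto
  moreover have "\<bar>sin z * cos z\<bar> \<le> 1 * 1" unfolding abs_mult by (intro mult_mono) auto
  ultimately have "\<bar>2 * (sin z * cos z) * (1 + 2 * (e * cos z))\<bar> \<le> 2 * (1 * 1) * (3 / 2)"
    unfolding abs_mult by (intro mult_mono) auto
  moreover have "\<bar>e * (sin z) ^ 3\<bar> \<le> 1 / 4 * 1"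
    unfolding abs_mult using e by (intro mult_mono) (auto simp: power_abs intro!: power_le_one)
  ultimately have "\<bar>?f' z\<bar> \<le> 7 / 2" by linarith
  then have "(b - a) * \<bar>?f' z\<bar> \<le> (b - a) * (7 / 2)"
    using assms(2) by (intro mult_left_mono) simp_all
  then show ?thesis unfolding z abs_mult using assms(2) by simp
qed

text \<open>In the angle the quadrature is a Riemann sum with right end points and step
  \<open>h = pi / (D + 1)\<close> for the derivative of \<open>semicircle_cdf\<close>. By the
  Lipschitz constant 7/2 each step costs at most
  \<open>h * (2 / pi) * (7 / 2) * h = 7 * pi / (D + 1)^2\<close>, and
  \<open>7 * pi < 22\<close>.\<close>

lemma gauss_riemann_sum:
  assumes e: "\<bar>e\<bar> \<le> 1 / 4"
  shows "(\<Sum>m=1..j. gauss_weight D m * (1 + e * gauss_node D m)) \<le>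
    semicircle_cdf e (gauss_angle D j) + real j * (22 / (real (Suc D))\<^sup>2)"
proof (induction j)
  case 0
  then show ?case by (simp add: gauss_angle_def)
next
  case (Suc j)
  let ?f = "\<lambda>x::real. (sin x)\<^sup>2 * (1 + 2 * e * cos x)"
  define a where "a = gauss_angle D j"
  define b where "b = gauss_angle D (Suc j)"
  have ba: "b - a = pi / real (Suc D)"
    by (simp add: a_def b_def gauss_angle_def diff_divide_distrib [symmetric] algebra_simps del: of_nat_Suc) (simp add: field_simps)
  then have "a < b" by (smt (verit) divide_pos_pos of_nat_0_less_iff pi_gt_zero zero_less_Suc)
  have w: "gauss_weight D (Suc j) * (1 + e * gauss_node D (Suc j)) = (b - a) * (2 / pi * ?f b)"
    unfolding ba by (simp add: gauss_weight_def gauss_node_def b_def)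
  obtain z where z: "a < z" "z < b" "semicircle_cdf e b - semicircle_cdf e a = (b - a) * (2 / pi * ?f z)"
    using MVT2[OF \<open>a < b\<close>, of "semicircle_cdf e" "\<lambda>x. 2 / pi * ?f x"] semicircle_cdf_deriv by blast
  have "?f b - ?f z \<le> 7 / 2 * (b - a)"
  proof -
    have "7 / 2 * (b - z) \<le> 7 / 2 * (b - a)" using z(1) by simp
    then show ?thesis
      using abs_le_D1[OF semicircle_density_lipschitz[OF e z(2)]] by (rule order_trans[rotated])
  qed
  then have "?f b \<le> ?f z + 7 / 2 * (b - a)" by linarith
  then have "(b - a) * (2 / pi * ?f b) \<le> (b - a) * (2 / pi * (?f z + 7 / 2 * (b - a)))"
    using \<open>a < b\<close> by (intro mult_left_mono) simp_all
  also have "\<dots> = semicircle_cdf e b - semicircle_cdf e a + (b - a) * (2 / pi * (7 / 2 * (b - a)))"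
    unfolding z(3) by (simp only: distrib_left)
  also have "(b - a) * (2 / pi * (7 / 2 * (b - a))) = 7 * pi / (real (Suc D))\<^sup>2"
    unfolding ba by (simp add: power2_eq_square field_simps del: of_nat_Suc)
  also have "\<dots> \<le> 22 / (real (Suc D))\<^sup>2"
    using pi_less_4 pi_approx by (intro divide_right_mono) auto
  finally have "gauss_weight D (Suc j) * (1 + e * gauss_node D (Suc j)) \<le>
    semicircle_cdf e b - semicircle_cdf e a + 22 / (real (Suc D))\<^sup>2" unfolding w by simp
  moreover have "real (Suc j) * (22 / (real (Suc D))\<^sup>2) =
    real j * (22 / (real (Suc D))\<^sup>2) + 22 / (real (Suc D))\<^sup>2"
    by (simp only: of_nat_Suc distrib_right mult_1_left add.commute)
  moreover have "(\<Sum>m=1..Suc j. gauss_weight D m * (1 + e * gauss_node D m)) =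
    (\<Sum>m=1..j. gauss_weight D m * (1 + e * gauss_node D m)) +
    gauss_weight D (Suc j) * (1 + e * gauss_node D (Suc j))" by simp
  ultimately show ?case using Suc unfolding a_def b_def by linarith
qed

text \<open>The constant 26 is 22 for the Riemann sum plus 4, which exceeds \<open>pi\<close>, for
  rounding an angle up to a node. The second term is the truncation at \<open>1 + e * t\<close>. Of
  the last term, \<open>4 * D^2 * E\<close> comes from the coefficients; the rest is at least one
  \<open>E\<close>, kept in reserve for replacing the total weight by \<open>A\<close>.\<close>

definition quadrature_error :: "real \<Rightarrow> real \<Rightarrow> real \<Rightarrow> nat \<Rightarrow> real" where
  "quadrature_error A e E D = A * (26 / real (Suc D)) + 8 * A * e\<^sup>2 + 5 * (real D)\<^sup>2 * E"

locale near_semicircle =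
  fixes I :: "'i set" and w t :: "'i \<Rightarrow> real" and A e E :: real and D :: nat
  assumes finite_I: "finite I" and w_nonneg: "i \<in> I \<Longrightarrow> w i \<ge> 0"
    and moments: "k \<le> 2 * D - 2 \<Longrightarrow> \<bar>(\<Sum>i\<in>I. w i * chebU k (t i)) - A * e ^ k\<bar> \<le> E"
    and e_small: "\<bar>e\<bar> \<le> 1 / 4" and A_nonneg: "A \<ge> 0" and D_pos: "D \<ge> 1"
begin

abbreviation "error \<equiv> quadrature_error A e E D"

lemma E_nonneg: "E \<ge> 0"
  using moments[of 0] by linarith

lemma E_le: "E \<le> (real D)\<^sup>2 * E"
proof -
  have "1\<^sup>2 \<le> (real D)\<^sup>2" using D_pos by (intro power_mono) auto
  then have "1 * E \<le> (real D)\<^sup>2 * E" by (intro mult_right_mono E_nonneg) simp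
  then show ?thesis by simp
qed

lemma total: "\<bar>(\<Sum>i\<in>I. w i) - A\<bar> \<le> E"
  using moments[of 0] by simp

lemma error_ge: "4 * A / real (Suc D) + E \<le> error - E"
proof -
  have "A / real (Suc D) \<ge> 0" "A * e\<^sup>2 \<ge> 0" using A_nonneg by simp_all
  moreover have "A * (26 / real (Suc D)) = 26 * (A / real (Suc D))"
    "4 * A / real (Suc D) = 4 * (A / real (Suc D))" by simp_all
  ultimately show ?thesis using E_le E_nonneg unfolding quadrature_error_def by linarith
qed

text \<open>The angle is rounded up to the next node, at least the first one, and
  \<open>semicircle_cdf\<close> grows by at most the change of angle. If there is no node left, the
  angle is within \<open>pi / (D + 1)\<close> of \<open>pi\<close>, the tail is nearly everything,
  and the total weight is bound enough.\<close>

lemma weight_ge_2cos: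
  assumes "0 \<le> \<theta>" "\<theta> \<le> pi"
  shows "(\<Sum>i\<in>{i\<in>I. t i \<ge> 2 * cos \<theta>}. w i) \<le> A * semicircle_cdf e \<theta> + (error - E)"
proof -
  define j where "j = max 1 (nat \<lceil>\<theta> * real (Suc D) / pi\<rceil>)"
  have x0: "\<theta> * real (Suc D) / pi \<ge> 0" using assms by simp
  have "real (nat \<lceil>\<theta> * real (Suc D) / pi\<rceil>) \<ge> \<theta> * real (Suc D) / pi" by linarith
  then have jge: "real j \<ge> \<theta> * real (Suc D) / pi" unfolding j_def by linarith
  have "real (nat \<lceil>\<theta> * real (Suc D) / pi\<rceil>) \<le> \<theta> * real (Suc D) / pi + 1" using x0 by linarith
  then have jle: "real j \<le> \<theta> * real (Suc D) / pi + 1" unfolding j_def using x0 by linarith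
  have ang: "\<theta> \<le> gauss_angle D j"
    using jge by (simp add: gauss_angle_def field_simps del: of_nat_Suc)
  have "gauss_angle D j \<le> \<theta> + pi / real (Suc D)"
    using jle by (simp add: gauss_angle_def field_simps del: of_nat_Suc)
  then have ang': "gauss_angle D j \<le> \<theta> + 4 / real (Suc D)"
    using pi_less_4 divide_right_mono[of pi 4 "real (Suc D)"] by linarith
  show ?thesis
  proof (cases "j \<le> D")
    case True
    have j1: "1 \<le> j" by (simp add: j_def)
    have "(\<Sum>i\<in>{i\<in>I. t i \<ge> 2 * cos \<theta>}. w i) \<le> (\<Sum>i\<in>{i\<in>I. t i \<ge> gauss_node D j}. w i)"
    proof (rule sum_mono2)
      have "gauss_node D j \<le> 2 * cos \<theta>"
        using gauss_angle_bounds[OF j1 True] ang assms(1)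
        unfolding gauss_node_def by (simp add: cos_monotone_0_pi_le)
      then show "{i\<in>I. t i \<ge> 2 * cos \<theta>} \<subseteq> {i\<in>I. t i \<ge> gauss_node D j}" by auto
    qed (use finite_I w_nonneg in auto)
    also have "\<dots> \<le> A * (\<Sum>m=1..j. gauss_weight D m * (1 + e * gauss_node D m)) + 8 * A * e\<^sup>2 + 4 * (real D)\<^sup>2 * E"
      by (rule half_line_weight_le[OF finite_I w_nonneg moments e_small A_nonneg j1 True])
    also have "A * (\<Sum>m=1..j. gauss_weight D m * (1 + e * gauss_node D m)) \<le>
        A * (semicircle_cdf e \<theta> + 26 / real (Suc D))"
    proof (rule mult_left_mono[OF _ A_nonneg])
      have "real j * (22 / (real (Suc D))\<^sup>2) \<le> real (Suc D) * (22 / (real (Suc D))\<^sup>2)"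
        using True by (intro mult_right_mono) auto
      also have "\<dots> = 22 / real (Suc D)" by (simp add: power2_eq_square del: of_nat_Suc)
      finally have "real j * (22 / (real (Suc D))\<^sup>2) \<le> 22 / real (Suc D)" .
      moreover have "22 / real (Suc D) + 4 / real (Suc D) = 26 / real (Suc D)"
        by (simp flip: add_divide_distrib)
      ultimately show "(\<Sum>m=1..j. gauss_weight D m * (1 + e * gauss_node D m)) \<le>
          semicircle_cdf e \<theta> + 26 / real (Suc D)"
        using gauss_riemann_sum[OF e_small, of D j] semicircle_cdf_increment(2)[OF e_small ang] ang'
        by linarith
    qed
    finally have "(\<Sum>i\<in>{i\<in>I. t i \<ge> 2 * cos \<theta>}. w i) \<le>
        A * (semicircle_cdf e \<theta> + 26 / real (Suc D)) + 8 * A * e\<^sup>2 + 4 * (real D)\<^sup>2 * E"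
      by simp
    then show ?thesis using E_le unfolding quadrature_error_def distrib_left by linarith
  next
    case False
    then have "real (Suc D) \<le> real j" by simp
    then have "pi * real (Suc D) \<le> pi * real j" by simp
    moreover have "pi * real j \<le> pi + \<theta> * real (Suc D)"
      using jle by (simp add: field_simps del: of_nat_Suc)
    ultimately have "pi * real (Suc D) \<le> pi + \<theta> * real (Suc D)" by linarith
    then have "pi \<le> \<theta> + pi / real (Suc D)"
      by (simp add: field_simps del: of_nat_Suc)
    then have "pi \<le> \<theta> + 4 / real (Suc D)"
      using pi_less_4 divide_right_mono[of pi 4 "real (Suc D)"] by linarith
    then have "1 \<le> semicircle_cdf e \<theta> + 4 / real (Suc D)"
      using semicircle_cdf_increment(2)[OF e_small assms(2)] by simp
    then have "A * 1 \<le> A * (semicircle_cdf e \<theta> + 4 / real (Suc D))"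
      by (intro mult_left_mono A_nonneg)
    moreover have "(\<Sum>i\<in>{i\<in>I. t i \<ge> 2 * cos \<theta>}. w i) \<le> (\<Sum>i\<in>I. w i)"
      using finite_I w_nonneg by (intro sum_mono2) auto
    ultimately have "(\<Sum>i\<in>{i\<in>I. t i \<ge> 2 * cos \<theta>}. w i) \<le> A * semicircle_cdf e \<theta> + 4 * A / real (Suc D) + E"
      using total by (simp add: algebra_simps)
    then show ?thesis using error_ge by linarith
  qed
qed

end

context near_semicircle
begin

text \<open>Reflection turns bounds for right half lines into bounds for left ones. The latter give
  lower bounds for right half lines by passing to the complement.\<close>

lemma reflected: "near_semicircle I w (\<lambda>i. - t i) A (- e) E D"
proof
  fix k assume k: "k \<le> 2 * D - 2"
  have "(\<Sum>i\<in>I. w i * chebU k (- t i)) = (-1) ^ k * (\<Sum>i\<in>I. w i * chebU k (t i))"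
    by (simp add: chebU_uminus sum_distrib_left algebra_simps)
  moreover have "A * (- e) ^ k = (-1) ^ k * (A * e ^ k)"
    by (simp only: power_minus[of e] mult.left_commute)
  ultimately have "(\<Sum>i\<in>I. w i * chebU k (- t i)) - A * (- e) ^ k =
      (-1) ^ k * ((\<Sum>i\<in>I. w i * chebU k (t i)) - A * e ^ k)"
    by (simp only: right_diff_distrib)
  then show "\<bar>(\<Sum>i\<in>I. w i * chebU k (- t i)) - A * (- e) ^ k\<bar> \<le> E"
    using moments[OF k] by (simp add: abs_mult)
qed (use finite_I w_nonneg e_small A_nonneg D_pos in auto)

lemma weight_le_2cos:
  assumes "0 \<le> \<theta>" "\<theta> \<le> pi"
  shows "(\<Sum>i\<in>{i\<in>I. t i \<le> 2 * cos \<theta>}. w i) \<le> A * (1 - semicircle_cdf e \<theta>) + (error - E)"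
proof -
  interpret r: near_semicircle I w "\<lambda>i. - t i" A "- e" E D by (rule reflected)
  have "{i \<in> I. 2 * cos (pi - \<theta>) \<le> - t i} = {i \<in> I. t i \<le> 2 * cos \<theta>}" by auto
  then show ?thesis
    using r.weight_ge_2cos[of "pi - \<theta>"] assms
    by (simp add: semicircle_cdf_reflect quadrature_error_def)
qed

text \<open>Clamping keeps \<open>arccos\<close> in its domain and extends the tail by
  \<open>A\<close> to the left of -2 and by 0 to the right of 2, so that outlying points need no
  separate treatment later.\<close>

definition tail :: "real \<Rightarrow> real" where
  "tail u = A * semicircle_cdf e (arccos (max (-1) (min 1 (u / 2))))"

lemma weight_ge: "(\<Sum>i\<in>{i\<in>I. t i \<ge> u}. w i) \<le> tail u + error"
proof -
  define \<theta> where "\<theta> = arccos (max (-1) (min 1 (u / 2)))"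
  have \<theta>: "0 \<le> \<theta>" "\<theta> \<le> pi" unfolding \<theta>_def by (auto intro: arccos_lbound arccos_ubound)
  have cos: "cos \<theta> = max (-1) (min 1 (u / 2))" unfolding \<theta>_def by (rule cos_arccos) auto
  show ?thesis
  proof (cases "u < - 2")
    case True
    then have "tail u = A" by (simp add: tail_def)
    moreover have "(\<Sum>i\<in>{i\<in>I. t i \<ge> u}. w i) \<le> (\<Sum>i\<in>I. w i)"
      using finite_I w_nonneg by (intro sum_mono2) auto
    moreover have "4 * A / real (Suc D) \<ge> 0" using A_nonneg by simp
    ultimately show ?thesis using total error_ge by linarith
  next
    case False
    then have "2 * cos \<theta> \<le> u" unfolding cos by auto
    then have "(\<Sum>i\<in>{i\<in>I. t i \<ge> u}. w i) \<le> (\<Sum>i\<in>{i\<in>I. t i \<ge> 2 * cos \<theta>}. w i)"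
      using finite_I w_nonneg by (intro sum_mono2) auto
    then show ?thesis using weight_ge_2cos[OF \<theta>] E_nonneg by (simp add: tail_def \<theta>_def)
  qed
qed

text \<open>Open half lines from below and closed ones from above: with this pairing, atoms at the
  ends of an interval do no harm, whichever end points it contains.\<close>

lemma weight_gt: "(\<Sum>i\<in>{i\<in>I. t i > u}. w i) \<ge> tail u - error"
proof -
  define \<theta> where "\<theta> = arccos (max (-1) (min 1 (u / 2)))"
  have \<theta>: "0 \<le> \<theta>" "\<theta> \<le> pi" unfolding \<theta>_def by (auto intro: arccos_lbound arccos_ubound)
  have cos: "cos \<theta> = max (-1) (min 1 (u / 2))" unfolding \<theta>_def by (rule cos_arccos) auto
  show ?thesis
  proof (cases "u > 2")
    case True
    then have "tail u = 0" by (simp add: tail_def)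
    moreover have "(\<Sum>i\<in>{i\<in>I. t i > u}. w i) \<ge> 0" using w_nonneg by (intro sum_nonneg) auto
    moreover have "4 * A / real (Suc D) \<ge> 0" using A_nonneg by simp
    ultimately show ?thesis using error_ge E_nonneg by linarith
  next
    case False
    then have "u \<le> 2 * cos \<theta>" unfolding cos by auto
    then have "(\<Sum>i\<in>{i\<in>I. t i \<le> u}. w i) \<le> (\<Sum>i\<in>{i\<in>I. t i \<le> 2 * cos \<theta>}. w i)"
      using finite_I w_nonneg by (intro sum_mono2) auto
    moreover have "(\<Sum>i\<in>I. w i) = (\<Sum>i\<in>{i\<in>I. t i > u}. w i) + (\<Sum>i\<in>{i\<in>I. t i \<le> u}. w i)"
    proof -
      have "I = {i\<in>I. t i > u} \<union> {i\<in>I. t i \<le> u}" by auto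
      moreover have "sum w ({i\<in>I. t i > u} \<union> {i\<in>I. t i \<le> u}) =
          sum w {i\<in>I. t i > u} + sum w {i\<in>I. t i \<le> u}"
        using finite_I by (intro sum.union_disjoint) auto
      ultimately show ?thesis by simp
    qed
    ultimately show ?thesis using weight_le_2cos[OF \<theta>] total
      by (simp add: tail_def \<theta>_def algebra_simps)
  qed
qed

end

section \<open>The semicircle law in the singular value coordinate\<close>

definition clamped_cdf :: "real \<Rightarrow> real \<Rightarrow> real" where
  "clamped_cdf e u = semicircle_cdf e (arccos (max (-1) (min 1 (u / 2))))"

text \<open>For positive \<open>s\<close> and nonnegative \<open>x\<close> the values in [-2, 2] are
  taken between \<open>\<bar>1 - s\<bar>\<close> and \<open>1 + s\<close>, the positive part of the
  support of the limit law if \<open>s\<close> is \<open>y powr (-1/2)\<close>.\<close>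

definition semicircle_coord :: "real \<Rightarrow> real \<Rightarrow> real" where
  "semicircle_coord s x = (x\<^sup>2 - 1 - s\<^sup>2) / s"

text \<open>
  The density \<open>sqrt (4 - t\<^sup>2) * (1 + e * t) / (2 * pi)\<close> in the coordinate \<open>x\<close>, where
  \<open>t = semicircle_coord s x\<close>.
\<close>

definition perturbed_density :: "real \<Rightarrow> real \<Rightarrow> real \<Rightarrow> real" where
  "perturbed_density e s x = x / (pi * s) * sqrt (max 0 (4 - (semicircle_coord s x)\<^sup>2)) * (1 + e * semicircle_coord s x)"

lemma continuous_clamped_cdf: "continuous_on UNIV (clamped_cdf e)"
proof -
  have "continuous_on UNIV (\<lambda>u::real. arccos (max (-1) (min 1 (u / 2))))"
    by (intro continuous_intros ballI) auto
  moreover have "continuous_on UNIV (semicircle_cdf e)"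
    unfolding semicircle_cdf_def [abs_def] by (intro continuous_intros) auto
  ultimately show ?thesis
    unfolding clamped_cdf_def [abs_def]
    using continuous_on_compose2[of UNIV "semicircle_cdf e" UNIV "\<lambda>u. arccos (max (-1) (min 1 (u / 2)))"] by simp
qed

lemma clamped_cdf_deriv:
  assumes "u \<noteq> 2" "u \<noteq> -2"
  shows "(clamped_cdf e has_real_derivative - (1 / (2 * pi) * sqrt (max 0 (4 - u\<^sup>2)) * (1 + e * u))) (at u)"
proof -
  consider "u < -2" | "\<bar>u\<bar> < 2" | "u > 2" using assms by linarith
  then show ?thesis
  proof cases
    case 1
    then have "u\<^sup>2 \<ge> 4" using power_mono[of 2 "- u" 2] by simp
    moreover have "(clamped_cdf e has_real_derivative 0) (at u)"
      by (rule has_field_derivative_transform_within_open[OF DERIV_const[of 1], where S = "{..< -2}"])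
        (use 1 in \<open>auto simp: clamped_cdf_def\<close>)
    ultimately show ?thesis by simp
  next
    case 3
    then have "u\<^sup>2 \<ge> 4" using power_mono[of 2 u 2] by simp
    moreover have "(clamped_cdf e has_real_derivative 0) (at u)"
      by (rule has_field_derivative_transform_within_open[OF DERIV_const[of 0], where S = "{2<..}"])
        (use 3 in \<open>auto simp: clamped_cdf_def\<close>)
    ultimately show ?thesis by simp
  next
    case 2
    let ?\<theta> = "arccos (u / 2)"
    have u: "-1 < u / 2" "u / 2 < 1" using 2 by auto
    have "\<bar>u\<bar>\<^sup>2 < 2\<^sup>2" using 2 by (intro power_strict_mono) auto
    then have u4: "4 - u\<^sup>2 > 0" by simp
    have "((\<lambda>u. arccos (u / 2)) has_real_derivative inverse (- sqrt (1 - (u / 2)\<^sup>2)) * (1 / 2)) (at u)"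
      by (rule DERIV_chain2[where f = arccos and g = "\<lambda>u. u / 2", OF DERIV_arccos[OF u]])
        (auto intro!: derivative_eq_intros)
    then have "((\<lambda>u. semicircle_cdf e (arccos (u / 2))) has_real_derivative
        (2 / pi * ((sin ?\<theta>)\<^sup>2 * (1 + 2 * e * cos ?\<theta>))) * (inverse (- sqrt (1 - (u / 2)\<^sup>2)) * (1 / 2))) (at u)"
      by (rule DERIV_chain2[where f = "semicircle_cdf e" and g = "\<lambda>u. arccos (u / 2)", OF semicircle_cdf_deriv])
    moreover have "cos ?\<theta> = u / 2" using u by (intro cos_arccos) auto
    moreover have "(sin ?\<theta>)\<^sup>2 = (4 - u\<^sup>2) / 4"
      using u sin_squared_eq[of ?\<theta>] \<open>cos ?\<theta> = u / 2\<close> by (simp add: power_divide field_simps)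
    moreover have "sqrt (1 - (u / 2)\<^sup>2) = sqrt (4 - u\<^sup>2) / 2"
    proof -
      have "1 - (u / 2)\<^sup>2 = (4 - u\<^sup>2) / 2\<^sup>2" by (simp add: power_divide field_simps)
      then show ?thesis by (simp only: real_sqrt_divide) simp
    qed
    moreover have "(4 - u\<^sup>2) = sqrt (4 - u\<^sup>2) * sqrt (4 - u\<^sup>2)" using u4 by simp
    then have "(2 / pi * ((4 - u\<^sup>2) / 4 * (1 + 2 * e * (u / 2)))) * (inverse (- (sqrt (4 - u\<^sup>2) / 2)) * (1 / 2)) =
        - (1 / (2 * pi) * sqrt (4 - u\<^sup>2) * (1 + e * u))"
      using u4 by (simp add: field_simps)
    ultimately have "((\<lambda>u. semicircle_cdf e (arccos (u / 2))) has_real_derivative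
        - (1 / (2 * pi) * sqrt (max 0 (4 - u\<^sup>2)) * (1 + e * u))) (at u)"
      using u4 by (simp only: max_absorb2 less_imp_le)
    then show ?thesis
      by (rule has_field_derivative_transform_within_open[where S = "{-2<..<2}"])
        (use 2 in \<open>auto simp: clamped_cdf_def\<close>)
  qed
qed

lemma continuous_perturbed_density: "s > 0 \<Longrightarrow> continuous_on S (perturbed_density e s)"
  unfolding perturbed_density_def [abs_def] semicircle_coord_def by (intro continuous_intros) auto

lemma semicircle_coord_mono: "s > 0 \<Longrightarrow> 0 \<le> x \<Longrightarrow> 0 \<le> y \<Longrightarrow> semicircle_coord s x \<le> semicircle_coord s y \<longleftrightarrow> x \<le> y"
  by (auto simp: semicircle_coord_def divide_le_cancel power_mono_iff)

lemma perturbed_density_nonneg: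
  assumes "\<bar>e\<bar> \<le> 1 / 4" "s > 0" "x \<ge> 0"
  shows "perturbed_density e s x \<ge> 0"
proof (cases "\<bar>semicircle_coord s x\<bar> \<le> 2")
  case True
  have "\<bar>e * semicircle_coord s x\<bar> \<le> 1 / 4 * 2" unfolding abs_mult using assms True by (intro mult_mono) auto
  then have "1 + e * semicircle_coord s x \<ge> 0" by linarith
  then show ?thesis unfolding perturbed_density_def using assms by (intro mult_nonneg_nonneg) auto
next
  case False
  then have "2\<^sup>2 \<le> \<bar>semicircle_coord s x\<bar>\<^sup>2" by (intro power_mono) auto
  then show ?thesis by (simp add: perturbed_density_def)
qed

lemma integral_perturbed_density:
  assumes s: "s > 0" and ab: "0 \<le> a" "a \<le> b"
  shows "(LINT x:{a..b}|lborel. perturbed_density e s x) =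
    clamped_cdf e (semicircle_coord s a) - clamped_cdf e (semicircle_coord s b)"
    and "set_integrable lborel {a..b} (perturbed_density e s)"
proof -
  let ?F = "\<lambda>x. - clamped_cdf e (semicircle_coord s x)"
  show int: "set_integrable lborel {a..b} (perturbed_density e s)"
    unfolding set_integrable_def by (intro borel_integrable_compact continuous_perturbed_density s) simp
  have cont: "continuous_on {a..b} ?F"
  proof (intro continuous_on_minus)
    have "continuous_on {a..b} (semicircle_coord s)"
      unfolding semicircle_coord_def [abs_def] using s by (intro continuous_intros) auto
    then show "continuous_on {a..b} (\<lambda>x. clamped_cdf e (semicircle_coord s x))"
      by (rule continuous_on_compose2[OF continuous_clamped_cdf]) auto
  qed
  \<comment> \<open>The exceptional points are those with coordinate 2 or -2, which
    \<open>clamped_cdf_deriv\<close> excludes.\<close>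
  have "(perturbed_density e s has_integral ?F b - ?F a) {a..b}"
  proof (rule fundamental_theorem_of_calculus_interior_strong[where S = "{1 + s, \<bar>1 - s\<bar>}"])
    fix x assume x: "x \<in> {a<..<b} - {1 + s, \<bar>1 - s\<bar>}"
    then have x0: "x > 0" using ab by auto
    have "semicircle_coord s x \<noteq> 2"
    proof
      assume "semicircle_coord s x = 2"
      then have "x\<^sup>2 = (1 + s)\<^sup>2" using s by (simp add: semicircle_coord_def power2_eq_square field_simps)
      then show False using x x0 s by (simp add: power2_eq_iff)
    qed
    moreover have "semicircle_coord s x \<noteq> - 2"
    proof
      assume "semicircle_coord s x = - 2"
      then have "x\<^sup>2 = (1 - s)\<^sup>2" using s by (simp add: semicircle_coord_def power2_eq_square field_simps)
      then show False using x x0 s by (auto simp: power2_eq_iff)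
    qed
    ultimately have d: "(clamped_cdf e has_real_derivative - (1 / (2 * pi) * sqrt (max 0 (4 - (semicircle_coord s x)\<^sup>2)) * (1 + e * semicircle_coord s x))) (at (semicircle_coord s x))"
      by (rule clamped_cdf_deriv)
    have "(semicircle_coord s has_real_derivative 2 * x / s) (at x)"
      unfolding semicircle_coord_def [abs_def] using s
      by (auto intro!: derivative_eq_intros)
    from DERIV_minus[OF DERIV_chain2[OF d this]]
    moreover have "- (- (1 / (2 * pi) * R * T) * (2 * x / s)) = x / (pi * s) * R * T" for R T :: real
      by (simp add: field_simps)
    ultimately have "(?F has_real_derivative perturbed_density e s x) (at x)"
      unfolding perturbed_density_def by (simp only:)
    then show "(?F has_vector_derivative perturbed_density e s x) (at x)"
      by (simp add: has_real_derivative_iff_has_vector_derivative)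
  qed (use ab cont in auto)
  then have "integral {a..b} (perturbed_density e s) = ?F b - ?F a" by (rule integral_unique)
  then show "(LINT x:{a..b}|lborel. perturbed_density e s x) =
    clamped_cdf e (semicircle_coord s a) - clamped_cdf e (semicircle_coord s b)"
    using set_borel_integral_eq_integral(2)[OF int] by simp
qed

section \<open>Intervals with arbitrary end points, and division by the square through a layer
  cake\<close>

lemma bounded_interval_between:
  fixes J :: "real set"
  assumes "is_interval J" "bounded J" "J \<noteq> {}"
  shows "{Inf J<..<Sup J} \<subseteq> J" "J \<subseteq> {Inf J..Sup J}"
proof -
  have b: "bdd_below J" "bdd_above J" using assms(2) by (auto dest: bounded_imp_bdd_below bounded_imp_bdd_above)
  show "J \<subseteq> {Inf J..Sup J}" using b by (auto intro: cInf_lower cSup_upper)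
  show "{Inf J<..<Sup J} \<subseteq> J"
  proof
    fix x assume "x \<in> {Inf J<..<Sup J}"
    then obtain y z where "y \<in> J" "y < x" "z \<in> J" "x < z"
      using cInf_less_iff[OF assms(3) b(1)] less_cSup_iff[OF assms(3) b(2)] by auto
    then show "x \<in> J" using assms(1) by (meson is_interval_1 less_imp_le)
  qed
qed

lemma set_lborel_integral_interval:
  fixes f :: "real \<Rightarrow> real"
  assumes f: "f \<in> borel_measurable borel" and "{a<..<b} \<subseteq> J" "J \<subseteq> {a..b}"
  shows "(LINT x:J|lborel. f x) = (LINT x:{a..b}|lborel. f x)"
proof -
  have eq: "AE x in lborel. x \<in> J \<longleftrightarrow> x \<in> {a..b}"
  proof (rule AE_mp[OF AE_conjI[OF AE_lborel_singleton[of a] AE_lborel_singleton[of b]]], rule AE_I2, safe)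
    fix x assume "x \<noteq> a" "x \<noteq> b"
    then show "x \<in> J \<Longrightarrow> x \<in> {a..b}" "x \<in> {a..b} \<Longrightarrow> x \<in> J" using assms by force+
  qed
  have "J = {a<..<b} \<union> (J \<inter> {a, b})" using assms by force
  moreover have "{a<..<b} \<union> (J \<inter> {a, b}) \<in> sets borel"
    by (intro sets.Un borel_open borel_closed finite_imp_closed) auto
  ultimately have J: "J \<in> sets borel" by simp
  have "AE x in lborel. indicator J x *\<^sub>R f x = indicator {a..b} x *\<^sub>R f x"
    using eq by eventually_elim (auto simp: indicator_def)
  then show ?thesis
    unfolding set_lebesgue_integral_def using J f by (intro integral_cong_AE) auto
qed

text \<open>Turns a uniform bound for the level sets of the layer cakes below into a bound for the
  integrals. With nonnegative integrals, measurability is the only regularity to be checked.\<close>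

lemma nn_integral_close:
  fixes F G :: "real \<Rightarrow> real"
  assumes [measurable]: "F \<in> borel_measurable borel" "G \<in> borel_measurable borel"
    and nonneg: "\<And>u. F u \<ge> 0" "\<And>u. G u \<ge> 0"
    and close: "\<And>u. \<bar>F u - G u\<bar> \<le> B" and h: "h \<ge> 0" and x: "x \<ge> 0" "y \<ge> 0"
    and F: "(\<integral>\<^sup>+u\<in>{0<..<h}. ennreal (F u) \<partial>lborel) = ennreal x"
    and G: "(\<integral>\<^sup>+u\<in>{0<..<h}. ennreal (G u) \<partial>lborel) = ennreal y"
  shows "\<bar>x - y\<bar> \<le> B * h"
proof -
  have B: "B \<ge> 0" using close[of 0] by linarith
  have le: "x' \<le> y' + B * h"
    if "(\<integral>\<^sup>+u\<in>{0<..<h}. ennreal (F' u) \<partial>lborel) = ennreal x'" "(\<integral>\<^sup>+u\<in>{0<..<h}. ennreal (G' u) \<partial>lborel) = ennreal y'"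
      "G' \<in> borel_measurable borel" "\<And>u. F' u \<le> G' u + B" "\<And>u. G' u \<ge> 0" "y' \<ge> 0"
    for F' G' :: "real \<Rightarrow> real" and x' y'
  proof -
    note [measurable] = that(3)
    have "ennreal x' \<le> (\<integral>\<^sup>+u. ennreal (G' u) * indicator {0<..<h} u + ennreal B * indicator {0<..<h} u \<partial>lborel)"
      unfolding that(1)[symmetric] using that(4,5) B
      by (intro nn_integral_mono) (auto simp: indicator_def ennreal_plus[symmetric] simp del: ennreal_plus intro!: ennreal_leI)
    also have "\<dots> = ennreal y' + ennreal B * emeasure lborel {0<..<h}"
      by (subst nn_integral_add) (auto simp: that(2) nn_integral_cmult_indicator)
    also have "\<dots> = ennreal (y' + B * h)"
      using h B that(6) by (simp add: ennreal_mult ennreal_plus[symmetric] del: ennreal_plus flip: ennreal_mult)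
    finally show "x' \<le> y' + B * h"
      using h B that(6) by (subst (asm) ennreal_le_iff) auto
  qed
  have "F u \<le> G u + B" "G u \<le> F u + B" for u using close[of u] by linarith+
  then have "x \<le> y + B * h" "y \<le> x + B * h"
    using le[OF F G assms(2)] le[OF G F assms(1)] nonneg x by auto
  then show ?thesis by linarith
qed

text \<open>For \<open>l\<close> above \<open>\<epsilon>\<close>, the number \<open>1 / l^2\<close>
  is the length of the set of \<open>u\<close> between 0 and \<open>1 / \<epsilon>^2\<close> with
  \<open>u < 1 / l^2\<close>. So the sum divided by squares is an integral over \<open>u\<close> of
  plain weights.\<close>

lemma layer_cake_sum:
  fixes w l :: "'i \<Rightarrow> real"
  assumes I: "finite I" "\<And>i. i \<in> I \<Longrightarrow> w i \<ge> 0" and J: "J \<subseteq> {\<epsilon><..}" "\<epsilon> > 0"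
  shows "(\<integral>\<^sup>+u\<in>{0<..<1 / \<epsilon>\<^sup>2}. ennreal (\<Sum>i\<in>{i\<in>I. l i \<in> J \<and> u < 1 / (l i)\<^sup>2}. w i) \<partial>lborel) =
    ennreal (\<Sum>i\<in>{i\<in>I. l i \<in> J}. w i / (l i)\<^sup>2)"
    and "(\<lambda>u. \<Sum>i\<in>{i\<in>I. l i \<in> J \<and> u < 1 / (l i)\<^sup>2}. w i) \<in> borel_measurable borel"
proof -
  let ?K = "{i\<in>I. l i \<in> J}"
  have eq: "(\<Sum>i\<in>{i\<in>I. l i \<in> J \<and> u < 1 / (l i)\<^sup>2}. w i) = (\<Sum>i\<in>?K. w i * indicator {..<1 / (l i)\<^sup>2} u)" for u
    using I(1) by (intro sum.mono_neutral_cong_left) (auto simp: indicator_def)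
  show "(\<lambda>u. \<Sum>i\<in>{i\<in>I. l i \<in> J \<and> u < 1 / (l i)\<^sup>2}. w i) \<in> borel_measurable borel"
    unfolding eq by measurable
  have "(\<integral>\<^sup>+u\<in>{0<..<1 / \<epsilon>\<^sup>2}. ennreal (\<Sum>i\<in>{i\<in>I. l i \<in> J \<and> u < 1 / (l i)\<^sup>2}. w i) \<partial>lborel) =
      (\<integral>\<^sup>+u. (\<Sum>i\<in>?K. ennreal (w i) * indicator {0<..<1 / (l i)\<^sup>2} u) \<partial>lborel)"
  proof (intro nn_integral_cong)
    fix u :: real
    have "ennreal (\<Sum>i\<in>?K. w i * indicator {..<1 / (l i)\<^sup>2} u) * indicator {0<..<1 / \<epsilon>\<^sup>2} u =
        (\<Sum>i\<in>?K. ennreal (w i * indicator {..<1 / (l i)\<^sup>2} u) * indicator {0<..<1 / \<epsilon>\<^sup>2} u)"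
      using I by (subst sum_ennreal[symmetric]) (auto simp: sum_distrib_right indicator_def)
    also have "\<dots> = (\<Sum>i\<in>?K. ennreal (w i) * indicator {0<..<1 / (l i)\<^sup>2} u)"
    proof (intro sum.cong refl)
      fix i assume "i \<in> ?K"
      then have "1 / (l i)\<^sup>2 < 1 / \<epsilon>\<^sup>2"
        using J by (intro divide_strict_left_mono mult_pos_pos power_strict_mono) auto
      then show "ennreal (w i * indicator {..<1 / (l i)\<^sup>2} u) * indicator {0<..<1 / \<epsilon>\<^sup>2} u =
          ennreal (w i) * indicator {0<..<1 / (l i)\<^sup>2} u"
        by (auto simp: indicator_def)
    qed
    finally show "ennreal (\<Sum>i\<in>{i\<in>I. l i \<in> J \<and> u < 1 / (l i)\<^sup>2}. w i) * indicator {0<..<1 / \<epsilon>\<^sup>2} u =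
        (\<Sum>i\<in>?K. ennreal (w i) * indicator {0<..<1 / (l i)\<^sup>2} u)" unfolding eq .
  qed
  also have "\<dots> = (\<Sum>i\<in>?K. ennreal (w i) * emeasure lborel {0<..<1 / (l i)\<^sup>2})"
    by (subst nn_integral_sum) (auto simp: nn_integral_cmult_indicator)
  also have "\<dots> = (\<Sum>i\<in>?K. ennreal (w i / (l i)\<^sup>2))"
    using I by (intro sum.cong refl) (auto simp: ennreal_mult[symmetric])
  also have "\<dots> = ennreal (\<Sum>i\<in>?K. w i / (l i)\<^sup>2)" using I by (intro sum_ennreal) auto
  finally show "(\<integral>\<^sup>+u\<in>{0<..<1 / \<epsilon>\<^sup>2}. ennreal (\<Sum>i\<in>{i\<in>I. l i \<in> J \<and> u < 1 / (l i)\<^sup>2}. w i) \<partial>lborel) =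
    ennreal (\<Sum>i\<in>?K. w i / (l i)\<^sup>2)" .
qed

text \<open>The continuous counterpart, by exchanging the two nonnegative integrals.\<close>

lemma layer_cake_density:
  fixes f :: "real \<Rightarrow> real"
  assumes [measurable]: "f \<in> borel_measurable borel" "J \<in> sets borel"
    and J: "J \<subseteq> {\<epsilon><..}" "\<epsilon> > 0"
  shows "(\<integral>\<^sup>+u\<in>{0<..<1 / \<epsilon>\<^sup>2}. (\<integral>\<^sup>+x\<in>{x\<in>J. u < 1 / x\<^sup>2}. ennreal (f x) \<partial>lborel) \<partial>lborel) =
    (\<integral>\<^sup>+x\<in>J. ennreal (f x / x\<^sup>2) \<partial>lborel)"
    and "(\<lambda>u. \<integral>\<^sup>+x\<in>{x\<in>J. u < 1 / x\<^sup>2}. ennreal (f x) \<partial>lborel) \<in> borel_measurable borel"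
proof -
  have ind: "indicator {x\<in>J. u < 1 / x\<^sup>2} x = (indicator J x * indicator {..<1 / x\<^sup>2} u :: ennreal)" for u x
    by (auto simp: indicator_def)
  have [measurable]: "(\<lambda>(u :: real, x :: real). indicator {..<1 / x\<^sup>2} u :: ennreal) \<in> borel_measurable (lborel \<Otimes>\<^sub>M lborel)"
    unfolding indicator_def lessThan_iff case_prod_beta by measurable
  have [measurable]: "(\<lambda>p :: real \<times> real. indicator {..<1 / (snd p)\<^sup>2} (fst p) :: ennreal) \<in> borel_measurable (lborel \<Otimes>\<^sub>M lborel)"
    unfolding indicator_def lessThan_iff by measurable
  have [measurable]: "(\<lambda>p :: real \<times> real. indicator {..<1 / (fst p)\<^sup>2} (snd p) :: ennreal) \<in> borel_measurable (lborel \<Otimes>\<^sub>M lborel)"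
    unfolding indicator_def lessThan_iff by measurable
  show "(\<lambda>u. \<integral>\<^sup>+x\<in>{x\<in>J. u < 1 / x\<^sup>2}. ennreal (f x) \<partial>lborel) \<in> borel_measurable borel"
    unfolding ind by (rule lborel.borel_measurable_nn_integral[where N = borel, simplified]) measurable
  have "(\<integral>\<^sup>+u\<in>{0<..<1 / \<epsilon>\<^sup>2}. (\<integral>\<^sup>+x\<in>{x\<in>J. u < 1 / x\<^sup>2}. ennreal (f x) \<partial>lborel) \<partial>lborel) =
      (\<integral>\<^sup>+u. \<integral>\<^sup>+x. ennreal (f x) * (indicator J x * indicator {..<1 / x\<^sup>2} u) * indicator {0<..<1 / \<epsilon>\<^sup>2} u \<partial>lborel \<partial>lborel)"
    unfolding ind by (intro nn_integral_cong) (simp add: nn_integral_multc)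
  also have "\<dots> = (\<integral>\<^sup>+x. \<integral>\<^sup>+u. ennreal (f x) * (indicator J x * indicator {..<1 / x\<^sup>2} u) * indicator {0<..<1 / \<epsilon>\<^sup>2} u \<partial>lborel \<partial>lborel)"
    by (rule lborel_pair.Fubini') (simp add: case_prod_beta)
  also have "\<dots> = (\<integral>\<^sup>+x\<in>J. ennreal (f x / x\<^sup>2) \<partial>lborel)"
  proof (intro nn_integral_cong)
    fix x :: real
    show "(\<integral>\<^sup>+u. ennreal (f x) * (indicator J x * indicator {..<1 / x\<^sup>2} u) * indicator {0<..<1 / \<epsilon>\<^sup>2} u \<partial>lborel) =
        ennreal (f x / x\<^sup>2) * indicator J x"
    proof (cases "x \<in> J")
      case True
      then have "1 / x\<^sup>2 < 1 / \<epsilon>\<^sup>2"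
        using J by (intro divide_strict_left_mono mult_pos_pos power_strict_mono) auto
      then have "(\<integral>\<^sup>+u. ennreal (f x) * (indicator J x * indicator {..<1 / x\<^sup>2} u) * indicator {0<..<1 / \<epsilon>\<^sup>2} u \<partial>lborel) =
          (\<integral>\<^sup>+u. ennreal (f x) * indicator {0<..<1 / x\<^sup>2} u \<partial>lborel)"
        using True by (intro nn_integral_cong) (auto simp: indicator_def)
      also have "\<dots> = ennreal (f x) * ennreal (1 / x\<^sup>2)" by (subst nn_integral_cmult_indicator) auto
      also have "\<dots> = ennreal (f x / x\<^sup>2)"
        by (cases "f x \<ge> 0") (auto simp: ennreal_mult[symmetric] ennreal_neg divide_nonpos_nonneg)
      finally show ?thesis using True by simp
    qed simp
  qed
  finally show "(\<integral>\<^sup>+u\<in>{0<..<1 / \<epsilon>\<^sup>2}. (\<integral>\<^sup>+x\<in>{x\<in>J. u < 1 / x\<^sup>2}. ennreal (f x) \<partial>lborel) \<partial>lborel) =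
    (\<integral>\<^sup>+x\<in>J. ennreal (f x / x\<^sup>2) \<partial>lborel)" .
qed

lemma set_nn_integral_eq_set_integral_nonneg:
  fixes g :: "real \<Rightarrow> real"
  assumes "set_integrable lborel S g" "\<And>x. x \<in> S \<Longrightarrow> g x \<ge> 0"
  shows "(\<integral>\<^sup>+x\<in>S. ennreal (g x) \<partial>lborel) = ennreal (LINT x:S|lborel. g x)"
proof -
  have "(\<integral>\<^sup>+x\<in>S. ennreal (g x) \<partial>lborel) = (\<integral>\<^sup>+x. ennreal (indicator S x *\<^sub>R g x) \<partial>lborel)"
    by (intro nn_integral_cong) (auto simp: indicator_def)
  also have "\<dots> = ennreal (LINT x|lborel. indicator S x *\<^sub>R g x)"
    using assms unfolding set_integrable_def by (intro nn_integral_eq_integral AE_I2) (auto simp: indicator_def)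
  finally show ?thesis by (simp add: set_lebesgue_integral_def)
qed

lemma borel_perturbed_density: "s > 0 \<Longrightarrow> perturbed_density e s \<in> borel_measurable borel"
  by (intro borel_measurable_continuous_onI continuous_perturbed_density)

lemma is_interval_borel: "is_interval J \<Longrightarrow> (J :: real set) \<in> sets borel"
  by (simp add: real_interval_borel_measurable)

text \<open>The weight of \<open>J\<close> is squeezed between differences of open and closed half
  lines at \<open>Inf J\<close> and \<open>Sup J\<close>; each of the two half lines costs one
  error.\<close>

lemma near_semicircle_interval:
  assumes ns: "near_semicircle I w (\<lambda>i. semicircle_coord s (l i)) A e E D"
    and s: "s > 0" and l: "\<And>i. i \<in> I \<Longrightarrow> l i \<ge> 0" and J: "is_interval J" "bounded J" "J \<subseteq> {0..}"
  shows "\<bar>(\<Sum>i\<in>{i\<in>I. l i \<in> J}. w i) - A * (LINT x:J|lborel. perturbed_density e s x)\<bar> \<le>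
    2 * quadrature_error A e E D"
proof (cases "J = {}")
  case True
  interpret near_semicircle I w "\<lambda>i. semicircle_coord s (l i)" A e E D by (rule ns)
  have "4 * A / real (Suc D) \<ge> 0" using A_nonneg by simp
  then show ?thesis using True error_ge E_nonneg by (simp add: set_lebesgue_integral_def)
next
  case False
  interpret near_semicircle I w "\<lambda>i. semicircle_coord s (l i)" A e E D by (rule ns)
  define a where "a = Inf J"
  define b where "b = Sup J"
  note Jab = bounded_interval_between[OF J(1,2) False, folded a_def b_def]
  have a0: "a \<ge> 0" unfolding a_def using J(3) False by (intro cInf_greatest) auto
  have ab: "a \<le> b" using Jab(2) False by force
  have ge: "(\<Sum>i\<in>{i\<in>I. l i \<ge> c}. w i) \<le> A * clamped_cdf e (semicircle_coord s c) + error" if "c \<ge> 0" for c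
  proof -
    have "{i\<in>I. l i \<ge> c} = {i\<in>I. semicircle_coord s (l i) \<ge> semicircle_coord s c}"
      using l semicircle_coord_mono[OF s that] by auto
    then show ?thesis using weight_ge[of "semicircle_coord s c"] by (simp add: tail_def clamped_cdf_def)
  qed
  have gt: "(\<Sum>i\<in>{i\<in>I. l i > c}. w i) \<ge> A * clamped_cdf e (semicircle_coord s c) - error" if "c \<ge> 0" for c
  proof -
    have "{i\<in>I. l i > c} = {i\<in>I. semicircle_coord s (l i) > semicircle_coord s c}"
      using l semicircle_coord_mono[OF s _ that] by (auto simp flip: not_le)
    then show ?thesis using weight_gt[of "semicircle_coord s c"] by (simp add: tail_def clamped_cdf_def)
  qed
  have int: "A * (LINT x:J|lborel. perturbed_density e s x) =
      A * clamped_cdf e (semicircle_coord s a) - A * clamped_cdf e (semicircle_coord s b)"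
    using set_lborel_integral_interval[OF borel_perturbed_density[OF s] Jab]
      integral_perturbed_density(1)[OF s a0 ab] by (simp add: right_diff_distrib)
  have split: "(\<Sum>i\<in>P \<union> Q. w i) = (\<Sum>i\<in>P. w i) + (\<Sum>i\<in>Q. w i)" if "P \<subseteq> I" "Q \<subseteq> I" "P \<inter> Q = {}" for P Q
    using that finite_I by (intro sum.union_disjoint) (auto intro: finite_subset)
  have mono: "(\<Sum>i\<in>P. w i) \<le> (\<Sum>i\<in>Q. w i)" if "P \<subseteq> Q" "Q \<subseteq> I" for P Q
    using that finite_I w_nonneg by (intro sum_mono2) (auto intro: finite_subset)
  have "(\<Sum>i\<in>{i\<in>I. l i \<in> J}. w i) + (\<Sum>i\<in>{i\<in>I. l i > b}. w i) =
      (\<Sum>i\<in>{i\<in>I. l i \<in> J} \<union> {i\<in>I. l i > b}. w i)"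
    using Jab(2) by (intro split[symmetric]) auto
  also have "\<dots> \<le> (\<Sum>i\<in>{i\<in>I. l i \<ge> a}. w i)"
    using Jab(2) ab by (intro mono) auto
  finally have upper: "(\<Sum>i\<in>{i\<in>I. l i \<in> J}. w i) + (\<Sum>i\<in>{i\<in>I. l i > b}. w i) \<le> (\<Sum>i\<in>{i\<in>I. l i \<ge> a}. w i)" .
  have "(\<Sum>i\<in>{i\<in>I. l i > a}. w i) \<le> (\<Sum>i\<in>{i\<in>I. l i \<in> J \<and> l i < b} \<union> {i\<in>I. l i \<ge> b}. w i)"
  proof (intro mono)
    show "{i\<in>I. l i > a} \<subseteq> {i\<in>I. l i \<in> J \<and> l i < b} \<union> {i\<in>I. l i \<ge> b}"
    proof
      fix i assume i: "i \<in> {i\<in>I. l i > a}"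
      show "i \<in> {i\<in>I. l i \<in> J \<and> l i < b} \<union> {i\<in>I. l i \<ge> b}"
      proof (cases "l i < b")
        case True
        then have "l i \<in> J" using i Jab(1) by auto
        then show ?thesis using i True by simp
      qed (use i in auto)
    qed
  qed auto
  also have "\<dots> = (\<Sum>i\<in>{i\<in>I. l i \<in> J \<and> l i < b}. w i) + (\<Sum>i\<in>{i\<in>I. l i \<ge> b}. w i)"
    by (intro split) auto
  also have "(\<Sum>i\<in>{i\<in>I. l i \<in> J \<and> l i < b}. w i) \<le> (\<Sum>i\<in>{i\<in>I. l i \<in> J}. w i)"
    by (intro mono) auto
  finally have lower: "(\<Sum>i\<in>{i\<in>I. l i > a}. w i) \<le> (\<Sum>i\<in>{i\<in>I. l i \<in> J}. w i) + (\<Sum>i\<in>{i\<in>I. l i \<ge> b}. w i)"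
    by simp
  show ?thesis
    unfolding int using upper lower ge[OF a0] gt[OF a0] ge[of b] gt[of b] a0 ab by linarith
qed

text \<open>Each level set \<open>{x \<in> J. u < 1 / x^2}\<close> is again an interval, because
  \<open>1 / x^2\<close> decreases on \<open>J\<close>. So \<open>near_semicircle_interval\<close>
  applies uniformly in \<open>u\<close>, and integrating over \<open>u\<close> below
  \<open>1 / \<epsilon>^2\<close> gives the factor.\<close>

lemma near_semicircle_weighted:
  assumes ns: "near_semicircle I w (\<lambda>i. semicircle_coord s (l i)) A e E D"
    and s: "s > 0" and l: "\<And>i. i \<in> I \<Longrightarrow> l i \<ge> 0"
    and J: "is_interval J" "bounded J" "J \<subseteq> {\<epsilon><..}" "\<epsilon> > 0"
  shows "\<bar>(\<Sum>i\<in>{i\<in>I. l i \<in> J}. w i / (l i)\<^sup>2) - A * (LINT x:J|lborel. perturbed_density e s x / x\<^sup>2)\<bar> \<le>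
    2 * quadrature_error A e E D / \<epsilon>\<^sup>2"
    and "set_integrable lborel J (\<lambda>x. perturbed_density e s x / x\<^sup>2)"
proof -
  interpret near_semicircle I w "\<lambda>i. semicircle_coord s (l i)" A e E D by (rule ns)
  obtain b where b: "\<And>x. x \<in> J \<Longrightarrow> x \<le> b" "b \<ge> \<epsilon>"
    using bounded_imp_bdd_above[OF J(2)] unfolding bdd_above_def by (meson max.cobounded1 max.cobounded2 order_trans)
  have Jb: "J \<subseteq> {\<epsilon>..b}" using b J(3) by auto
  have sJ: "J \<in> sets borel" by (rule is_interval_borel[OF J(1)])
  define c where "c u = {x\<in>J. u < 1 / x\<^sup>2}" for u
  have c_int: "is_interval (c u)" for u
    unfolding is_interval_1
  proof (intro ballI allI impI)
    fix x y z assume xyz: "x \<in> c u" "y \<in> c u" "x \<le> z \<and> z \<le> y"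
    then have zJ: "z \<in> J" using J(1) unfolding is_interval_1 c_def by blast
    then have "0 < z" using J(3,4) by auto
    then have "1 / y\<^sup>2 \<le> 1 / z\<^sup>2" using xyz by (intro divide_left_mono power_mono mult_pos_pos) auto
    then show "z \<in> c u" using xyz zJ by (auto simp: c_def)
  qed
  have c_J: "c u \<subseteq> J" for u by (auto simp: c_def)
  have sc: "c u \<in> sets borel" for u by (rule is_interval_borel[OF c_int])
  have cont: "continuous_on {\<epsilon>..b} (\<lambda>x. A * perturbed_density e s x)"
    by (intro continuous_intros continuous_perturbed_density s)
  have int1: "set_integrable lborel {\<epsilon>..b} (\<lambda>x. A * perturbed_density e s x)"
    unfolding set_integrable_def by (intro borel_integrable_compact cont) simp
  have "continuous_on {\<epsilon>..b} (\<lambda>x. perturbed_density e s x / x\<^sup>2)"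
    using J(4) by (intro continuous_intros continuous_perturbed_density s) auto
  then have int2: "set_integrable lborel {\<epsilon>..b} (\<lambda>x. perturbed_density e s x / x\<^sup>2)"
    unfolding set_integrable_def by (intro borel_integrable_compact) simp
  then show int2J: "set_integrable lborel J (\<lambda>x. perturbed_density e s x / x\<^sup>2)"
    using sJ Jb by (intro set_integrable_subset[OF int2]) auto
  then have int3: "set_integrable lborel J (\<lambda>x. A * perturbed_density e s x / x\<^sup>2)"
    using set_integrable_mult_right[of A lborel J "\<lambda>x. perturbed_density e s x / x\<^sup>2"] by simp
  have nonneg: "A * perturbed_density e s x \<ge> 0" if "x \<in> J" for x
    using that J(3,4) A_nonneg perturbed_density_nonneg[OF e_small s] by force
  define G where "G u = A * (LINT x:c u|lborel. perturbed_density e s x)" for u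
  have H: "(\<integral>\<^sup>+x\<in>c u. ennreal (A * perturbed_density e s x) \<partial>lborel) = ennreal (G u)" for u
  proof -
    have "set_integrable lborel (c u) (\<lambda>x. A * perturbed_density e s x)"
      using c_J[of u] Jb sc[of u] by (intro set_integrable_subset[OF int1]) auto
    then show ?thesis
      using nonneg c_J[of u] by (subst set_nn_integral_eq_set_integral_nonneg) (auto simp: G_def)
  qed
  have Gnn: "G u \<ge> 0" for u
    unfolding G_def set_lebesgue_integral_def using c_J[of u] J(3,4) perturbed_density_nonneg[OF e_small s]
    by (intro mult_nonneg_nonneg A_nonneg integral_nonneg_AE AE_I2) (force simp: indicator_def)
  have meas: "(\<lambda>x. A * perturbed_density e s x) \<in> borel_measurable borel"
    using borel_perturbed_density[OF s] by measurable
  note L = layer_cake_density[OF meas sJ J(3,4), folded c_def, unfolded H]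
  have "G = (\<lambda>u. enn2real (ennreal (G u)))" using Gnn by auto
  moreover have "(\<lambda>u. enn2real (ennreal (G u))) \<in> borel_measurable borel" using L(2) by measurable
  ultimately have Gmeas: "G \<in> borel_measurable borel" by simp
  note K = layer_cake_sum[where l = l, OF finite_I w_nonneg J(3,4)]
  have y: "(\<integral>\<^sup>+x\<in>J. ennreal (A * perturbed_density e s x / x\<^sup>2) \<partial>lborel) =
      ennreal (A * (LINT x:J|lborel. perturbed_density e s x / x\<^sup>2))"
    using int3 divide_nonneg_nonneg[OF nonneg zero_le_power2]
    by (subst set_nn_integral_eq_set_integral_nonneg) (simp_all flip: times_divide_eq_right)
  have y0: "(LINT x:J|lborel. perturbed_density e s x / x\<^sup>2) \<ge> 0"
    unfolding set_lebesgue_integral_def using J(3,4) perturbed_density_nonneg[OF e_small s]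
    by (intro integral_nonneg_AE AE_I2) (force simp: indicator_def)
  have "\<bar>(\<Sum>i\<in>{i\<in>I. l i \<in> J}. w i / (l i)\<^sup>2) - A * (LINT x:J|lborel. perturbed_density e s x / x\<^sup>2)\<bar> \<le>
      (2 * error) * (1 / \<epsilon>\<^sup>2)"
  proof (rule nn_integral_close[OF K(2) Gmeas _ Gnn _ _ _ _ K(1) L(1)[unfolded y]])
    fix u
    have "{i \<in> I. l i \<in> J \<and> u < 1 / (l i)\<^sup>2} = {i\<in>I. l i \<in> c u}" by (auto simp: c_def)
    moreover have "c u \<subseteq> {0..}" using c_J[of u] J(3,4) by auto
    ultimately show "\<bar>(\<Sum>i\<in>{i \<in> I. l i \<in> J \<and> u < 1 / (l i)\<^sup>2}. w i) - G u\<bar> \<le> 2 * error"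
      unfolding G_def using near_semicircle_interval[OF ns s l c_int bounded_subset[OF J(2) c_J]] by simp
  qed (use J(4) w_nonneg A_nonneg y0 in \<open>auto intro!: sum_nonneg mult_nonneg_nonneg\<close>)
  then show "\<bar>(\<Sum>i\<in>{i\<in>I. l i \<in> J}. w i / (l i)\<^sup>2) - A * (LINT x:J|lborel. perturbed_density e s x / x\<^sup>2)\<bar> \<le>
      2 * error / \<epsilon>\<^sup>2" by simp
qed

section \<open>Switchings\<close>

definition neighbours :: "nat set set \<Rightarrow> nat \<Rightarrow> nat set" where
  "neighbours E v = {u. {u, v} \<in> E}"

lemma biregular_graphs_edgeE:
  assumes "E \<in> biregular_graphs m n dL dR" "e \<in> E"
  obtains u v where "e = {u, v}" "u < m" "m \<le> v" "v < m + n"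
proof -
  have "E \<subseteq> {{u, v} | u v. u \<in> {..<m} \<and> v \<in> {m..<m + n}}"
    using assms(1) unfolding biregular_graphs_def by simp
  then have "e \<in> {{u, v} | u v. u \<in> {..<m} \<and> v \<in> {m..<m + n}}" using assms(2) by (rule subsetD)
  then show ?thesis using that by auto
qed

lemma biregular_graphs_edge:
  assumes "E \<in> biregular_graphs m n dL dR" "{u, v} \<in> E"
  shows "(u < m \<and> m \<le> v \<and> v < m + n) \<or> (v < m \<and> m \<le> u \<and> u < m + n)"
proof -
  obtain a b where "{u, v} = {a, b}" "a < m" "m \<le> b" "b < m + n"
    using assms by (rule biregular_graphs_edgeE)
  then show ?thesis by (auto simp: doubleton_eq_iff)
qed

lemma finite_edges: "E \<in> biregular_graphs m n dL dR \<Longrightarrow> finite E"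
  by (rule finite_subset[of _ "Pow {..<m + n}"]) (auto elim: biregular_graphs_edgeE)

lemma finite_neighbours: "E \<in> biregular_graphs m n dL dR \<Longrightarrow> finite (neighbours E v)"
  by (rule finite_subset[of _ "{..<m + n}"]) (auto simp: neighbours_def dest: biregular_graphs_edge)

lemma card_neighbours_eq:
  assumes E: "E \<in> biregular_graphs m n dL dR"
  shows "card (neighbours E v) = card {e \<in> E. v \<in> e}"
proof -
  have "bij_betw (\<lambda>u. {u, v}) (neighbours E v) {e \<in> E. v \<in> e}"
  proof (rule bij_betw_imageI)
    show "inj_on (\<lambda>u. {u, v}) (neighbours E v)" by (auto simp: inj_on_def doubleton_eq_iff)
    show "(\<lambda>u. {u, v}) ` neighbours E v = {e \<in> E. v \<in> e}"
    proof safe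
      fix e assume e: "e \<in> E" "v \<in> e"
      obtain a b where "e = {a, b}" using E e(1) by (rule biregular_graphs_edgeE)
      then show "e \<in> (\<lambda>u. {u, v}) ` neighbours E v"
        using e by (auto simp: neighbours_def insert_commute image_iff)
    qed (auto simp: neighbours_def)
  qed
  then show ?thesis by (rule bij_betw_same_card)
qed

lemma card_neighbours:
  assumes E: "E \<in> biregular_graphs m n dL dR"
  shows "v < m \<Longrightarrow> card (neighbours E v) = dL"
    and "m \<le> v \<Longrightarrow> v < m + n \<Longrightarrow> card (neighbours E v) = dR"
  using E unfolding card_neighbours_eq[OF E] by (auto simp: biregular_graphs_def)

lemma biregular_graphs_switch:
  assumes E: "E \<in> biregular_graphs m n dL dR"
    and u: "u < m" "u' < m" and v: "m \<le> v" "v < m + n" "m \<le> v'" "v' < m + n"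
    and edges: "{u, v} \<in> E" "{u', v'} \<in> E" "{u, v'} \<notin> E" "{u', v} \<notin> E"
  shows "E - {{u, v}, {u', v'}} \<union> {{u, v'}, {u', v}} \<in> biregular_graphs m n dL dR"
proof -
  define E' where "E' = E - {{u, v}, {u', v'}} \<union> {{u, v'}, {u', v}}"
  have ne: "u \<noteq> u'" "v \<noteq> v'" using edges by auto
  have deg: "card {e \<in> E'. w \<in> e} = card {e \<in> E. w \<in> e}" for w
  proof -
    let ?a = "{e \<in> {{u, v}, {u', v'}}. w \<in> e}" and ?b = "{e \<in> {{u, v'}, {u', v}}. w \<in> e}"
    have fin: "finite {e \<in> E. w \<in> e}" using finite_edges[OF E] by simp
    have "card ?a = card ?b"
    proof -
      have ne': "u \<noteq> v" "u \<noteq> v'" "u' \<noteq> v" "u' \<noteq> v'" using u v by auto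
      consider "w = u" | "w = v" | "w = u'" | "w = v'" | "w \<notin> {u, v, u', v'}" by blast
      then show ?thesis
      proof cases
        case 1
        then have "?a = {{u, v}}" "?b = {{u, v'}}" using ne ne' by fast+
        then show ?thesis by simp
      next
        case 2
        then have "?a = {{u, v}}" "?b = {{u', v}}" using ne ne' by fast+
        then show ?thesis by simp
      next
        case 3
        then have "?a = {{u', v'}}" "?b = {{u', v}}" using ne ne' by fast+
        then show ?thesis by simp
      next
        case 4
        then have "?a = {{u', v'}}" "?b = {{u, v'}}" using ne ne' by fast+
        then show ?thesis by simp
      next
        case 5
        then have "?a = {}" "?b = {}" by auto
        then show ?thesis by (simp only: card.empty)
      qed
    qed
    moreover have "{e \<in> E'. w \<in> e} = ({e \<in> E. w \<in> e} - ?a) \<union> ?b"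
      unfolding E'_def using edges by fast
    moreover have "card (({e \<in> E. w \<in> e} - ?a) \<union> ?b) = card ({e \<in> E. w \<in> e} - ?a) + card ?b"
      using fin edges by (intro card_Un_disjoint) auto
    moreover have "card ({e \<in> E. w \<in> e} - ?a) = card {e \<in> E. w \<in> e} - card ?a"
      using edges by (intro card_Diff_subset) auto
    moreover have "card ?a \<le> card {e \<in> E. w \<in> e}"
      using fin edges by (intro card_mono) auto
    ultimately have "card {e \<in> E'. w \<in> e} = (card {e \<in> E. w \<in> e} - card ?a) + card ?a"
      and "card ?a \<le> card {e \<in> E. w \<in> e}" by (simp_all only:)
    then show ?thesis by (simp only: le_add_diff_inverse2)
  qed
  have "E' \<subseteq> {{u, v} | u v. u \<in> {..<m} \<and> v \<in> {m..<m + n}}"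
  proof
    fix e assume "e \<in> E'"
    then consider "e \<in> E" | "e = {u, v'}" | "e = {u', v}" unfolding E'_def by blast
    then show "e \<in> {{u, v} | u v. u \<in> {..<m} \<and> v \<in> {m..<m + n}}"
    proof cases
      case 1
      with E obtain a b where "e = {a, b}" "a < m" "m \<le> b" "b < m + n" by (rule biregular_graphs_edgeE)
      then show ?thesis by auto
    qed (use u v in auto)
  qed
  then show ?thesis using E deg unfolding biregular_graphs_def E'_def [symmetric] by simp
qed

lemma card_edge_pairs:
  assumes E: "E \<in> biregular_graphs m n dL dR"
  shows "card {(u, v). u < m \<and> m \<le> v \<and> v < m + n \<and> {u, v} \<in> E} = n * dR"
proof -
  have "{(u, v). u < m \<and> m \<le> v \<and> v < m + n \<and> {u, v} \<in> E} =
      (\<lambda>(v, u). (u, v)) ` (SIGMA v:{m..<m + n}. neighbours E v)"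
    using biregular_graphs_edge[OF E] by (force simp: neighbours_def image_iff)
  moreover have "inj_on (\<lambda>(v, u). (u, v)) (SIGMA v:{m..<m + n}. neighbours E v)"
    by (auto simp: inj_on_def)
  moreover have "card (SIGMA v:{m..<m + n}. neighbours E v) = (\<Sum>v\<in>{m..<m + n}. card (neighbours E v))"
    using finite_neighbours[OF E] by (intro card_SigmaI) auto
  moreover have "(\<Sum>v\<in>{m..<m + n}. card (neighbours E v)) = (\<Sum>v\<in>{m..<m + n}. dR)"
    using card_neighbours[OF E] by (intro sum.cong) auto
  ultimately show ?thesis by (simp add: card_image)
qed

text \<open>
  Double counting of the switchings that replace the edges \<open>{u, v}\<close>, \<open>{u', v'}\<close> by \<open>{u, v'}\<close>, \<open>{u', v}\<close>.
\<close>

lemma switching_count: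
  assumes H: "finite H" and e: "{u, v} \<notin> H" and u: "u < m" and v: "m \<le> v" "v < m + n"
  shows "card {E \<in> biregular_graphs m n dL dR. insert {u, v} H \<subseteq> E} * (n * dR - (2 * dL * dR + card H))
    \<le> card {E \<in> biregular_graphs m n dL dR. H \<subseteq> E} * (dL * dR)"
proof -
  let ?G = "biregular_graphs m n dL dR"
  define A1 where "A1 = {E \<in> ?G. insert {u, v} H \<subseteq> E}"
  define A2 where "A2 = {E \<in> ?G. H \<subseteq> E}"
  define pairs where "pairs E = {(u', v'). u' < m \<and> m \<le> v' \<and> v' < m + n \<and> {u', v'} \<in> E}" for E
  define valid where "valid E = {(u', v') \<in> pairs E. {u', v'} \<notin> H \<and> {u, v'} \<notin> E \<and> {u', v} \<notin> E}" for E
  define target where "target E = neighbours E v \<times> neighbours E u" for E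
  \<comment> \<open>The pair \<open>(u', v')\<close> is recorded in the image, which makes the
    switching reversible. In the new graph \<open>u'\<close> is a neighbour of \<open>v\<close> and
    \<open>v'\<close> one of \<open>u\<close>, hence the choice of \<open>target\<close>.\<close>
  define sw where "sw = (\<lambda>(E, u', v'). (E - {{u, v}, {u', v'}} \<union> {{u, v'}, {u', v}}, u', v'))"
  have finA: "finite A1" "finite A2" unfolding A1_def A2_def by (simp_all add: finite_biregular_graphs)
  have fin_pairs: "finite (pairs E)" for E
    by (rule finite_subset[of _ "{..<m} \<times> {..<m + n}"]) (auto simp: pairs_def)
  have inj: "inj_on sw (SIGMA E:A1. valid E)"
  proof (rule inj_on_inverseI[where g = "\<lambda>(E, u', v'). (E - {{u, v'}, {u', v}} \<union> {{u, v}, {u', v'}}, u', v')"])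
    fix x assume "x \<in> (SIGMA E:A1. valid E)"
    then obtain E u' v' where "x = (E, u', v')" "{u, v} \<in> E" "{u', v'} \<in> E" "{u, v'} \<notin> E" "{u', v} \<notin> E"
      by (auto simp: A1_def valid_def pairs_def)
    then show "(case sw x of (E, u', v') \<Rightarrow> (E - {{u, v'}, {u', v}} \<union> {{u, v}, {u', v'}}, u', v')) = x"
      by (auto simp: sw_def)
  qed
  have sub: "sw ` (SIGMA E:A1. valid E) \<subseteq> (SIGMA E:A2. target E)"
  proof
    fix y assume "y \<in> sw ` (SIGMA E:A1. valid E)"
    then obtain E u' v' where *: "y = sw (E, u', v')" "E \<in> ?G" "insert {u, v} H \<subseteq> E" "u' < m" "m \<le> v'" "v' < m + n"
      "{u', v'} \<in> E" "{u', v'} \<notin> H" "{u, v'} \<notin> E" "{u', v} \<notin> E"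
      by (auto simp: A1_def valid_def pairs_def)
    have "E - {{u, v}, {u', v'}} \<union> {{u, v'}, {u', v}} \<in> ?G"
      using * u v by (intro biregular_graphs_switch) auto
    then show "y \<in> (SIGMA E:A2. target E)"
      using * e by (auto simp: sw_def A2_def target_def neighbours_def insert_commute)
  qed
  have "(\<Sum>E\<in>A1. card (valid E)) = card (SIGMA E:A1. valid E)"
    using finA fin_pairs by (intro card_SigmaI[symmetric]) (auto simp: valid_def intro: finite_subset[OF _ fin_pairs])
  also have "\<dots> = card (sw ` (SIGMA E:A1. valid E))"
    using inj by (simp add: card_image)
  also have "\<dots> \<le> card (SIGMA E:A2. target E)"
    using sub finA by (intro card_mono finite_SigmaI) (auto simp: A2_def target_def intro: finite_neighbours)
  also have "\<dots> = (\<Sum>E\<in>A2. card (target E))"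
    using finA by (intro card_SigmaI) (auto simp: A2_def target_def intro: finite_neighbours)
  also have "\<dots> = (\<Sum>E\<in>A2. dL * dR)"
    using card_neighbours u v by (intro sum.cong) (auto simp: A2_def target_def card_cartesian_product)
  finally have upper: "(\<Sum>E\<in>A1. card (valid E)) \<le> card A2 * (dL * dR)" by simp
  have "n * dR - (2 * dL * dR + card H) \<le> card (valid E)" if "E \<in> A1" for E
  proof -
    have E: "E \<in> ?G" using that by (simp add: A1_def)
    \<comment> \<open>The pairs that cannot be used: edges of \<open>H\<close>, edges whose right
      end is adjacent to \<open>u\<close>, and edges whose left end is adjacent to \<open>v\<close>.
      The last two kinds include all edges at \<open>u\<close> or \<open>v\<close>, so that a valid
      pair shares no vertex with \<open>{u, v}\<close>.\<close>
    define B1 where "B1 = {(u', v') \<in> pairs E. {u', v'} \<in> H}"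
    define B2 where "B2 = (\<lambda>(v', u'). (u', v')) ` (SIGMA v':neighbours E u. neighbours E v')"
    define B3 where "B3 = (SIGMA u':neighbours E v. neighbours E u')"
    have nu: "m \<le> v' \<and> v' < m + n" if "v' \<in> neighbours E u" for v'
      using biregular_graphs_edge[OF E, of v' u] that u by (auto simp: neighbours_def)
    have nv: "u' < m" if "u' \<in> neighbours E v" for u'
      using biregular_graphs_edge[OF E, of u' v] that v by (auto simp: neighbours_def)
    have "pairs E \<subseteq> valid E \<union> (B1 \<union> (B2 \<union> B3))"
      by (force simp: pairs_def valid_def B1_def B2_def B3_def neighbours_def insert_commute image_iff)
    moreover have fin: "finite (valid E)" "finite B1" "finite B2" "finite B3"
      using fin_pairs finite_neighbours[OF E]
      by (auto simp: valid_def B1_def B2_def B3_def intro: finite_subset[OF _ fin_pairs])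
    ultimately have "card (pairs E) \<le> card (valid E \<union> (B1 \<union> (B2 \<union> B3)))" by (intro card_mono) auto
    also have "\<dots> \<le> card (valid E) + (card B1 + (card B2 + card B3))"
      using card_Un_le[of "valid E" "B1 \<union> (B2 \<union> B3)"] card_Un_le[of B1 "B2 \<union> B3"]
        card_Un_le[of B2 B3] by linarith
    also have "card B1 \<le> card H"
    proof (rule card_inj_on_le[where f = "\<lambda>(u', v'). {u', v'}"])
      show "inj_on (\<lambda>(u', v'). {u', v'}) B1"
        by (auto simp: inj_on_def B1_def pairs_def doubleton_eq_iff)
    qed (use H in \<open>auto simp: B1_def\<close>)
    also have "card B2 \<le> card (SIGMA v':neighbours E u. neighbours E v')"
      unfolding B2_def using finite_neighbours[OF E] by (intro card_image_le) auto
    also have "\<dots> = (\<Sum>v'\<in>neighbours E u. card (neighbours E v'))"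
      using finite_neighbours[OF E] by (intro card_SigmaI) auto
    also have "\<dots> = dL * dR" using nu card_neighbours[OF E] u by simp
    also have "card B3 = (\<Sum>u'\<in>neighbours E v. card (neighbours E u'))"
      unfolding B3_def using finite_neighbours[OF E] by (intro card_SigmaI) auto
    also have "\<dots> = dR * dL" using nv card_neighbours[OF E] v by simp
    finally have "card (pairs E) \<le> card (valid E) + (card H + (dL * dR + dR * dL))" by linarith
    moreover have "card (pairs E) = n * dR" unfolding pairs_def by (rule card_edge_pairs[OF E])
    ultimately show ?thesis by (simp add: algebra_simps)
  qed
  then have "(\<Sum>E\<in>A1. n * dR - (2 * dL * dR + card H)) \<le> (\<Sum>E\<in>A1. card (valid E))"
    by (intro sum_mono)
  then show ?thesis using upper unfolding A1_def A2_def by simp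
qed

text \<open>Edge by edge: given the edges of \<open>H\<close>, one more prescribed edge has
  conditional probability at most \<open>dL * dR\<close> divided by the number of usable edges. The
  assumption leaves at least half of the \<open>n * dR\<close> edges usable, so each edge costs a
  factor \<open>2 * dL / n\<close>.\<close>

lemma card_supergraphs_le:
  assumes "finite H" "4 * dL * dR + 2 * card H \<le> n * dR" "n > 0" "dR > 0"
  shows "real (card {E \<in> biregular_graphs m n dL dR. H \<subseteq> E}) \<le>
    (2 * real dL / real n) ^ card H * real (card (biregular_graphs m n dL dR))"
  using assms
proof (induction H rule: finite_induct)
  case empty
  then show ?case by simp
next
  case (insert e H)
  let ?G = "biregular_graphs m n dL dR"
  have IH: "real (card {E \<in> ?G. H \<subseteq> E}) \<le> (2 * real dL / real n) ^ card H * real (card ?G)"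
    using insert by simp
  show ?case
  proof (cases "\<exists>u v. e = {u, v} \<and> u < m \<and> m \<le> v \<and> v < m + n")
    case False
    then have "{E \<in> ?G. insert e H \<subseteq> E} = {}"
      by (auto elim: biregular_graphs_edgeE)
    then show ?thesis by (simp only: card.empty) simp
  next
    case True
    then obtain u v where e: "e = {u, v}" "u < m" "m \<le> v" "v < m + n" by blast
    define D where "D = n * dR - (2 * dL * dR + card H)"
    have "2 * (2 * dL * dR + card H) \<le> n * dR" using insert by simp
    moreover have "2 * Q \<le> P \<Longrightarrow> P \<le> 2 * (P - Q)" for P Q :: nat by linarith
    ultimately have D: "n * dR \<le> 2 * D" unfolding D_def by blast
    then have D0: "real D > 0" using insert.prems by (cases D) auto
    have "real (card {E \<in> ?G. insert e H \<subseteq> E}) * real D \<le> real (card {E \<in> ?G. H \<subseteq> E}) * (real dL * real dR)"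
      using switching_count[of H u v m n dL dR] insert.hyps e unfolding D_def
      by (simp flip: of_nat_mult)
    then have "real (card {E \<in> ?G. insert e H \<subseteq> E}) \<le> real (card {E \<in> ?G. H \<subseteq> E}) * (real dL * real dR / real D)"
      using D0 by (simp add: field_simps)
    also have "\<dots> \<le> real (card {E \<in> ?G. H \<subseteq> E}) * (2 * real dL / real n)"
    proof (rule mult_left_mono)
      have "real dL * real dR / real D \<le> real dL * real dR / (real n * real dR / 2)"
        using D D0 insert.prems by (intro divide_left_mono mult_pos_pos) (auto simp flip: of_nat_mult)
      also have "\<dots> = 2 * real dL / real n"
        using insert.prems by (simp add: field_simps)
      finally show "real dL * real dR / real D \<le> 2 * real dL / real n" .
    qed simp
    also have "\<dots> \<le>
      ((2 * real dL / real n) ^ card H * real (card ?G)) * (2 * real dL / real n)"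
      using IH by (intro mult_right_mono) auto
    finally show ?thesis using insert.hyps by (simp add: algebra_simps)
  qed
qed

section \<open>Short cycles\<close>

definition nbwalk :: "nat set set \<Rightarrow> nat list \<Rightarrow> bool" where
  "nbwalk E ws \<longleftrightarrow> (\<forall>i. Suc i < length ws \<longrightarrow> {ws ! i, ws ! Suc i} \<in> E) \<and>
    (\<forall>i. Suc (Suc i) < length ws \<longrightarrow> ws ! i \<noteq> ws ! Suc (Suc i))"

text \<open>Backtracking is excluded only inside the walk: the last step may undo the first.\<close>

definition closed_nbwalk :: "nat set set \<Rightarrow> nat \<Rightarrow> nat \<Rightarrow> bool" where
  "closed_nbwalk E k v \<longleftrightarrow> (\<exists>ws. nbwalk E ws \<and> length ws = Suc k \<and> ws ! 0 = v \<and> ws ! k = v)"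

definition cycle_edges :: "nat list \<Rightarrow> nat set set" where
  "cycle_edges xs = (\<lambda>i. {xs ! i, xs ! (Suc i mod length xs)}) ` {..<length xs}"

definition graph_cycle :: "nat set set \<Rightarrow> nat list \<Rightarrow> bool" where
  "graph_cycle E xs \<longleftrightarrow> distinct xs \<and> 3 \<le> length xs \<and> cycle_edges xs \<subseteq> E"

lemma finite_cycle_edges [simp]: "finite (cycle_edges xs)"
  by (simp add: cycle_edges_def)

text \<open>Two of these edges with different indices coincide only if each index is the cyclic
  successor of the other, which happens only in length 2.\<close>

lemma card_cycle_edges:
  assumes "distinct xs" "3 \<le> length xs"
  shows "card (cycle_edges xs) = length xs"
proof -
  let ?l = "length xs"
  have "inj_on (\<lambda>i. {xs ! i, xs ! (Suc i mod ?l)}) {..<?l}"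
  proof (rule inj_onI)
    fix i j assume ij: "i \<in> {..<?l}" "j \<in> {..<?l}"
      and eq: "{xs ! i, xs ! (Suc i mod ?l)} = {xs ! j, xs ! (Suc j mod ?l)}"
    have nth: "xs ! a = xs ! b \<longleftrightarrow> a = b" if "a < ?l" "b < ?l" for a b
      using assms(1) that by (simp add: nth_eq_iff_index_eq)
    have l0: "Suc i mod ?l < ?l" "Suc j mod ?l < ?l" using assms by (auto intro: mod_less_divisor)
    have "i = j \<or> (i = Suc j mod ?l \<and> Suc i mod ?l = j)"
      using eq ij l0 by (auto simp: doubleton_eq_iff nth)
    then show "i = j"
      using ij assms(2) by (auto simp: mod_Suc split: if_splits)
  qed
  then show ?thesis by (simp add: cycle_edges_def card_image)
qed

lemma cycle_edges_vertices:
  assumes "e \<in> cycle_edges xs"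
  shows "e \<noteq> {}" "e \<subseteq> set xs"
proof -
  obtain i where i: "i < length xs" "e = {xs ! i, xs ! (Suc i mod length xs)}"
    using assms by (auto simp: cycle_edges_def)
  then have "Suc i mod length xs < length xs" by (intro mod_less_divisor) auto
  then show "e \<noteq> {}" "e \<subseteq> set xs" using i by auto
qed

lemma cycle_edges_disjoint: "set xs \<inter> set ys = {} \<Longrightarrow> cycle_edges xs \<inter> cycle_edges ys = {}"
  using cycle_edges_vertices by blast

lemma cycle_vertices:
  assumes E: "E \<in> biregular_graphs m n dL dR" and xs: "graph_cycle E xs"
  shows "set xs \<subseteq> {..<m + n}"
proof
  fix x assume "x \<in> set xs"
  then obtain i where i: "i < length xs" "x = xs ! i" by (auto simp: in_set_conv_nth)
  then have "{xs ! i, xs ! (Suc i mod length xs)} \<in> E"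
    using xs by (auto simp: graph_cycle_def cycle_edges_def)
  then show "x \<in> {..<m + n}" using biregular_graphs_edge[OF E] i by fastforce
qed

text \<open>A cycle occurs as a list with every starting point and orientation. The repetitions only
  enlarge a number that is to be bounded from above.\<close>

definition disjoint_cycle_pairs :: "nat \<Rightarrow> nat set set \<Rightarrow> (nat list \<times> nat list) set" where
  "disjoint_cycle_pairs K E = {(xs, ys). graph_cycle E xs \<and> graph_cycle E ys \<and> length xs \<le> K \<and> length ys \<le> K \<and>
     set xs \<inter> set ys = {}}"

lemma sum_power_length_le:
  fixes c :: real
  assumes "c \<ge> 0" "c * real N \<le> b" "b \<ge> 1"
  shows "(\<Sum>xs\<in>{xs. set xs \<subseteq> {..<N} \<and> 1 \<le> length xs \<and> length xs \<le> K}. c ^ length xs) \<le> real K * b ^ K"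
proof -
  have "{xs. set xs \<subseteq> {..<N} \<and> 1 \<le> length xs \<and> length xs \<le> K} =
      (\<Union>l\<in>{1..K}. {xs. set xs \<subseteq> {..<N} \<and> length xs = l})" by auto
  then have "(\<Sum>xs\<in>{xs. set xs \<subseteq> {..<N} \<and> 1 \<le> length xs \<and> length xs \<le> K}. c ^ length xs) =
      (\<Sum>l=1..K. \<Sum>xs\<in>{xs. set xs \<subseteq> {..<N} \<and> length xs = l}. c ^ length xs)"
    by (simp only:) (rule sum.UNION_disjoint, auto simp: finite_lists_length_eq)
  also have "\<dots> = (\<Sum>l=1..K. (c * real N) ^ l)"
    by (intro sum.cong refl) (simp add: card_lists_length_eq power_mult_distrib mult.commute)
  also have "\<dots> \<le> (\<Sum>l=1..K. b ^ K)"
    using assms by (intro sum_mono order_trans[OF power_mono power_increasing]) auto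
  finally show ?thesis by simp
qed

text \<open>A cycle has as many edges as vertices: each vertex offers \<open>m + n\<close> choices
  and each edge costs \<open>c = 2 * dL / n\<close>. As \<open>m * dL = n * dR\<close>, the product
  is \<open>2 * (dL + dR)\<close>, at most \<open>4 * dR\<close>. For disjoint cycles the edge
  numbers add up, to at most \<open>2 * K\<close>, so the bound for pairs is the square of that for
  single cycles.\<close>

lemma sum_disjoint_cycle_pairs_le:
  assumes G: "G = biregular_graphs m n dL dR"
    and deg: "m * dL = n * dR" "dL \<le> dR" "n > 0" "dR > 0" and small: "4 * dL * dR + 4 * K \<le> n * dR"
  shows "(\<Sum>E\<in>G. real (card (disjoint_cycle_pairs K E))) \<le> real (card G) * (real K * (4 * real dR) ^ K)\<^sup>2"
proof -
  define c where "c = 2 * real dL / real n"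
  define L where "L = {xs. set xs \<subseteq> {..<m + n} \<and> 1 \<le> length xs \<and> length xs \<le> K}"
  define X where "X = {(xs, ys). xs \<in> L \<and> ys \<in> L \<and> distinct xs \<and> distinct ys \<and> 3 \<le> length xs \<and> 3 \<le> length ys \<and> set xs \<inter> set ys = {}}"
  have finL: "finite L"
    by (rule finite_subset[OF _ finite_lists_length_le[of "{..<m + n}" K]]) (auto simp: L_def)
  then have finX: "finite X"
    by (intro finite_subset[of X "L \<times> L"]) (auto simp: X_def)
  have finG: "finite G" by (simp add: G finite_biregular_graphs)
  have pairs: "disjoint_cycle_pairs K E = {p \<in> X. cycle_edges (fst p) \<union> cycle_edges (snd p) \<subseteq> E}" if "E \<in> G" for E
    using cycle_vertices[of E m n dL dR] that
    by (auto simp: disjoint_cycle_pairs_def X_def L_def graph_cycle_def G)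
  have "(\<Sum>E\<in>G. real (card (disjoint_cycle_pairs K E))) =
      (\<Sum>E\<in>G. \<Sum>p\<in>X. if cycle_edges (fst p) \<union> cycle_edges (snd p) \<subseteq> E then 1 else 0)"
    using finX by (intro sum.cong refl) (simp add: pairs sum.If_cases Collect_conj_eq)
  also have "\<dots> = (\<Sum>p\<in>X. \<Sum>E\<in>G. if cycle_edges (fst p) \<union> cycle_edges (snd p) \<subseteq> E then 1 else 0)"
    by (rule sum.swap)
  also have "\<dots> = (\<Sum>p\<in>X. real (card {E \<in> G. cycle_edges (fst p) \<union> cycle_edges (snd p) \<subseteq> E}))"
    using finG by (intro sum.cong refl) (simp add: sum.If_cases Collect_conj_eq)
  also have "\<dots> \<le> (\<Sum>p\<in>X. c ^ length (fst p) * c ^ length (snd p) * real (card G))"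
  proof (rule sum_mono)
    fix p assume p: "p \<in> X"
    obtain xs ys where xy: "p = (xs, ys)" by (cases p)
    let ?H = "cycle_edges xs \<union> cycle_edges ys"
    have card: "card ?H = length xs + length ys"
      using p xy cycle_edges_disjoint[of xs ys]
      by (subst card_Un_disjoint) (auto simp: X_def card_cycle_edges)
    have "length xs + length ys \<le> 2 * K" using p xy by (auto simp: X_def L_def)
    then have "real (card {E \<in> G. ?H \<subseteq> E}) \<le> c ^ card ?H * real (card G)"
      unfolding c_def G using small deg card by (intro card_supergraphs_le) auto
    then show "real (card {E \<in> G. cycle_edges (fst p) \<union> cycle_edges (snd p) \<subseteq> E}) \<le>
        c ^ length (fst p) * c ^ length (snd p) * real (card G)"
      by (simp add: xy card power_add)
  qed
  also have "\<dots> \<le> (\<Sum>p\<in>L \<times> L. c ^ length (fst p) * c ^ length (snd p) * real (card G))"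
    using finL by (intro sum_mono2) (auto simp: X_def c_def)
  also have "\<dots> = real (card G) * (\<Sum>xs\<in>L. c ^ length xs)\<^sup>2"
    by (simp add: power2_eq_square sum_product sum.cartesian_product sum_distrib_left case_prod_beta algebra_simps)
  also have "\<dots> \<le> real (card G) * (real K * (4 * real dR) ^ K)\<^sup>2"
  proof (intro mult_left_mono power_mono)
    have "c * real (m + n) = 2 * (real dL + real (m * dL) / real n)"
      using deg(3) by (simp add: c_def field_simps)
    also have "real (m * dL) / real n = real dR" using deg by simp
    finally have "c * real (m + n) \<le> 4 * real dR" using deg(2) by simp
    then show "(\<Sum>xs\<in>L. c ^ length xs) \<le> real K * (4 * real dR) ^ K"
      unfolding L_def using deg(4) by (intro sum_power_length_le) (auto simp: c_def)
  qed (auto simp: c_def intro: sum_nonneg)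
  finally show ?thesis .
qed

lemma card_many_disjoint_cycle_pairs_le:
  assumes G: "G = biregular_graphs m n dL dR"
    and deg: "m * dL = n * dR" "dL \<le> dR" "n > 0" "dR > 0" and small: "4 * dL * dR + 4 * K \<le> n * dR"
    and T: "T > 0"
  shows "real (card {E \<in> G. T\<^sup>2 \<le> card (disjoint_cycle_pairs K E)}) \<le>
    real (card G) * (real K * (4 * real dR) ^ K / real T)\<^sup>2"
proof -
  have finG: "finite G" by (simp add: G finite_biregular_graphs)
  have "real (card {E \<in> G. T\<^sup>2 \<le> card (disjoint_cycle_pairs K E)}) * (real T)\<^sup>2 =
      (\<Sum>E\<in>{E \<in> G. T\<^sup>2 \<le> card (disjoint_cycle_pairs K E)}. real (T\<^sup>2))" by simp
  also have "\<dots> \<le> (\<Sum>E\<in>{E \<in> G. T\<^sup>2 \<le> card (disjoint_cycle_pairs K E)}. real (card (disjoint_cycle_pairs K E)))"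
    by (intro sum_mono) (simp only: mem_Collect_eq of_nat_le_iff)
  also have "\<dots> \<le> (\<Sum>E\<in>G. real (card (disjoint_cycle_pairs K E)))"
    using finG by (intro sum_mono2) auto
  also have "\<dots> \<le> real (card G) * (real K * (4 * real dR) ^ K)\<^sup>2"
    by (rule sum_disjoint_cycle_pairs_le[OF G deg small])
  finally show ?thesis using T by (simp add: power_divide field_simps)
qed

fun reach :: "nat set set \<Rightarrow> nat \<Rightarrow> nat \<Rightarrow> nat set" where
  "reach E 0 z = {z}"
| "reach E (Suc r) z = reach E r z \<union> (\<Union>x\<in>reach E r z. neighbours E x)"

lemma card_neighbours_le:
  assumes E: "E \<in> biregular_graphs m n dL dR" and "dL \<le> dR"
  shows "card (neighbours E v) \<le> dR"
proof -
  consider "v < m" | "m \<le> v" "v < m + n" | "m + n \<le> v" by linarith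
  then show ?thesis
  proof cases
    case 3
    then have "neighbours E v = {}" using biregular_graphs_edge[OF E] by (fastforce simp: neighbours_def)
    then show ?thesis by simp
  qed (use card_neighbours[OF E] assms(2) in auto)
qed

lemma card_reach_le:
  assumes E: "E \<in> biregular_graphs m n dL dR" and "dL \<le> dR"
  shows "finite (reach E r z) \<and> card (reach E r z) \<le> (1 + dR) ^ r"
proof (induction r)
  case (Suc r)
  have "card (\<Union>x\<in>reach E r z. neighbours E x) \<le> (\<Sum>x\<in>reach E r z. card (neighbours E x))"
    using Suc by (intro card_UN_le) auto
  also have "\<dots> \<le> (\<Sum>x\<in>reach E r z. dR)"
    using card_neighbours_le[OF assms] by (intro sum_mono)
  finally have "card (reach E (Suc r) z) \<le> card (reach E r z) + card (reach E r z) * dR"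
    by (simp add: order_trans[OF card_Un_le])
  also have "\<dots> = card (reach E r z) * (1 + dR)" by simp
  also have "\<dots> \<le> (1 + dR) ^ r * (1 + dR)" using Suc by (intro mult_right_mono) auto
  finally show ?case using Suc finite_neighbours[OF E] by (simp add: mult.commute)
qed simp

lemma reach_mono: "r \<le> r' \<Longrightarrow> reach E r z \<subseteq> reach E r' z"
  by (induction rule: dec_induct) auto

lemma nbwalk_reach:
  assumes "nbwalk E ws" "i < length ws"
  shows "ws ! 0 \<in> reach E i (ws ! i)"
proof -
  have "ws ! (i - k) \<in> reach E k (ws ! i)" if "k \<le> i" for k
    using that
  proof (induction k)
    case (Suc k)
    have "{ws ! (i - Suc k), ws ! Suc (i - Suc k)} \<in> E"
      using assms Suc.prems unfolding nbwalk_def by auto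
    moreover have "Suc (i - Suc k) = i - k" using Suc.prems by simp
    ultimately have "ws ! (i - Suc k) \<in> neighbours E (ws ! (i - k))" by (simp add: neighbours_def)
    then show ?case using Suc by auto
  qed simp
  from this[of i] show ?thesis by simp
qed

text \<open>The walk is cut at the first vertex that has been visited before; the part since the
  earlier visit is a cycle. Length 1 would be a loop, and length 2 would be a backtracking.\<close>

lemma closed_nbwalk_cycle:
  assumes E: "E \<in> biregular_graphs m n dL dR" and ws: "nbwalk E ws" "length ws = Suc k" "ws ! 0 = ws ! k" "1 \<le> k"
  shows "\<exists>xs. graph_cycle E xs \<and> length xs \<le> k \<and> (\<forall>x\<in>set xs. \<exists>i<k. x = ws ! i)"
proof -
  define P where "P j \<longleftrightarrow> j < length ws \<and> (\<exists>i<j. ws ! i = ws ! j)" for j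
  have "P k" unfolding P_def using ws by (auto intro!: exI[of _ 0])
  define j where "j = (LEAST j. P j)"
  have "P j" unfolding j_def using \<open>P k\<close> by (rule LeastI)
  then obtain i where i: "i < j" "ws ! i = ws ! j" "j < length ws" unfolding P_def by blast
  have least: "\<not> P b" if "b < j" for b using that unfolding j_def by (rule not_less_Least)
  have jk: "j \<le> k" using i ws by simp
  define xs where "xs = drop i (take j ws)"
  have len: "length xs = j - i" using i by (simp add: xs_def)
  have nth: "xs ! l = ws ! (i + l)" if "l < j - i" for l
    using that i by (simp add: xs_def)
  have no_loop: "a \<noteq> b" if "{a, b} \<in> E" for a b
    using biregular_graphs_edge[OF E that] by auto
  have edge: "{ws ! l, ws ! Suc l} \<in> E" if "Suc l < length ws" for l
    using ws(1) that by (auto simp: nbwalk_def)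
  have "distinct (take j ws)"
    unfolding distinct_conv_nth
  proof (intro allI impI)
    fix a b assume ab: "a < length (take j ws)" "b < length (take j ws)" "a \<noteq> b"
    have ne: "ws ! a \<noteq> ws ! b" if "a < b" "b < j" for a b
      using least[OF that(2)] that i unfolding P_def by auto
    have "ws ! a \<noteq> ws ! b"
      using ne[of a b] ne[of b a] ab by (cases a b rule: linorder_cases) auto
    then show "take j ws ! a \<noteq> take j ws ! b" using ab by simp
  qed
  then have "distinct xs" by (simp add: xs_def)
  moreover have "3 \<le> length xs"
  proof -
    have "j \<noteq> Suc i" using no_loop[OF edge[of i]] i by auto
    moreover have "j \<noteq> Suc (Suc i)" using ws(1) i unfolding nbwalk_def by auto
    ultimately show ?thesis using i len by linarith
  qed
  moreover have "cycle_edges xs \<subseteq> E"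
  proof
    fix e assume "e \<in> cycle_edges xs"
    then obtain l where l: "l < j - i" "e = {xs ! l, xs ! (Suc l mod length xs)}"
      by (auto simp: cycle_edges_def len)
    have "xs ! (Suc l mod length xs) = ws ! Suc (i + l)"
    proof (cases "Suc l = j - i")
      case True
      then have "Suc (i + l) = j" using i by simp
      then show ?thesis using True i nth[of 0] by (simp add: len)
    next
      case False
      then show ?thesis using l nth[of "Suc l"] by (simp add: len)
    qed
    moreover have "Suc (i + l) < length ws" using l i by linarith
    ultimately show "e \<in> E" using l nth[of l] edge[of "i + l"] by simp
  qed
  moreover have "\<exists>i<k. x = ws ! i" if x: "x \<in> set xs" for x
  proof -
    obtain l where "l < j - i" "x = xs ! l" using x len by (metis in_set_conv_nth)
    then show ?thesis using nth[of l] jk by (intro exI[of _ "i + l"]) auto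
  qed
  ultimately show ?thesis
    using len jk by (intro exI[of _ xs]) (auto simp: graph_cycle_def)
qed

text \<open>
  A maximal family of pairwise disjoint short cycles has fewer than \<open>T + 1\<close> members and meets
  every short cycle, hence comes close to each of the vertices to be counted.
\<close>

lemma card_closed_nbwalk_le:
  assumes E: "E \<in> biregular_graphs m n dL dR" and deg: "dL \<le> dR"
    and few: "card (disjoint_cycle_pairs K E) < T\<^sup>2"
  shows "card {v. \<exists>k. 1 \<le> k \<and> k \<le> K \<and> closed_nbwalk E k v} \<le> T * K * (1 + dR) ^ K"
proof -
  define S where "S = {xs. graph_cycle E xs \<and> length xs \<le> K}"
  have finS: "finite S"
    by (rule finite_subset[OF _ finite_lists_length_le[of "{..<m + n}" K]])
      (use cycle_vertices[OF E] in \<open>auto simp: S_def\<close>)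
  define \<F> where "\<F> = {F. F \<subseteq> S \<and> (\<forall>xs\<in>F. \<forall>ys\<in>F. xs \<noteq> ys \<longrightarrow> set xs \<inter> set ys = {})}"
  have "finite \<F>" unfolding \<F>_def using finS by (auto intro: finite_subset[of _ "Pow S"])
  moreover have "{} \<in> \<F>" by (simp add: \<F>_def)
  ultimately obtain F where F: "F \<in> \<F>" and max: "\<And>F'. F' \<in> \<F> \<Longrightarrow> F \<subseteq> F' \<Longrightarrow> F = F'"
    using finite_has_maximal[of \<F>] by blast
  have finF: "finite F" using F finS by (auto simp: \<F>_def intro: finite_subset)
  have meets: "\<exists>ys\<in>F. set xs \<inter> set ys \<noteq> {}" if xs: "xs \<in> S" for xs
  proof (rule ccontr)
    assume *: "\<not> ?thesis"
    then have "insert xs F \<in> \<F>" using F xs by (auto simp: \<F>_def)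
    then have "F = insert xs F" using max[of "insert xs F"] by auto
    then have "set xs \<inter> set xs = {}" using * by blast
    then show False using xs by (auto simp: S_def graph_cycle_def)
  qed
  have "card F \<le> T"
  proof (rule ccontr)
    assume "\<not> card F \<le> T"
    then have f: "Suc T \<le> card F" by simp
    have "F \<times> F - (\<lambda>x. (x, x)) ` F \<subseteq> disjoint_cycle_pairs K E"
    proof clarify
      fix xs ys assume xy: "xs \<in> F" "ys \<in> F" "(xs, ys) \<notin> (\<lambda>x. (x, x)) ` F"
      then have "xs \<noteq> ys" by blast
      then show "(xs, ys) \<in> disjoint_cycle_pairs K E"
        using F xy by (auto simp: \<F>_def S_def disjoint_cycle_pairs_def)
    qed
    moreover have "finite (disjoint_cycle_pairs K E)"
      by (rule finite_subset[of _ "S \<times> S"]) (use finS in \<open>auto simp: S_def disjoint_cycle_pairs_def\<close>)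
    ultimately have "card (F \<times> F - (\<lambda>x. (x, x)) ` F) \<le> card (disjoint_cycle_pairs K E)"
      by (intro card_mono)
    also have "\<dots> < T\<^sup>2" by (rule few)
    finally have "card (F \<times> F - (\<lambda>x. (x, x)) ` F) < T * T" by (simp add: power2_eq_square)
    moreover have "card (F \<times> F - (\<lambda>x. (x, x)) ` F) = card F * card F - card F"
      using finF by (subst card_Diff_subset) (auto simp: card_cartesian_product card_image inj_on_def)
    moreover have "card F * card F - card F = card F * (card F - 1)" by (simp add: algebra_simps)
    moreover have "Suc T * T \<le> card F * (card F - 1)" using f by (intro mult_le_mono) auto
    ultimately show False by simp
  qed
  define V where "V = (\<Union>xs\<in>F. set xs)"
  have finV: "finite V" using finF by (simp add: V_def)
  have "card V \<le> (\<Sum>xs\<in>F. card (set xs))" unfolding V_def using finF by (intro card_UN_le)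
  also have "\<dots> \<le> (\<Sum>xs\<in>F. K)"
    using F by (intro sum_mono order_trans[OF card_length]) (auto simp: \<F>_def S_def)
  also have "\<dots> \<le> T * K" using \<open>card F \<le> T\<close> by simp
  finally have cardV: "card V \<le> T * K" .
  \<comment> \<open>A closed walk at \<open>v\<close> contains a short cycle, this cycle meets
    \<open>V\<close> by maximality, and the walk itself leads from \<open>v\<close> to the common
    vertex in fewer than \<open>K\<close> steps.\<close>
  have "{v. \<exists>k. 1 \<le> k \<and> k \<le> K \<and> closed_nbwalk E k v} \<subseteq> (\<Union>z\<in>V. reach E K z)"
  proof clarify
    fix v k assume k: "1 \<le> k" "k \<le> K" and "closed_nbwalk E k v"
    then obtain ws where ws: "nbwalk E ws" "length ws = Suc k" "ws ! 0 = v" "ws ! k = v"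
      by (auto simp: closed_nbwalk_def)
    then obtain xs where xs: "graph_cycle E xs" "length xs \<le> k" "\<forall>x\<in>set xs. \<exists>i<k. x = ws ! i"
      using closed_nbwalk_cycle[OF E, of ws k] k by auto
    then obtain ys where ys: "ys \<in> F" "set xs \<inter> set ys \<noteq> {}"
      using meets[of xs] k by (auto simp: S_def)
    then obtain z where z: "z \<in> set xs" "z \<in> V" by (auto simp: V_def)
    then obtain i where i: "i < k" "z = ws ! i" using xs by blast
    then have "v \<in> reach E i z" using nbwalk_reach[OF ws(1), of i] ws by simp
    then have "v \<in> reach E K z" using reach_mono[of i K E z] i k by auto
    then show "v \<in> (\<Union>z\<in>V. reach E K z)" using z by blast
  qed
  moreover have "finite (\<Union>z\<in>V. reach E K z)" using finV card_reach_le[OF E deg] by blast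
  ultimately have "card {v. \<exists>k. 1 \<le> k \<and> k \<le> K \<and> closed_nbwalk E k v} \<le> card (\<Union>z\<in>V. reach E K z)"
    by (intro card_mono)
  also have "\<dots> \<le> (\<Sum>z\<in>V. card (reach E K z))" by (intro card_UN_le finV)
  also have "\<dots> \<le> (\<Sum>z\<in>V. (1 + dR) ^ K)" using card_reach_le[OF E deg] by (intro sum_mono) blast
  also have "\<dots> \<le> T * K * (1 + dR) ^ K" using cardV by simp
  finally show ?thesis .
qed

section \<open>Spectrum of symmetric matrices\<close>

lemma splits_if_size_proots:
  fixes p :: "real poly"
  assumes "degree p = n" "lead_coeff p = 1" "size (proots p) = n"
  shows "\<exists>as. p = (\<Prod>a\<leftarrow>as. [:- a, 1:]) \<and> mset as = proots p"
  using assms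
proof (induction n arbitrary: p)
  case 0
  then have "p = 1" by (metis degree_eq_zeroE lead_coeff_pCons(2) one_pCons)
  then show ?case by (intro exI[of _ "[]"]) simp
next
  case (Suc n)
  then have "proots p \<noteq> {#}" by auto
  then obtain a where a: "a \<in># proots p" by (rule multiset_nonemptyE)
  have p0: "p \<noteq> 0" using Suc.prems by auto
  then have "poly p a = 0" using a by simp
  then obtain q where q: "p = [:- a, 1:] * q" by (auto simp: poly_eq_0_iff_dvd)
  have q0: "q \<noteq> 0" using p0 q by auto
  have roots: "proots p = {#a#} + proots q"
    unfolding q using q0 by (subst proots_mult) (simp_all del: mult_pCons_left)
  have "lead_coeff q = 1" using Suc.prems(2) unfolding q lead_coeff_mult by simp
  moreover have "degree q = n" using Suc.prems(1) q0 unfolding q by (subst (asm) degree_mult_eq) auto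
  moreover have "size (proots q) = n" using Suc.prems(3) roots by simp
  ultimately obtain as where "q = (\<Prod>a\<leftarrow>as. [:- a, 1:])" "mset as = proots q" using Suc.IH by blast
  then show ?case using roots q by (intro exI[of _ "a # as"]) simp
qed

lemma proots_prod_linear: "proots (\<Prod>b\<leftarrow>bs. [:- b, 1 :: real:]) = mset bs"
proof (induction bs)
  case (Cons b bs)
  have "(\<Prod>b\<leftarrow>bs. [:- b, 1 :: real:]) \<noteq> 0" by (auto simp: prod_list_zero_iff)
  then have "proots ([:- b, 1:] * (\<Prod>b\<leftarrow>bs. [:- b, 1:])) = {#b#} + mset bs"
    by (subst proots_mult) (simp_all add: Cons.IH del: mult_pCons_left)
  then show ?case by (simp only: list.map prod_list.Cons) simp
qed simp

lemma eigenvalue_mset_upper_triangular: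
  fixes B :: "real mat"
  assumes "B \<in> carrier_mat N N" "upper_triangular B"
  shows "eigenvalue_mset B = mset (diag_mat B)"
  unfolding eigenvalue_mset_def char_poly_upper_triangular[OF assms] by (rule proots_prod_linear)

lemma eigenvalue_mset_similar: "similar_mat A B \<Longrightarrow> eigenvalue_mset A = eigenvalue_mset B"
  unfolding eigenvalue_mset_def by (simp add: char_poly_similar)

text \<open>The Schur decomposition needs a characteristic polynomial that splits over the reals,
  which symmetry provides. A triangular form is enough, since only its diagonal and traces are read
  off.\<close>

lemma symmetric_triangularization:
  fixes A :: "real mat"
  assumes A: "A \<in> carrier_mat N N" and sym: "transpose_mat A = A"
  obtains B P Q where "similar_mat_wit A B P Q" "upper_triangular B" "mset (diag_mat B) = eigenvalue_mset A"
proof -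
  have "degree (char_poly A) = N" "lead_coeff (char_poly A) = 1"
    using degree_monic_char_poly[OF A] by auto
  then obtain as where as: "char_poly A = (\<Prod>a\<leftarrow>as. [:- a, 1:])" "mset as = eigenvalue_mset A"
    using splits_if_size_proots[of "char_poly A" N] size_eigenvalues_symmetric[OF A sym]
    unfolding eigenvalue_mset_def by blast
  obtain B P Q where "schur_decomposition A as = (B, P, Q)" by (cases "schur_decomposition A as") auto
  from schur_decomposition[OF A as(1) this] show ?thesis using as(2) that by metis
qed

lemma eigenvalue_mset_smult:
  fixes A :: "real mat"
  assumes A: "A \<in> carrier_mat N N" and sym: "transpose_mat A = A"
  shows "eigenvalue_mset (c \<cdot>\<^sub>m A) = image_mset ((*) c) (eigenvalue_mset A)"
proof -
  obtain B P Q where sim: "similar_mat_wit A B P Q" and up: "upper_triangular B"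
    and diag: "mset (diag_mat B) = eigenvalue_mset A"
    using symmetric_triangularization[OF A sym] .
  note D = similar_mat_witD2[OF A sim]
  have "similar_mat (c \<cdot>\<^sub>m A) (c \<cdot>\<^sub>m B)"
  proof (rule similar_matI)
    show "{c \<cdot>\<^sub>m A, c \<cdot>\<^sub>m B, P, Q} \<subseteq> carrier_mat N N" using D by auto
    show "c \<cdot>\<^sub>m A = P * (c \<cdot>\<^sub>m B) * Q"
      unfolding D(3) using D(5,6,7) by (simp add: mult_smult_distrib[of _ N N _ N] mult_smult_assoc_mat[of _ N N _ N])
  qed (use D in auto)
  moreover have "upper_triangular (c \<cdot>\<^sub>m B)" using up D(5) unfolding upper_triangular_def by auto
  moreover have "diag_mat (c \<cdot>\<^sub>m B) = map ((*) c) (diag_mat B)"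
    using D(5) by (auto simp: diag_mat_def)
  ultimately have "eigenvalue_mset (c \<cdot>\<^sub>m A) = mset (map ((*) c) (diag_mat B))"
    using eigenvalue_mset_upper_triangular[of "c \<cdot>\<^sub>m B" N] D(5) by (simp add: eigenvalue_mset_similar)
  then show ?thesis by (simp add: diag)
qed

text \<open>Conjugation by the diagonal matrix with signs 1 and -1 on the two sides negates the
  matrix.\<close>

lemma eigenvalue_mset_bipartite:
  fixes A :: "real mat"
  assumes A: "A \<in> carrier_mat N N" and sym: "transpose_mat A = A"
    and bip: "\<And>i j. i < N \<Longrightarrow> j < N \<Longrightarrow> A $$ (i, j) \<noteq> 0 \<Longrightarrow> (i < m) \<noteq> (j < m)"
  shows "image_mset uminus (eigenvalue_mset A) = eigenvalue_mset A"
proof -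
  define S where "S = mat N N (\<lambda>(i, j). if i = j then (if i < m then 1 else - 1 :: real) else 0)"
  have S: "S \<in> carrier_mat N N" by (simp add: S_def)
  have mult_left: "(S * X) $$ (i, j) = (if i < m then 1 else - 1) * X $$ (i, j)"
    if "X \<in> carrier_mat N N" "i < N" "j < N" for X i j
    using that by (simp add: S_def scalar_prod_def if_distrib[of "\<lambda>x. x * _"] cong: if_cong)
  have mult_right: "(X * S) $$ (i, j) = X $$ (i, j) * (if j < m then 1 else - 1)"
    if "X \<in> carrier_mat N N" "i < N" "j < N" for X i j
    using that by (simp add: S_def scalar_prod_def if_distrib[of "\<lambda>x. _ * x"] cong: if_cong)
  have SS: "S * S = 1\<^sub>m N"
  proof (rule eq_matI)
    fix i j assume "i < dim_row (1\<^sub>m N :: real mat)" "j < dim_col (1\<^sub>m N :: real mat)"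
    then have ij: "i < N" "j < N" by auto
    show "(S * S) $$ (i, j) = 1\<^sub>m N $$ (i, j)"
      unfolding mult_left[OF S ij] using ij by (simp add: S_def)
  qed (use S in auto)
  have "(-1) \<cdot>\<^sub>m A = S * A * S"
  proof (rule eq_matI)
    fix i j assume "i < dim_row (S * A * S)" "j < dim_col (S * A * S)"
    then have ij: "i < N" "j < N" using S A by auto
    have SA: "S * A \<in> carrier_mat N N" using S A by simp
    have "(S * A * S) $$ (i, j) = (if i < m then 1 else - 1) * A $$ (i, j) * (if j < m then 1 else - 1)"
      unfolding mult_right[OF SA ij] mult_left[OF A ij] ..
    then show "((-1) \<cdot>\<^sub>m A) $$ (i, j) = (S * A * S) $$ (i, j)"
      using ij A bip[of i j] by (cases "A $$ (i, j) = 0") (auto split: if_splits)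
  qed (use S A in auto)
  then have "similar_mat ((-1) \<cdot>\<^sub>m A) A"
    using S A SS by (intro similar_matI[of _ _ S S N]) auto
  then have "eigenvalue_mset ((-1) \<cdot>\<^sub>m A) = eigenvalue_mset A" by (rule eigenvalue_mset_similar)
  moreover have "(*) (- 1) = (uminus :: real \<Rightarrow> real)" by (rule ext) simp
  ultimately show ?thesis unfolding eigenvalue_mset_smult[OF A sym] by simp
qed

lemma measure_empirical_spectral_distribution:
  assumes "eigenvalue_mset A = mset bs" "bs \<noteq> []"
  shows "measure (empirical_spectral_distribution A) J = real (card {i. i < length bs \<and> bs ! i \<in> J}) / real (length bs)"
proof -
  have ne: "mset bs \<noteq> {#}" using assms by simp
  have "measure (empirical_spectral_distribution A) J = measure_pmf.prob (pmf_of_multiset (mset bs)) (J \<inter> set bs)"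
    unfolding empirical_spectral_distribution_def assms(1)
    using measure_Int_set_pmf[of "pmf_of_multiset (mset bs)" J] ne by simp
  also have "\<dots> = (\<Sum>x\<in>J \<inter> set bs. real (count (mset bs) x) / real (length bs))"
    using ne by (subst measure_measure_pmf_finite) auto
  also have "\<dots> = real (\<Sum>x\<in>J \<inter> set bs. count (mset bs) x) / real (length bs)"
    by (simp add: sum_divide_distrib)
  also have "(\<Sum>x\<in>J \<inter> set bs. count (mset bs) x) = size (filter_mset (\<lambda>x. x \<in> J) (mset bs))"
    unfolding size_multiset_overloaded_eq by (intro sum.cong) auto
  also have "\<dots> = length (filter (\<lambda>x. x \<in> J) bs)" by (metis mset_filter size_mset)
  also have "\<dots> = card {i. i < length bs \<and> bs ! i \<in> J}" by (rule length_filter_conv_card)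
  finally show ?thesis .
qed

section \<open>Traces of polynomials in a matrix by simultaneous triangularization\<close>

definition trace_mat :: "real mat \<Rightarrow> real" where
  "trace_mat A = (\<Sum>i<dim_row A. A $$ (i, i))"

lemma trace_mat_mult_commute:
  assumes "X \<in> carrier_mat N N" "Y \<in> carrier_mat N N"
  shows "trace_mat (X * Y) = trace_mat (Y * X)"
proof -
  have *: "trace_mat (X * Y) = (\<Sum>i<N. \<Sum>j<N. X $$ (i, j) * Y $$ (j, i))"
    if "X \<in> carrier_mat N N" "Y \<in> carrier_mat N N" for X Y
    using that by (simp add: trace_mat_def scalar_prod_def atLeast0LessThan)
  show ?thesis
    unfolding *[OF assms] *[OF assms(2,1)] by (subst sum.swap) (simp add: mult.commute)
qed

lemma upper_triangular_mult:
  fixes X Y :: "real mat"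
  assumes "X \<in> carrier_mat N N" "Y \<in> carrier_mat N N" "upper_triangular X" "upper_triangular Y"
  shows "upper_triangular (X * Y)" and "i < N \<Longrightarrow> (X * Y) $$ (i, i) = X $$ (i, i) * Y $$ (i, i)"
proof -
  have entry: "(X * Y) $$ (i, j) = (\<Sum>k<N. X $$ (i, k) * Y $$ (k, j))" if "i < N" "j < N" for i j
    using that assms by (simp add: scalar_prod_def atLeast0LessThan)
  have zero: "X $$ (i, k) = 0" "Y $$ (i, k) = 0" if "k < i" "i < N" for i k
    using that assms by auto
  show "upper_triangular (X * Y)"
  proof
    fix i j assume ij: "j < i" "i < dim_row (X * Y)"
    then have "(X * Y) $$ (i, j) = (\<Sum>k<N. X $$ (i, k) * Y $$ (k, j))" using entry assms by simp
    also have "\<dots> = 0"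
    proof (intro sum.neutral ballI)
      fix k assume "k \<in> {..<N}"
      then show "X $$ (i, k) * Y $$ (k, j) = 0"
        using zero(1)[of k i] zero(2)[of j k] ij assms by (cases "k < i") auto
    qed
    finally show "(X * Y) $$ (i, j) = 0" .
  qed
  show "(X * Y) $$ (i, i) = X $$ (i, i) * Y $$ (i, i)" if i: "i < N"
  proof -
    have "(X * Y) $$ (i, i) = (\<Sum>k<N. if k = i then X $$ (i, i) * Y $$ (i, i) else 0)"
      unfolding entry[OF i i]
    proof (intro sum.cong refl)
      fix k assume "k \<in> {..<N}"
      then show "X $$ (i, k) * Y $$ (k, i) = (if k = i then X $$ (i, i) * Y $$ (i, i) else 0)"
        using zero(1)[of k i] zero(2)[of i k] i by (cases k i rule: linorder_cases) auto
    qed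
    then show ?thesis using i by simp
  qed
qed

text \<open>With \<open>P\<close> and \<open>Q\<close> fixed, \<open>f\<close> lists the eigenvalues
  of \<open>X\<close> along the diagonal. Closure under sums, products and scalars then gives the
  spectral mapping for polynomials without matrix powers.\<close>

definition triangularizes :: "nat \<Rightarrow> real mat \<Rightarrow> real mat \<Rightarrow> (nat \<Rightarrow> real) \<Rightarrow> real mat \<Rightarrow> bool" where
  "triangularizes N P Q f X \<longleftrightarrow> (\<exists>Y\<in>carrier_mat N N. upper_triangular Y \<and> X = P * Y * Q \<and> (\<forall>i<N. Y $$ (i, i) = f i))"

context
  fixes N :: nat and P Q :: "real mat"
  assumes P: "P \<in> carrier_mat N N" and Q: "Q \<in> carrier_mat N N" and QP: "Q * P = 1\<^sub>m N"
begin

lemma triangularizes_mult: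
  assumes "triangularizes N P Q f X" "triangularizes N P Q g Z"
  shows "triangularizes N P Q (\<lambda>i. f i * g i) (X * Z)"
proof -
  obtain Y W where Y: "Y \<in> carrier_mat N N" "upper_triangular Y" "X = P * Y * Q" "\<forall>i<N. Y $$ (i, i) = f i"
    and W: "W \<in> carrier_mat N N" "upper_triangular W" "Z = P * W * Q" "\<forall>i<N. W $$ (i, i) = g i"
    using assms by (auto simp: triangularizes_def)
  have "X * Z = P * Y * (Q * (P * (W * Q)))"
    unfolding Y(3) W(3) using P Q Y(1) W(1) by (simp add: assoc_mult_mat[of _ N N _ N _ N])
  also have "Q * (P * (W * Q)) = (Q * P) * (W * Q)"
    using P Q W(1) by (simp add: assoc_mult_mat[of _ N N _ N _ N])
  also have "\<dots> = W * Q" unfolding QP using W(1) Q by (simp add: left_mult_one_mat[of _ N N])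
  also have "P * Y * (W * Q) = P * (Y * W) * Q"
    using P Q Y(1) W(1) by (simp add: assoc_mult_mat[of _ N N _ N _ N])
  finally show ?thesis
    using upper_triangular_mult[OF Y(1) W(1) Y(2) W(2)] Y W
    by (auto simp: triangularizes_def intro!: bexI[of _ "Y * W"])
qed

lemma triangularizes_smult:
  assumes "triangularizes N P Q f X"
  shows "triangularizes N P Q (\<lambda>i. c * f i) (c \<cdot>\<^sub>m X)"
proof -
  obtain Y where Y: "Y \<in> carrier_mat N N" "upper_triangular Y" "X = P * Y * Q" "\<forall>i<N. Y $$ (i, i) = f i"
    using assms by (auto simp: triangularizes_def)
  have "c \<cdot>\<^sub>m X = P * (c \<cdot>\<^sub>m Y) * Q"
    unfolding Y(3) using P Q Y(1) by (simp add: mult_smult_distrib[of _ N N _ N] mult_smult_assoc_mat[of _ N N _ N])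
  moreover have "upper_triangular (c \<cdot>\<^sub>m Y)" using Y(1,2) unfolding upper_triangular_def by auto
  ultimately show ?thesis
    using Y by (auto simp: triangularizes_def intro!: bexI[of _ "c \<cdot>\<^sub>m Y"])
qed

lemma triangularizes_add:
  assumes "triangularizes N P Q f X" "triangularizes N P Q g Z"
  shows "triangularizes N P Q (\<lambda>i. f i + g i) (X + Z)"
proof -
  obtain Y W where Y: "Y \<in> carrier_mat N N" "upper_triangular Y" "X = P * Y * Q" "\<forall>i<N. Y $$ (i, i) = f i"
    and W: "W \<in> carrier_mat N N" "upper_triangular W" "Z = P * W * Q" "\<forall>i<N. W $$ (i, i) = g i"
    using assms by (auto simp: triangularizes_def)
  have "X + Z = P * (Y + W) * Q"
    unfolding Y(3) W(3) using P Q Y(1) W(1)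
    by (simp add: add_mult_distrib_mat[of _ N N _ _ N] mult_add_distrib_mat[of _ N N _ N])
  moreover have "upper_triangular (Y + W)" using Y(1,2) W(1,2) unfolding upper_triangular_def by auto
  ultimately show ?thesis
    using Y W by (auto simp: triangularizes_def intro!: bexI[of _ "Y + W"])
qed

lemma trace_triangularizes:
  assumes "triangularizes N P Q f X"
  shows "trace_mat X = (\<Sum>i<N. f i)"
proof -
  obtain Y where Y: "Y \<in> carrier_mat N N" "X = P * Y * Q" "\<forall>i<N. Y $$ (i, i) = f i"
    using assms by (auto simp: triangularizes_def)
  have "trace_mat X = trace_mat (Q * (P * Y))"
    unfolding Y(2) using P Q Y(1) by (intro trace_mat_mult_commute[of _ N]) auto
  also have "Q * (P * Y) = (Q * P) * Y" using P Q Y(1) by (simp add: assoc_mult_mat[of _ N N _ N _ N])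
  also have "\<dots> = Y" unfolding QP using Y(1) by (rule left_mult_one_mat)
  finally show ?thesis using Y by (simp add: trace_mat_def)
qed

end

section \<open>Non-backtracking walks\<close>

definition nbwalks :: "nat set set \<Rightarrow> nat \<Rightarrow> nat \<Rightarrow> nat \<Rightarrow> nat list set" where
  "nbwalks E k u v = {ws. nbwalk E ws \<and> length ws = Suc k \<and> ws ! 0 = u \<and> ws ! k = v}"

lemma nbwalk_Cons:
  "nbwalk E (u # ws) \<longleftrightarrow> nbwalk E ws \<and> (ws \<noteq> [] \<longrightarrow> {u, ws ! 0} \<in> E) \<and> (2 \<le> length ws \<longrightarrow> u \<noteq> ws ! 1)"
proof -
  have 1: "(\<forall>i. Suc i < Suc (length ws) \<longrightarrow> {(u # ws) ! i, (u # ws) ! Suc i} \<in> E) \<longleftrightarrow>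
      (ws \<noteq> [] \<longrightarrow> {u, ws ! 0} \<in> E) \<and> (\<forall>i. Suc i < length ws \<longrightarrow> {ws ! i, ws ! Suc i} \<in> E)"
    by (auto simp: nth_Cons split: nat.splits)
  have 2: "(\<forall>i. Suc (Suc i) < Suc (length ws) \<longrightarrow> (u # ws) ! i \<noteq> (u # ws) ! Suc (Suc i)) \<longleftrightarrow>
      (2 \<le> length ws \<longrightarrow> u \<noteq> ws ! 1) \<and> (\<forall>i. Suc (Suc i) < length ws \<longrightarrow> ws ! i \<noteq> ws ! Suc (Suc i))"
    by (auto simp: nth_Cons split: nat.splits)
  show ?thesis unfolding nbwalk_def using 1 2 by auto
qed

lemma nbwalks_0: "nbwalks E 0 u v = (if u = v then {[u]} else {})"
  by (auto simp: nbwalks_def length_Suc_conv nbwalk_def)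

lemma finite_nbwalks:
  assumes E: "E \<in> biregular_graphs m n dL dR"
  shows "finite (nbwalks E k u v)"
proof (rule finite_subset)
  show "nbwalks E k u v \<subseteq> {ws. set ws \<subseteq> insert u {..<m + n} \<and> length ws = Suc k}"
  proof
    fix ws assume ws: "ws \<in> nbwalks E k u v"
    have "ws ! i \<in> insert u {..<m + n}" if "i < length ws" for i
    proof (cases i)
      case 0
      then show ?thesis using ws by (auto simp: nbwalks_def)
    next
      case (Suc j)
      then have "{ws ! j, ws ! Suc j} \<in> E" using ws that by (auto simp: nbwalks_def nbwalk_def)
      then show ?thesis using biregular_graphs_edge[OF E] Suc by fastforce
    qed
    then show "ws \<in> {ws. set ws \<subseteq> insert u {..<m + n} \<and> length ws = Suc k}"
      using ws by (auto simp: nbwalks_def set_conv_nth)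
  qed
qed (rule finite_lists_length_eq, simp)

text \<open>
  Prepending a step to a non-backtracking walk gives a non-backtracking walk, unless the step
  undoes the first step of the walk.
\<close>

lemma sum_card_nbwalks:
  assumes E: "E \<in> biregular_graphs m n dL dR"
  shows "(\<Sum>w\<in>neighbours E u. card (nbwalks E k w v)) = card (nbwalks E (Suc k) u v) +
    (if k = 0 then 0 else (card (neighbours E u) - (if k = 1 then 0 else 1)) * card (nbwalks E (k - 1) u v))"
proof -
  define X where "X = (\<Union>w\<in>neighbours E u. nbwalks E k w v)"
  have finX: "finite X" unfolding X_def using finite_nbwalks[OF E] finite_neighbours[OF E] by blast
  have X_iff: "ws \<in> X \<longleftrightarrow> nbwalk E ws \<and> length ws = Suc k \<and> {u, ws ! 0} \<in> E \<and> ws ! k = v" for ws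
    by (auto simp: X_def nbwalks_def neighbours_def insert_commute)
  have sumX: "(\<Sum>w\<in>neighbours E u. card (nbwalks E k w v)) = card X"
    unfolding X_def using finite_nbwalks[OF E] finite_neighbours[OF E]
    by (intro card_UN_disjoint[symmetric]) (auto simp: nbwalks_def)
  define X1 where "X1 = {ws \<in> X. k = 0 \<or> ws ! 1 \<noteq> u}"
  define X2 where "X2 = {ws \<in> X. k \<noteq> 0 \<and> ws ! 1 = u}"
  have "X = X1 \<union> X2" "X1 \<inter> X2 = {}" by (auto simp: X1_def X2_def)
  then have cardX: "card X = card X1 + card X2" using finX by (metis card_Un_disjoint finite_Un)
  have "nbwalks E (Suc k) u v = (#) u ` X1"
  proof (intro equalityI subsetI)
    fix ws assume ws: "ws \<in> nbwalks E (Suc k) u v"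
    then obtain ws' where ws': "ws = u # ws'" by (auto simp: nbwalks_def length_Suc_conv)
    then have "ws' \<in> X1" using ws
      by (cases k) (auto simp: nbwalks_def nbwalk_Cons X1_def X_iff)
    then show "ws \<in> (#) u ` X1" using ws' by blast
  next
    fix ws assume "ws \<in> (#) u ` X1"
    then obtain ws' where ws': "ws = u # ws'" "ws' \<in> X1" by blast
    then show "ws \<in> nbwalks E (Suc k) u v"
      by (cases k) (auto simp: nbwalks_def nbwalk_Cons X1_def X_iff)
  qed
  then have c1: "card X1 = card (nbwalks E (Suc k) u v)" by (simp add: card_image)
  have c2: "card X2 = (if k = 0 then 0 else (card (neighbours E u) - (if k = 1 then 0 else 1)) * card (nbwalks E (k - 1) u v))"
  proof (cases k)
    case 0
    then show ?thesis by (simp add: X2_def)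
  next
    case (Suc l)
    \<comment> \<open>A walk of \<open>X2\<close> is back at \<open>u\<close> after its first step.
      It is a walk of length \<open>l\<close> from \<open>u\<close>, preceded by a neighbour of
      \<open>u\<close> that differs from the second vertex of that walk, if there is one. This is
      why \<open>k = 1\<close> has one choice more.\<close>
    define B where "B ws = neighbours E u - (if l = 0 then {} else {ws ! 1})" for ws :: "nat list"
    have "X2 = (\<lambda>(ws, w). w # ws) ` (SIGMA ws:nbwalks E l u v. B ws)"
    proof (intro equalityI subsetI)
      fix ws assume ws: "ws \<in> X2"
      then obtain w ws' where w: "ws = w # ws'" by (auto simp: X2_def X_iff length_Suc_conv)
      then have "ws' \<in> nbwalks E l u v" "w \<in> B ws'" using ws Suc
        by (auto simp: X2_def X_iff nbwalks_def nbwalk_Cons B_def neighbours_def insert_commute)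
      then show "ws \<in> (\<lambda>(ws, w). w # ws) ` (SIGMA ws:nbwalks E l u v. B ws)" using w by force
    next
      fix ws assume "ws \<in> (\<lambda>(ws, w). w # ws) ` (SIGMA ws:nbwalks E l u v. B ws)"
      then obtain w ws' where "ws = w # ws'" "ws' \<in> nbwalks E l u v" "w \<in> B ws'" by auto
      then show "ws \<in> X2" using Suc
        by (cases l) (auto simp: X2_def X_iff nbwalks_def nbwalk_Cons B_def neighbours_def insert_commute)
    qed
    moreover have "inj_on (\<lambda>(ws, w). w # ws) (SIGMA ws:nbwalks E l u v. B ws)" by (auto simp: inj_on_def)
    ultimately have "card X2 = card (SIGMA ws:nbwalks E l u v. B ws)" by (simp add: card_image)
    also have "\<dots> = (\<Sum>ws\<in>nbwalks E l u v. card (B ws))"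
      using finite_nbwalks[OF E] finite_neighbours[OF E] by (intro card_SigmaI) (auto simp: B_def)
    also have "\<dots> = (\<Sum>ws\<in>nbwalks E l u v. card (neighbours E u) - (if l = 0 then 0 else 1))"
    proof (intro sum.cong refl)
      fix ws assume ws: "ws \<in> nbwalks E l u v"
      show "card (B ws) = card (neighbours E u) - (if l = 0 then 0 else 1)"
      proof (cases l)
        case (Suc j)
        then have "{ws ! 0, ws ! 1} \<in> E" "ws ! 0 = u" using ws by (auto simp: nbwalks_def nbwalk_def)
        then have "ws ! 1 \<in> neighbours E u" by (simp add: neighbours_def insert_commute)
        then show ?thesis using Suc finite_neighbours[OF E] by (simp add: B_def)
      qed (simp add: B_def)
    qed
    finally show ?thesis using Suc by simp
  qed
  show ?thesis unfolding sumX cardX c1 c2 ..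
qed

lemma card_nbwalks_le:
  assumes E: "E \<in> biregular_graphs m n dL dR" and "dL \<le> dR"
  shows "card (nbwalks E k u v) \<le> dR ^ k"
proof (induction k arbitrary: u)
  case 0
  then show ?case by (simp add: nbwalks_0)
next
  case (Suc k)
  have "card (nbwalks E (Suc k) u v) \<le> (\<Sum>w\<in>neighbours E u. card (nbwalks E k w v))"
    unfolding sum_card_nbwalks[OF E] by simp
  also have "\<dots> \<le> (\<Sum>w\<in>neighbours E u. dR ^ k)" using Suc by (intro sum_mono)
  also have "\<dots> \<le> dR * dR ^ k"
    using card_neighbours_le[OF assms, of u] by (simp add: mult_right_mono)
  finally show ?case by simp
qed

lemma nbwalks_closed: "closed_nbwalk E k v \<longleftrightarrow> nbwalks E k v v \<noteq> {}"
  by (auto simp: closed_nbwalk_def nbwalks_def)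

section \<open>Walk counts, closed walks and the trace formula\<close>

definition nbcount :: "nat set set \<Rightarrow> nat \<Rightarrow> nat \<Rightarrow> nat \<Rightarrow> real" where
  "nbcount E k u v = real (card (nbwalks E k u v))"

lemma nbcount_1:
  assumes E: "E \<in> biregular_graphs m n dL dR"
  shows "nbcount E 1 u v = (if {u, v} \<in> E then 1 else 0)"
proof -
  have "(\<Sum>w\<in>neighbours E u. card (nbwalks E 0 w v)) = (\<Sum>w\<in>neighbours E u. if w = v then 1 else 0)"
    by (intro sum.cong) (auto simp: nbwalks_0)
  then have "card (nbwalks E 1 u v) = (if v \<in> neighbours E u then 1 else 0)"
    using sum_card_nbwalks[OF E, of 0 v u] finite_neighbours[OF E] by simp
  then show ?thesis by (simp add: nbcount_def neighbours_def insert_commute)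
qed

lemma sum_nbcount:
  assumes E: "E \<in> biregular_graphs m n dL dR" and deg: "card (neighbours E u) = Suc d"
  shows "(\<Sum>w\<in>neighbours E u. nbcount E k w v) = nbcount E (Suc k) u v +
    (if k = 0 then 0 else (if k = 1 then real d + 1 else real d) * nbcount E (k - 1) u v)"
  using arg_cong[OF sum_card_nbwalks[OF E, of k v u], of real] deg
  by (auto simp: nbcount_def)

text \<open>Two steps visit both sides, so the degrees enter only through \<open>p + q\<close> and
  \<open>p * q\<close>, and the recursion is the same for left and right vertices. The extra 1 for
  \<open>k = 0\<close> is the additional choice in undoing the only step of a walk of length
  1.\<close>

lemma sum2_nbcount:
  assumes E: "E \<in> biregular_graphs m n (Suc p) (Suc q)" and u: "u < m + n"
  shows "(\<Sum>w\<in>neighbours E u. \<Sum>x\<in>neighbours E w. nbcount E (2 * k + 1) x v) =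
    nbcount E (2 * k + 3) u v + (real p + real q + (if k = 0 then 1 else 0)) * nbcount E (2 * k + 1) u v +
    (if k = 0 then 0 else real p * real q * nbcount E (2 * k - 1) u v)"
proof -
  define a where "a = (if u < m then p else q)"
  define b where "b = (if u < m then q else p)"
  have pq: "real p + real q = real a + real b" "real p * real q = real a * real b"
    by (auto simp: a_def b_def)
  have da: "card (neighbours E u) = Suc a"
    using card_neighbours[OF E] u by (auto simp: a_def)
  have db: "card (neighbours E w) = Suc b" if "w \<in> neighbours E u" for w
    using card_neighbours[OF E, of w] biregular_graphs_edge[OF E, of w u] that
    by (auto simp: b_def neighbours_def)
  have "(\<Sum>w\<in>neighbours E u. \<Sum>x\<in>neighbours E w. nbcount E (2 * k + 1) x v) =
    (\<Sum>w\<in>neighbours E u. nbcount E (2 * k + 2) w v + (if k = 0 then real b + 1 else real b) * nbcount E (2 * k) w v)"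
    by (intro sum.cong refl) (simp add: sum_nbcount[OF E db])
  also have "\<dots> = (\<Sum>w\<in>neighbours E u. nbcount E (2 * k + 2) w v) +
      (if k = 0 then real b + 1 else real b) * (\<Sum>w\<in>neighbours E u. nbcount E (2 * k) w v)"
    by (simp add: sum.distrib sum_distrib_left)
  also have "\<dots> = nbcount E (2 * k + 3) u v + (real p + real q + (if k = 0 then 1 else 0)) * nbcount E (2 * k + 1) u v +
    (if k = 0 then 0 else real p * real q * nbcount E (2 * k - 1) u v)"
    unfolding pq sum_nbcount[OF E da] by (simp add: algebra_simps numeral_3_eq_3)
  finally show ?thesis .
qed

text \<open>The diagonal entry at \<open>v\<close> of the adjacency matrix times the matrix of walk
  counts of length \<open>2 * k + 1\<close>: closed walks of length \<open>2 * k + 2\<close> that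
  may backtrack right after the first step.\<close>

definition closed_count :: "nat set set \<Rightarrow> nat \<Rightarrow> nat \<Rightarrow> real" where
  "closed_count E k v = (\<Sum>w\<in>neighbours E v. nbcount E (2 * k + 1) w v)"

lemma closed_count_0:
  assumes E: "E \<in> biregular_graphs m n dL dR"
  shows "closed_count E 0 v = real (card (neighbours E v))"
proof -
  have "closed_count E 0 v = (\<Sum>w\<in>neighbours E v. 1)"
    unfolding closed_count_def by (intro sum.cong) (auto simp: nbcount_1[OF E, simplified] neighbours_def)
  then show ?thesis by simp
qed

lemma closed_count_nonneg: "closed_count E k v \<ge> 0"
  by (auto simp: closed_count_def nbcount_def intro: sum_nonneg)

lemma closed_count_le:
  assumes E: "E \<in> biregular_graphs m n dL dR" and "dL \<le> dR"
  shows "closed_count E k v \<le> real dR ^ (2 * k + 2)"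
proof -
  have "closed_count E k v \<le> (\<Sum>w\<in>neighbours E v. real dR ^ (2 * k + 1))"
    unfolding closed_count_def nbcount_def
    using card_nbwalks_le[OF assms] by (intro sum_mono) (simp only: of_nat_le_iff flip: of_nat_power)
  also have "\<dots> \<le> real dR * real dR ^ (2 * k + 1)"
    using card_neighbours_le[OF assms, of v] by (simp add: mult_right_mono)
  finally show ?thesis by simp
qed

text \<open>Prepending the step from \<open>v\<close> gives non-backtracking closed walks of length
  \<open>2 * k + 2\<close>, or, if it is undone at once, of length \<open>2 * k\<close>. At a good
  vertex neither kind exists; for \<open>k = 0\<close> the second kind would be the trivial
  walk.\<close>

lemma closed_count_good:
  assumes E: "E \<in> biregular_graphs m n dL dR" and k: "1 \<le> k" "2 * k + 2 \<le> K"
    and good: "\<And>j. 1 \<le> j \<Longrightarrow> j \<le> K \<Longrightarrow> \<not> closed_nbwalk E j v"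
  shows "closed_count E k v = 0"
proof -
  have "nbwalks E (2 * k + 2) v v = {}" "nbwalks E (2 * k) v v = {}"
    using good[of "2 * k + 2"] good[of "2 * k"] k unfolding nbwalks_closed by auto
  then have "(\<Sum>w\<in>neighbours E v. card (nbwalks E (2 * k + 1) w v)) = 0"
    unfolding sum_card_nbwalks[OF E] using k by simp
  then show ?thesis unfolding closed_count_def nbcount_def by (simp flip: of_nat_sum)
qed

text \<open>
  At the adjacency matrix, \<open>b * nbpoly p q k (b\<^sup>2)\<close> counts the non-backtracking walks of length \<open>2 * k + 1\<close>.
  Odd lengths are used because they need the same polynomial on both sides of the graph.
\<close>

fun nbpoly :: "real \<Rightarrow> real \<Rightarrow> nat \<Rightarrow> real \<Rightarrow> real" where
  "nbpoly p q 0 x = 1"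
| "nbpoly p q (Suc 0) x = x - (p + q) - 1"
| "nbpoly p q (Suc (Suc k)) x = (x - (p + q)) * nbpoly p q (Suc k) x - p * q * nbpoly p q k x"

text \<open>This is \<open>A * nbpoly p q k (A^2)\<close>, with the recursion carried out on
  matrices so that its entries can be compared with the walk counts.\<close>

fun nbmat :: "real \<Rightarrow> real \<Rightarrow> real mat \<Rightarrow> nat \<Rightarrow> real mat" where
  "nbmat p q A 0 = A"
| "nbmat p q A (Suc 0) = A * (A * A) + (- (p + q + 1)) \<cdot>\<^sub>m A"
| "nbmat p q A (Suc (Suc k)) = A * (A * nbmat p q A (Suc k)) + (- (p + q)) \<cdot>\<^sub>m nbmat p q A (Suc k) +
     (- (p * q)) \<cdot>\<^sub>m nbmat p q A k"

lemma nbmat_carrier: "A \<in> carrier_mat N N \<Longrightarrow> nbmat p q A k \<in> carrier_mat N N"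
  by (induction p q A k rule: nbmat.induct) auto

lemma adjacency_matrix_carrier: "adjacency_matrix N E \<in> carrier_mat N N"
  by (simp add: adjacency_matrix_def)

lemma transpose_adjacency_matrix': "transpose_mat (adjacency_matrix N E) = adjacency_matrix N E"
  by (intro eq_matI) (auto simp: adjacency_matrix_def insert_commute)

lemma adjacency_matrix_mult:
  assumes E: "E \<in> biregular_graphs m n dL dR" and X: "X \<in> carrier_mat (m + n) (m + n)"
    and uv: "u < m + n" "v < m + n"
  shows "(adjacency_matrix (m + n) E * X) $$ (u, v) = (\<Sum>w\<in>neighbours E u. X $$ (w, v))"
proof -
  have "(adjacency_matrix (m + n) E * X) $$ (u, v) = (\<Sum>w<m + n. (if {u, w} \<in> E then 1 else 0) * X $$ (w, v))"
    using X uv by (simp add: adjacency_matrix_def scalar_prod_def atLeast0LessThan)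
  also have "\<dots> = (\<Sum>w\<in>neighbours E u. X $$ (w, v))"
  proof (rule sum.mono_neutral_cong_right)
    show "neighbours E u \<subseteq> {..<m + n}"
      using biregular_graphs_edge[OF E] by (auto simp: neighbours_def dest: biregular_graphs_edge[OF E])
  qed (auto simp: neighbours_def insert_commute)
  finally show ?thesis .
qed

lemma neighbours_less: "E \<in> biregular_graphs m n dL dR \<Longrightarrow> w \<in> neighbours E u \<Longrightarrow> w < m + n"
  by (auto simp: neighbours_def dest: biregular_graphs_edge)

lemma nbmat_entry:
  assumes E: "E \<in> biregular_graphs m n (Suc p) (Suc q)" and uv: "u < m + n" "v < m + n"
  shows "nbmat (real p) (real q) (adjacency_matrix (m + n) E) k $$ (u, v) = nbcount E (2 * k + 1) u v"
  using uv
proof (induction k arbitrary: u rule: induct_nat_012)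
  case 0
  then show ?case using nbcount_1[OF E] by (simp add: adjacency_matrix_def)
next
  let ?A = "adjacency_matrix (m + n) E"
  note A = adjacency_matrix_carrier[of "m + n" E]
  have AA: "(?A * (?A * X)) $$ (u, v) = (\<Sum>w\<in>neighbours E u. \<Sum>x\<in>neighbours E w. X $$ (x, v))"
    if "X \<in> carrier_mat (m + n) (m + n)" "u < m + n" "v < m + n" for X u
  proof -
    have "?A * X \<in> carrier_mat (m + n) (m + n)" using A that by simp
    then have "(?A * (?A * X)) $$ (u, v) = (\<Sum>w\<in>neighbours E u. (?A * X) $$ (w, v))"
      by (rule adjacency_matrix_mult[OF E _ that(2,3)])
    also have "\<dots> = (\<Sum>w\<in>neighbours E u. \<Sum>x\<in>neighbours E w. X $$ (x, v))"
      using that neighbours_less[OF E] by (intro sum.cong refl adjacency_matrix_mult[OF E]) auto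
    finally show ?thesis .
  qed
  {
    case 1
    have entry: "?A $$ (x, v) = nbcount E 1 x v" if "x < m + n" for x
      using that 1 nbcount_1[OF E] by (simp add: adjacency_matrix_def)
    have "nbmat (real p) (real q) ?A 1 $$ (u, v) =
        (\<Sum>w\<in>neighbours E u. \<Sum>x\<in>neighbours E w. ?A $$ (x, v)) - (real p + real q + 1) * ?A $$ (u, v)"
      using A 1 AA[OF A 1] by (simp add: algebra_simps index_add_mat index_smult_mat del: index_mult_mat)
    also have "(\<Sum>w\<in>neighbours E u. \<Sum>x\<in>neighbours E w. ?A $$ (x, v)) =
        (\<Sum>w\<in>neighbours E u. \<Sum>x\<in>neighbours E w. nbcount E (2 * 0 + 1) x v)"
      using neighbours_less[OF E] by (intro sum.cong refl) (simp add: entry)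
    finally show ?case using sum2_nbcount[OF E 1(1), of 0 v] entry[OF 1(1)] by (simp add: numeral_3_eq_3 del: nbmat.simps)
  next
    case (ge2 k)
    let ?B = "nbmat (real p) (real q) ?A"
    have B: "?B j \<in> carrier_mat (m + n) (m + n)" for j by (rule nbmat_carrier[OF A])
    have "?B (Suc (Suc k)) $$ (u, v) =
        (\<Sum>w\<in>neighbours E u. \<Sum>x\<in>neighbours E w. ?B (Suc k) $$ (x, v))
        - (real p + real q) * ?B (Suc k) $$ (u, v) - real p * real q * ?B k $$ (u, v)"
      using A B[of k] B[of "Suc k"] ge2(3,4) AA[OF B[of "Suc k"] ge2(3,4)]
      by (simp add: algebra_simps index_add_mat index_smult_mat carrier_matD[OF B] del: index_mult_mat)
    also have "(\<Sum>w\<in>neighbours E u. \<Sum>x\<in>neighbours E w. ?B (Suc k) $$ (x, v)) =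
        (\<Sum>w\<in>neighbours E u. \<Sum>x\<in>neighbours E w. nbcount E (2 * Suc k + 1) x v)"
      using neighbours_less[OF E] ge2 by (intro sum.cong refl) auto
    also have "?B (Suc k) $$ (u, v) = nbcount E (2 * Suc k + 1) u v" by (rule ge2(2)[OF ge2(3,4)])
    also have "?B k $$ (u, v) = nbcount E (2 * k + 1) u v" by (rule ge2(1)[OF ge2(3,4)])
    finally show ?case
      using sum2_nbcount[OF E ge2(3), of "Suc k" v] by (simp add: algebra_simps eval_nat_numeral del: nbmat.simps)
  }
qed

text \<open>Both sides are the trace of \<open>A\<close> times \<open>nbmat p q A k\<close> for the
  adjacency matrix \<open>A\<close>: the left one through a common triangular form, the right one
  through the diagonal entries.\<close>

lemma sum_eigenvalues_nbpoly:
  assumes E: "E \<in> biregular_graphs m n (Suc p) (Suc q)"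
    and bs: "mset bs = eigenvalue_mset (adjacency_matrix (m + n) E)"
  shows "(\<Sum>b\<leftarrow>bs. b\<^sup>2 * nbpoly (real p) (real q) k (b\<^sup>2)) = (\<Sum>v<m + n. closed_count E k v)"
proof -
  let ?N = "m + n" and ?A = "adjacency_matrix (m + n) E"
  let ?V = "nbpoly (real p) (real q)" and ?M = "nbmat (real p) (real q) ?A"
  note A = adjacency_matrix_carrier[of ?N E]
  obtain B P Q where sim: "similar_mat_wit ?A B P Q" and up: "upper_triangular B"
    and diag: "mset (diag_mat B) = eigenvalue_mset ?A"
    using symmetric_triangularization[OF A transpose_adjacency_matrix'] .
  note D = similar_mat_witD2[OF A sim]
  define f where "f i = B $$ (i, i)" for i
  note mult = triangularizes_mult[OF D(6,7,2)] and add = triangularizes_add[OF D(6,7,2)]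
    and smult = triangularizes_smult[OF D(6,7,2)]
  have TA: "triangularizes ?N P Q f ?A"
    unfolding triangularizes_def using D(3,5) up by (auto simp: f_def)
  have TM: "triangularizes ?N P Q (\<lambda>i. f i * ?V k ((f i)\<^sup>2)) (?M k)" for k
  proof (induction k rule: induct_nat_012)
    case 0
    then show ?case using TA by simp
  next
    case 1
    have "triangularizes ?N P Q (\<lambda>i. f i * (f i * f i) + (- (real p + real q + 1)) * f i) (?M 1)"
      using add[OF mult[OF TA mult[OF TA TA]] smult[OF TA]] by simp
    then show ?case by (simp add: algebra_simps power2_eq_square)
  next
    case (ge2 k)
    have "triangularizes ?N P Q (\<lambda>i. f i * (f i * (f i * ?V (Suc k) ((f i)\<^sup>2))) +
        (- (real p + real q)) * (f i * ?V (Suc k) ((f i)\<^sup>2)) + (- (real p * real q)) * (f i * ?V k ((f i)\<^sup>2))) (?M (Suc (Suc k)))"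
      unfolding nbmat.simps
      by (rule add[OF add[OF mult[OF TA mult[OF TA ge2(2)]] smult[OF ge2(2)]] smult[OF ge2(1)]])
    moreover have "(\<lambda>i. f i * (f i * (f i * ?V (Suc k) ((f i)\<^sup>2))) +
        (- (real p + real q)) * (f i * ?V (Suc k) ((f i)\<^sup>2)) + (- (real p * real q)) * (f i * ?V k ((f i)\<^sup>2))) =
        (\<lambda>i. f i * ?V (Suc (Suc k)) ((f i)\<^sup>2))"
      by (rule ext) (simp add: algebra_simps power2_eq_square)
    ultimately show ?case by (simp only:)
  qed
  have "(\<Sum>b\<leftarrow>bs. b\<^sup>2 * ?V k (b\<^sup>2)) = sum_mset (image_mset (\<lambda>b. b\<^sup>2 * ?V k (b\<^sup>2)) (mset bs))"
    by (simp flip: sum_mset_sum_list)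
  also have "\<dots> = (\<Sum>b\<leftarrow>diag_mat B. b\<^sup>2 * ?V k (b\<^sup>2))"
    unfolding bs diag[symmetric] by (simp flip: sum_mset_sum_list)
  also have "\<dots> = (\<Sum>i<?N. f i * (f i * ?V k ((f i)\<^sup>2)))"
    using D(5) by (simp add: diag_mat_def sum_list_sum_nth f_def power2_eq_square mult.assoc atLeast0LessThan)
  also have "\<dots> = trace_mat (?A * ?M k)"
    by (rule trace_triangularizes[OF D(6,7,2) mult[OF TA TM], symmetric])
  also have "\<dots> = (\<Sum>v<?N. (?A * ?M k) $$ (v, v))" using A by (simp add: trace_mat_def)
  also have "\<dots> = (\<Sum>v<?N. closed_count E k v)"
  proof (intro sum.cong refl)
    fix v assume "v \<in> {..<?N}"
    then have v: "v < ?N" by simp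
    have "(?A * ?M k) $$ (v, v) = (\<Sum>w\<in>neighbours E v. ?M k $$ (w, v))"
      by (rule adjacency_matrix_mult[OF E nbmat_carrier[OF A] v v])
    also have "\<dots> = closed_count E k v"
      unfolding closed_count_def using v neighbours_less[OF E]
      by (intro sum.cong refl nbmat_entry[OF E]) auto
    finally show "(?A * ?M k) $$ (v, v) = closed_count E k v" .
  qed
  finally show ?thesis .
qed

text \<open>Divided by \<open>r ^ k\<close>, \<open>nbpoly\<close> obeys the recursion of
  \<open>chebU\<close> from index 1 on. The additional -1 in \<open>nbpoly p q 1\<close> accounts
  for the correction by \<open>chebU k t / r\<close>.\<close>

lemma nbpoly_chebU:
  assumes r: "r > 0" "r\<^sup>2 = p * q" and x: "x = p + q + r * t"
  shows "nbpoly p q (Suc k) x / r ^ Suc k = chebU (Suc k) t - chebU k t / r"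
proof (induction k rule: induct_nat_012)
  case 0
  then show ?case using r x by (simp add: field_simps)
next
  case 1
  have "nbpoly p q (Suc (Suc 0)) x = r * t * (r * t - 1) - r\<^sup>2"
    using x r(2) by simp
  then have "nbpoly p q (Suc (Suc 0)) x / r\<^sup>2 = (r * t * (r * t - 1) - r\<^sup>2) / r\<^sup>2"
    by (simp only:)
  also have "\<dots> = t * t - 1 - t / r" using r(1) by (simp add: field_simps power2_eq_square)
  finally show ?case by (simp add: numeral_2_eq_2 del: nbpoly.simps)
next
  case (ge2 k)
  have "nbpoly p q (Suc (Suc (Suc k))) x / r ^ Suc (Suc (Suc k)) =
      t * (nbpoly p q (Suc (Suc k)) x / r ^ Suc (Suc k)) - nbpoly p q (Suc k) x / r ^ Suc k"
    using r(1) x r(2)[symmetric] by (simp add: field_simps power2_eq_square)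
  then show ?case unfolding ge2 by (simp add: algebra_simps diff_divide_distrib)
qed

text \<open>Solving \<open>nbpoly_chebU\<close> for \<open>chebU\<close> gives a geometric sum. In
  the trace the term \<open>j = 0\<close> dominates, so that the moments are nearly a constant times
  \<open>(1 / r) ^ k\<close>; this is the origin of \<open>e = 1 / r\<close>.\<close>

lemma chebU_nbpoly:
  assumes "r > 0" "r\<^sup>2 = p * q" "x = p + q + r * t"
  shows "chebU k t = (\<Sum>j\<le>k. (1 / r) ^ (k - j) * (nbpoly p q j x / r ^ j))"
proof (induction k)
  case (Suc k)
  have "(\<Sum>j\<le>Suc k. (1 / r) ^ (Suc k - j) * (nbpoly p q j x / r ^ j)) =
      1 / r * (\<Sum>j\<le>k. (1 / r) ^ (k - j) * (nbpoly p q j x / r ^ j)) + nbpoly p q (Suc k) x / r ^ Suc k"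
    by (simp add: sum_distrib_left Suc_diff_le mult.assoc)
  also have "\<dots> = chebU (Suc k) t"
    unfolding Suc[symmetric] nbpoly_chebU[OF assms] by simp
  finally show ?case by simp
qed simp

text \<open>The term \<open>j = 0\<close> of \<open>chebU_nbpoly\<close> has trace
  \<open>2 * n * (q + 1)\<close>, which gives \<open>A = 1 + 1 / q\<close>. For \<open>j\<close> at
  least 1 only bad vertices contribute, and at most \<open>(1 + q) ^ (4 * D)\<close> each, since
  moments up to \<open>2 * D - 2\<close> involve closed walks of length at most
  \<open>4 * D - 2\<close>. The weights are divided by \<open>q\<close> so that they become
  \<open>1 / (2 * n)\<close> when divided by the squares of the scaled eigenvalues. From
  \<open>16 \<le> p * q\<close> follows that \<open>e\<close> is at most 1/4.\<close>

lemma near_semicircle_spectrum: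
  fixes m n p q D :: nat and bs :: "real list"
  defines "N \<equiv> m + n" and "r \<equiv> sqrt (real p * real q)"
  assumes E: "E \<in> biregular_graphs m n (Suc p) (Suc q)"
    and bs: "mset bs = eigenvalue_mset (adjacency_matrix N E)"
    and deg: "m * Suc p = n * Suc q" "p \<le> q" "16 \<le> p * q" "n > 0" and D: "D \<ge> 1"
    and bad: "card {v. \<exists>k. 1 \<le> k \<and> k \<le> 4 * D \<and> closed_nbwalk E k v} \<le> b"
  shows "near_semicircle {..<length bs} (\<lambda>i. (bs ! i)\<^sup>2 / (2 * real n * real q))
    (\<lambda>i. ((bs ! i)\<^sup>2 - (real p + real q)) / r) (1 + 1 / real q) (1 / r)
    (real b * real D * (1 + real q) ^ (4 * D) / real n) D"
proof -
  let ?S = "{..<length bs}" and ?w = "\<lambda>i. (bs ! i)\<^sup>2 / (2 * real n * real q)"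
  let ?t = "\<lambda>i. ((bs ! i)\<^sup>2 - (real p + real q)) / r"
  define bad_set where "bad_set = {v. \<exists>k. 1 \<le> k \<and> k \<le> 4 * D \<and> closed_nbwalk E k v}"
  define C where "C k = (\<Sum>v<N. closed_count E k v)" for k
  have "p > 0" "q > 0" using deg(3) by (auto intro: Nat.gr0I)
  have "(4::real)\<^sup>2 \<le> real p * real q" using deg(3) by (simp flip: of_nat_mult)
  then have r4: "r \<ge> 4" unfolding r_def by (rule real_le_rsqrt)
  have r: "r > 0" "r\<^sup>2 = real p * real q" using r4 by simp (simp add: r_def)
  have sum_C: "(\<Sum>i\<in>?S. (bs ! i)\<^sup>2 * nbpoly (real p) (real q) k ((bs ! i)\<^sup>2)) = C k" for k
    using sum_eigenvalues_nbpoly[OF E, of bs k] bs unfolding C_def N_def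
    by (simp add: sum_list_sum_nth atLeast0LessThan)
  have C0: "C 0 = 2 * real n * (1 + real q)"
  proof -
    have "C 0 = (\<Sum>v<N. real (card (neighbours E v)))" unfolding C_def closed_count_0[OF E] ..
    also have "{..<N} = {..<m} \<union> {m..<m + n}" by (auto simp: N_def)
    also have "(\<Sum>v\<in>{..<m} \<union> {m..<m + n}. real (card (neighbours E v))) =
        (\<Sum>v<m. real (card (neighbours E v))) + (\<Sum>v=m..<m + n. real (card (neighbours E v)))"
      by (rule sum.union_disjoint) auto
    also have "\<dots> = (\<Sum>v<m. real (Suc p)) + (\<Sum>v=m..<m + n. real (Suc q))"
      using card_neighbours[OF E] by (intro arg_cong2[where f = "(+)"] sum.cong) auto
    also have "\<dots> = real (m * Suc p) + real (n * Suc q)" by (simp add: algebra_simps)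
    finally show ?thesis unfolding deg(1) by (simp add: algebra_simps)
  qed
  have Ck: "0 \<le> C k" "C k \<le> real b * (1 + real q) ^ (4 * D)" if k: "1 \<le> k" "k \<le> 2 * D - 2" for k
  proof -
    show "0 \<le> C k" unfolding C_def by (intro sum_nonneg closed_count_nonneg)
    have "C k \<le> (\<Sum>v<N. if v \<in> bad_set then (1 + real q) ^ (4 * D) else 0)"
      unfolding C_def
    proof (rule sum_mono)
      fix v
      show "closed_count E k v \<le> (if v \<in> bad_set then (1 + real q) ^ (4 * D) else 0)"
      proof (cases "v \<in> bad_set")
        case True
        have "closed_count E k v \<le> real (Suc q) ^ (2 * k + 2)"
          using closed_count_le[OF E] deg by simp
        also have "\<dots> \<le> real (Suc q) ^ (4 * D)" using k by (intro power_increasing) auto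
        finally show ?thesis using True by simp
      next
        case False
        then show ?thesis
          using closed_count_good[OF E, of k "4 * D" v] k by (auto simp: bad_set_def)
      qed
    qed
    also have "\<dots> = real (card ({..<N} \<inter> bad_set)) * (1 + real q) ^ (4 * D)"
      by (simp add: sum.If_cases Int_def)
    also have "\<dots> \<le> real b * (1 + real q) ^ (4 * D)"
    proof (intro mult_right_mono)
      have "bad_set \<subseteq> {..<N}"
      proof
        fix v assume "v \<in> bad_set"
        then obtain k ws where "1 \<le> k" "nbwalk E ws" "length ws = Suc k" "ws ! 0 = v"
          by (auto simp: bad_set_def closed_nbwalk_def)
        then have "{v, ws ! 1} \<in> E" by (auto simp: nbwalk_def)
        then show "v \<in> {..<N}" using biregular_graphs_edge[OF E] by (fastforce simp: N_def)
      qed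
      then have "{..<N} \<inter> bad_set = bad_set" by blast
      then show "real (card ({..<N} \<inter> bad_set)) \<le> real b" using bad by (simp add: bad_set_def)
    qed simp
    finally show "C k \<le> real b * (1 + real q) ^ (4 * D)" .
  qed
  show ?thesis
  proof
    fix k assume k: "k \<le> 2 * D - 2"
    have "(\<Sum>i\<in>?S. ?w i * chebU k (?t i)) = (\<Sum>i\<in>?S. \<Sum>j\<le>k. (1 / r) ^ (k - j) / r ^ j / (2 * real n * real q) *
        ((bs ! i)\<^sup>2 * nbpoly (real p) (real q) j ((bs ! i)\<^sup>2)))"
    proof (intro sum.cong refl)
      fix i
      have "chebU k (?t i) = (\<Sum>j\<le>k. (1 / r) ^ (k - j) * (nbpoly (real p) (real q) j ((bs ! i)\<^sup>2) / r ^ j))"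
        using r by (intro chebU_nbpoly) auto
      then show "?w i * chebU k (?t i) = (\<Sum>j\<le>k. (1 / r) ^ (k - j) / r ^ j / (2 * real n * real q) *
          ((bs ! i)\<^sup>2 * nbpoly (real p) (real q) j ((bs ! i)\<^sup>2)))"
        by (simp add: sum_distrib_left mult_ac)
    qed
    also have "\<dots> = (\<Sum>j\<le>k. (1 / r) ^ (k - j) / r ^ j / (2 * real n * real q) * C j)"
      by (subst sum.swap) (simp only: sum_distrib_left[symmetric] sum_C)
    also have "\<dots> = (1 / r) ^ k / (2 * real n * real q) * C 0 +
        (\<Sum>j=1..k. (1 / r) ^ (k - j) / r ^ j / (2 * real n * real q) * C j)"
      by (simp add: atMost_atLeast0 sum.atLeast_Suc_atMost)
    also have "(1 / r) ^ k / (2 * real n * real q) * C 0 = C 0 / (2 * real n * real q) * (1 / r) ^ k" by simp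
    also have "C 0 / (2 * real n * real q) = 1 + 1 / real q"
      using \<open>q > 0\<close> deg(4) unfolding C0 by (simp add: field_simps)
    finally have eq: "(\<Sum>i\<in>?S. ?w i * chebU k (?t i)) - (1 + 1 / real q) * (1 / r) ^ k =
        (\<Sum>j=1..k. (1 / r) ^ (k - j) / r ^ j / (2 * real n * real q) * C j)" by simp
    have "\<bar>\<Sum>j=1..k. (1 / r) ^ (k - j) / r ^ j / (2 * real n * real q) * C j\<bar> \<le>
        (\<Sum>j=1..k. 1 / (2 * real n) * (real b * (1 + real q) ^ (4 * D)))"
    proof (rule order_trans[OF sum_abs], rule sum_mono)
      fix j assume j: "j \<in> {1..k}"
      have c: "(1 / r) ^ (k - j) / r ^ j / (2 * real n * real q) \<le> 1 / 1 / (2 * real n)"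
        using r4 deg(4) \<open>q > 0\<close> by (intro frac_le power_le_one one_le_power) auto
      have c0: "(1 / r) ^ (k - j) / r ^ j / (2 * real n * real q) \<ge> 0" using r(1) by simp
      have "C j \<ge> 0" "C j \<le> real b * (1 + real q) ^ (4 * D)" using Ck[of j] j k by auto
      then show "\<bar>(1 / r) ^ (k - j) / r ^ j / (2 * real n * real q) * C j\<bar> \<le> 1 / (2 * real n) * (real b * (1 + real q) ^ (4 * D))"
        using c c0 by (simp only: abs_mult abs_of_nonneg) (intro mult_mono, auto)
    qed
    also have "\<dots> = real k * (1 / (2 * real n) * (real b * (1 + real q) ^ (4 * D)))" by simp
    also have "\<dots> \<le> (2 * real D) * (1 / (2 * real n) * (real b * (1 + real q) ^ (4 * D)))"
      using k by (intro mult_right_mono) auto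
    also have "\<dots> = real b * real D * (1 + real q) ^ (4 * D) / real n" by simp
    finally show "\<bar>(\<Sum>i\<in>?S. ?w i * chebU k (?t i)) - (1 + 1 / real q) * (1 / r) ^ k\<bar> \<le>
        real b * real D * (1 + real q) ^ (4 * D) / real n" unfolding eq .
  next
    show "\<bar>1 / r\<bar> \<le> 1 / 4" using r4 by (simp add: field_simps)
  qed (use D in auto)
qed

section \<open>Comparison with the limit law\<close>

lemma sqrt_diff_le: "a \<ge> 0 \<Longrightarrow> b \<ge> 0 \<Longrightarrow> \<bar>sqrt a - sqrt b\<bar> \<le> sqrt \<bar>a - b\<bar>" for a b :: real
proof -
  have *: "sqrt a \<le> sqrt b + sqrt \<bar>a - b\<bar>" if "a \<ge> 0" "b \<ge> 0" for a b :: real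
  proof -
    have "sqrt a \<le> sqrt (b + \<bar>a - b\<bar>)" by simp
    also have "\<dots> \<le> sqrt b + sqrt \<bar>a - b\<bar>" using that by (intro sqrt_add_le_add_sqrt) auto
    finally show ?thesis .
  qed
  assume "a \<ge> 0" "b \<ge> 0"
  then show ?thesis using *[of a b] *[of b a] by (simp add: abs_minus_commute abs_le_iff)
qed

text \<open>For positive \<open>s\<close> this is \<open>s * sqrt (max 0 (4 - t^2))\<close> at
  \<open>t = semicircle_coord s x\<close>. It is the radical that the limit density and the
  perturbed density share; cleared of the denominator it can be compared for different
  \<open>s\<close>.\<close>

definition band :: "real \<Rightarrow> real \<Rightarrow> real" where
  "band s x = sqrt (max 0 (4 * s\<^sup>2 - (x\<^sup>2 - 1 - s\<^sup>2)\<^sup>2))"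

lemma band_nonneg: "band s x \<ge> 0"
  by (simp add: band_def)

lemma band_le: "s \<ge> 0 \<Longrightarrow> band s x \<le> 2 * s"
  unfolding band_def by (intro real_le_lsqrt) (auto simp: power_mult_distrib)

lemma band_factor: "4 * s\<^sup>2 - (x\<^sup>2 - 1 - s\<^sup>2)\<^sup>2 = ((1 + s)\<^sup>2 - x\<^sup>2) * (x\<^sup>2 - (1 - s)\<^sup>2)" for s x :: real
  by (simp add: power2_eq_square algebra_simps)

lemma band_zero:
  assumes "x > 2" "0 \<le> s" "s \<le> 1"
  shows "band s x = 0"
proof -
  have "(1 + s)\<^sup>2 \<le> x\<^sup>2" "(1 - s)\<^sup>2 \<le> x\<^sup>2" using assms by (intro power_mono; simp)+
  then have "((1 + s)\<^sup>2 - x\<^sup>2) * (x\<^sup>2 - (1 - s)\<^sup>2) \<le> 0" by (intro mult_nonpos_nonneg) auto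
  then show ?thesis unfolding band_def band_factor by simp
qed

text \<open>A square-root modulus of continuity, uniform in \<open>x\<close>: both sides vanish
  beyond 2, and up to 2 the radicands differ by at most
  \<open>12 * \<bar>s^2 - s'^2\<bar>\<close>.\<close>

lemma band_diff:
  assumes s: "0 \<le> s" "s \<le> 1" "0 \<le> s'" "s' \<le> 1" and x: "x \<ge> 0"
  shows "\<bar>band s x - band s' x\<bar> \<le> sqrt (12 * \<bar>s\<^sup>2 - s'\<^sup>2\<bar>)"
proof (cases "x > 2")
  case True
  then show ?thesis using s by (simp add: band_zero)
next
  case False
  let ?u = "\<lambda>s. 4 * s\<^sup>2 - (x\<^sup>2 - 1 - s\<^sup>2)\<^sup>2"
  have "\<bar>band s x - band s' x\<bar> \<le> sqrt \<bar>max 0 (?u s) - max 0 (?u s')\<bar>"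
    unfolding band_def by (rule sqrt_diff_le) auto
  also have "\<dots> \<le> sqrt \<bar>?u s - ?u s'\<bar>" by (intro real_sqrt_le_mono) linarith
  also have "?u s - ?u s' = (s\<^sup>2 - s'\<^sup>2) * (2 + 2 * x\<^sup>2 - s\<^sup>2 - s'\<^sup>2)"
    by (simp add: power2_eq_square algebra_simps)
  also have "sqrt \<bar>(s\<^sup>2 - s'\<^sup>2) * (2 + 2 * x\<^sup>2 - s\<^sup>2 - s'\<^sup>2)\<bar> \<le> sqrt (12 * \<bar>s\<^sup>2 - s'\<^sup>2\<bar>)"
  proof (rule real_sqrt_le_mono)
    have "x\<^sup>2 \<le> 4" using power_mono[of x 2 2] False x by simp
    moreover have "s\<^sup>2 \<le> 1" "s'\<^sup>2 \<le> 1" using s by (auto intro: power_le_one)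
    moreover have "0 \<le> s\<^sup>2" "0 \<le> s'\<^sup>2" "0 \<le> x\<^sup>2" by auto
    ultimately have "\<bar>2 + 2 * x\<^sup>2 - s\<^sup>2 - s'\<^sup>2\<bar> \<le> 12"
      unfolding abs_le_iff by (intro conjI) linarith+
    then have "\<bar>s\<^sup>2 - s'\<^sup>2\<bar> * \<bar>2 + 2 * x\<^sup>2 - s\<^sup>2 - s'\<^sup>2\<bar> \<le> \<bar>s\<^sup>2 - s'\<^sup>2\<bar> * 12"
      by (rule mult_left_mono) simp
    then show "\<bar>(s\<^sup>2 - s'\<^sup>2) * (2 + 2 * x\<^sup>2 - s\<^sup>2 - s'\<^sup>2)\<bar> \<le> 12 * \<bar>s\<^sup>2 - s'\<^sup>2\<bar>"
      by (simp only: abs_mult mult.commute)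
  qed
  finally show ?thesis .
qed

lemma perturbed_density_band:
  assumes "s > 0" "x > 0"
  shows "perturbed_density e s x / x\<^sup>2 = (1 + e * semicircle_coord s x) / (pi * s\<^sup>2 * x) * band s x"
proof -
  have "4 - (semicircle_coord s x)\<^sup>2 = (4 * s\<^sup>2 - (x\<^sup>2 - 1 - s\<^sup>2)\<^sup>2) / s\<^sup>2"
    using assms by (simp add: semicircle_coord_def power_divide field_simps)
  then have "max 0 (4 - (semicircle_coord s x)\<^sup>2) = max 0 (4 * s\<^sup>2 - (x\<^sup>2 - 1 - s\<^sup>2)\<^sup>2) / s\<^sup>2"
    using assms by (simp add: max_def divide_le_0_iff zero_le_divide_iff)
  then have "sqrt (max 0 (4 - (semicircle_coord s x)\<^sup>2)) = band s x / s"
    using assms by (simp add: band_def real_sqrt_divide)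
  then show ?thesis using assms unfolding perturbed_density_def by (simp add: power2_eq_square mult_ac)
qed

lemma band_coord:
  assumes "s > 0" "band s x \<noteq> 0"
  shows "\<bar>semicircle_coord s x\<bar> \<le> 2"
proof -
  have "(x\<^sup>2 - 1 - s\<^sup>2)\<^sup>2 \<le> (2 * s)\<^sup>2" using assms(2) by (auto simp: band_def max_def power_mult_distrib split: if_splits)
  then have "\<bar>x\<^sup>2 - 1 - s\<^sup>2\<bar> \<le> 2 * s" using assms(1) by (metis abs_le_square_iff abs_of_nonneg less_imp_le mult_nonneg_nonneg zero_le_numeral)
  then show ?thesis using assms(1) by (simp add: semicircle_coord_def abs_divide field_simps)
qed

text \<open>For positive \<open>x\<close> the indicator is absorbed by \<open>max 0\<close>, as the
  radicand is nonpositive off the support.\<close>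

lemma limit_density_band:
  assumes "y \<ge> 1" "x > 0"
  shows "limit_density y x = y / (1 + y) / (pi * x) * band (y powr (-1/2)) x"
proof -
  define s where "s = y powr (-1/2)"
  have s: "0 < s" "s \<le> 1" using assms(1) powr_mono2'[of "-1/2" 1 y] by (auto simp: s_def)
  have ld: "limit_density y x = y / ((1 + y) * pi * \<bar>x\<bar>) * sqrt (((1 + s)\<^sup>2 - x\<^sup>2) * (x\<^sup>2 - (1 - s)\<^sup>2)) *
      indicator ({- (1 + s)..- (1 - s)} \<union> {1 - s..1 + s}) x"
    by (simp only: limit_density_def Let_def s_def)
  show ?thesis
  proof (cases "x \<in> {1 - s..1 + s}")
    case True
    then have "(1 - s)\<^sup>2 \<le> x\<^sup>2" "x\<^sup>2 \<le> (1 + s)\<^sup>2" using s assms(2) by (intro power_mono; simp)+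
    then have "((1 + s)\<^sup>2 - x\<^sup>2) * (x\<^sup>2 - (1 - s)\<^sup>2) \<ge> 0" by (intro mult_nonneg_nonneg) auto
    then have "band s x = sqrt (((1 + s)\<^sup>2 - x\<^sup>2) * (x\<^sup>2 - (1 - s)\<^sup>2))" unfolding band_def band_factor by simp
    then show ?thesis using True assms(2) unfolding ld s_def[symmetric] by (simp add: mult_ac)
  next
    case False
    have "((1 + s)\<^sup>2 - x\<^sup>2) * (x\<^sup>2 - (1 - s)\<^sup>2) \<le> 0"
    proof (cases "x < 1 - s")
      case True
      then have "x\<^sup>2 \<le> (1 - s)\<^sup>2" "x\<^sup>2 \<le> (1 + s)\<^sup>2" using s assms(2) by (intro power_mono; simp)+
      then show ?thesis by (intro mult_nonneg_nonpos) auto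
    next
      case F: False
      then have "(1 + s)\<^sup>2 \<le> x\<^sup>2" "(1 - s)\<^sup>2 \<le> x\<^sup>2" using s assms(2) False by (intro power_mono; auto)+
      then show ?thesis by (intro mult_nonpos_nonneg) auto
    qed
    then have "band s x = 0" unfolding band_def band_factor by simp
    moreover have "x \<notin> {- (1 + s)..- (1 - s)} \<union> {1 - s..1 + s}" using False assms(2) s by auto
    ultimately show ?thesis unfolding ld s_def[symmetric] by (simp del: Un_iff)
  qed
qed

lemma limit_density_uminus: "limit_density y (- x) = limit_density y x"
  unfolding limit_density_def Let_def by (auto simp: indicator_def)

text \<open>Three replacements, one per term: dropping \<open>e * t\<close>, where
  \<open>t * band s x\<close> is at most 4 in absolute value; changing the prefactor
  \<open>a\<close> to \<open>a'\<close>; and changing \<open>s\<close> to \<open>s'\<close>.\<close>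

lemma density_difference:
  assumes s: "0 < s" "s \<le> 1" "0 < s'" "s' \<le> 1" and x: "0 < \<epsilon>" "\<epsilon> < x" and a: "0 \<le> a" "0 \<le> a'" and e: "e \<ge> 0"
  shows "\<bar>a * (1 + e * semicircle_coord s x) / (pi * x) * band s x - a' / (pi * x) * band s' x\<bar> \<le>
    (4 * a * e + 2 * \<bar>a - a'\<bar> + a' * sqrt (12 * \<bar>s\<^sup>2 - s'\<^sup>2\<bar>)) / \<epsilon>"
proof -
  let ?t = "semicircle_coord s x"
  have "a * (1 + e * ?t) / (pi * x) * band s x - a' / (pi * x) * band s' x =
      (a * e * (?t * band s x) + (a - a') * band s x + a' * (band s x - band s' x)) / (pi * x)"
    using x by (simp add: field_simps)
  also have "\<bar>\<dots>\<bar> = \<bar>a * e * (?t * band s x) + (a - a') * band s x + a' * (band s x - band s' x)\<bar> / (pi * x)"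
    using x by (simp add: abs_divide)
  also have "\<dots> \<le> (4 * a * e + 2 * \<bar>a - a'\<bar> + a' * sqrt (12 * \<bar>s\<^sup>2 - s'\<^sup>2\<bar>)) / \<epsilon>"
  proof (rule frac_le)
    have b2: "band s x \<le> 2" using band_le[of s x] s by simp
    have "\<bar>?t * band s x\<bar> \<le> 2 * 2"
    proof (cases "band s x = 0")
      case False
      then show ?thesis unfolding abs_mult using band_coord[OF s(1) False] b2 band_nonneg[of s x]
        by (intro mult_mono) auto
    qed simp
    then have "\<bar>a * e * (?t * band s x)\<bar> \<le> a * e * 4" using a e by (simp add: abs_mult mult_left_mono)
    moreover have "\<bar>(a - a') * band s x\<bar> \<le> \<bar>a - a'\<bar> * 2"
      unfolding abs_mult using b2 band_nonneg[of s x] by (intro mult_left_mono) auto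
    moreover have "\<bar>a' * (band s x - band s' x)\<bar> \<le> a' * sqrt (12 * \<bar>s\<^sup>2 - s'\<^sup>2\<bar>)"
      using band_diff[of s s' x] s x a by (simp add: abs_mult mult_left_mono)
    ultimately show "\<bar>a * e * (?t * band s x) + (a - a') * band s x + a' * (band s x - band s' x)\<bar> \<le>
        4 * a * e + 2 * \<bar>a - a'\<bar> + a' * sqrt (12 * \<bar>s\<^sup>2 - s'\<^sup>2\<bar>)" by linarith
    have "1 * \<epsilon> \<le> pi * x" using x pi_gt3 by (intro mult_mono) auto
    then show "\<epsilon> \<le> pi * x" by simp
  qed (use a e x in \<open>auto intro!: add_nonneg_nonneg mult_nonneg_nonneg\<close>)
  finally show ?thesis .
qed

lemma card_eigenvalues_uminus:
  fixes bs :: "real list"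
  assumes "image_mset uminus (mset bs) = mset bs"
  shows "card {i. i < length bs \<and> P (- bs ! i)} = card {i. i < length bs \<and> P (bs ! i)}"
proof -
  have "card {i. i < length bs \<and> P (bs ! i)} = size (filter_mset P (mset bs))"
    by (metis length_filter_conv_card mset_filter size_mset)
  also have "\<dots> = size (filter_mset P (image_mset uminus (mset bs)))" using assms by simp
  also have "\<dots> = size (filter_mset P (mset (map uminus bs)))" by simp
  also have "\<dots> = card {i. i < length (map uminus bs) \<and> P (map uminus bs ! i)}"
    by (metis length_filter_conv_card mset_filter size_mset)
  also have "{i. i < length (map uminus bs) \<and> P (map uminus bs ! i)} = {i. i < length bs \<and> P (- bs ! i)}" by auto
  finally show ?thesis ..
qed

lemma measure_limit_law:
  assumes y: "y \<ge> 1" and J: "is_interval J" "bounded J" "J \<subseteq> {\<epsilon><..}" "\<epsilon> > 0"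
  shows "measure (limit_law y) J = (LINT x:J|lborel. limit_density y x)"
    and "set_integrable lborel J (limit_density y)"
proof -
  obtain b where b: "\<And>x. x \<in> J \<Longrightarrow> x \<le> b"
    using bounded_imp_bdd_above[OF J(2)] unfolding bdd_above_def by auto
  then have Jb: "J \<subseteq> {\<epsilon>..b}" using J(3) by auto
  have sJ: "J \<in> sets borel" by (rule is_interval_borel[OF J(1)])
  let ?f = "\<lambda>x. y / (1 + y) / (pi * x) * band (y powr (-1/2)) x"
  have "continuous_on {\<epsilon>..b} ?f"
    unfolding band_def using J(4) by (intro continuous_intros) auto
  then have "set_integrable lborel {\<epsilon>..b} ?f"
    unfolding set_integrable_def by (intro borel_integrable_compact) simp
  from set_integrable_subset[OF this] have "set_integrable lborel J ?f" using sJ Jb by auto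
  moreover have eq: "limit_density y x = ?f x" if "x \<in> J" for x
    using limit_density_band[OF y] that J(3,4) by auto
  ultimately show int: "set_integrable lborel J (limit_density y)"
    unfolding set_integrable_def by (subst Bochner_Integration.integrable_cong[OF refl]) (auto simp: indicator_def)
  have nonneg: "limit_density y x \<ge> 0" if "x \<in> J" for x
    unfolding eq[OF that] using y that J(3,4) band_nonneg by (intro mult_nonneg_nonneg) auto
  have "0 \<notin> J" using J(3,4) by auto
  then have "emeasure (limit_law y) J = (\<integral>\<^sup>+x\<in>J. ennreal (limit_density y x) \<partial>lborel)"
    by (simp add: emeasure_limit_law[OF sJ])
  also have "\<dots> = ennreal (LINT x:J|lborel. limit_density y x)"
    by (rule set_nn_integral_eq_set_integral_nonneg[OF int nonneg])
  finally show "measure (limit_law y) J = (LINT x:J|lborel. limit_density y x)"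
    using nonneg unfolding measure_def set_lebesgue_integral_def
    by (simp add: integral_nonneg_AE indicator_def)
qed

lemma measure_limit_law_uminus:
  assumes "J \<in> sets borel"
  shows "measure (limit_law y) (uminus ` J) = measure (limit_law y) J"
proof -
  have img: "uminus ` J = {x. - x \<in> J}" by force
  have "{x. - x \<in> J} \<in> sets borel" using assms measurable_sets[of uminus borel borel J] by (simp add: vimage_def)
  then have "emeasure (limit_law y) {x. - x \<in> J} = (\<integral>\<^sup>+x\<in>{x. - x \<in> J}. ennreal (limit_density y x) \<partial>lborel) +
      ennreal ((y - 1) / (y + 1)) * indicator {x. - x \<in> J} 0"
    by (rule emeasure_limit_law)
  also have "(\<integral>\<^sup>+x\<in>{x. - x \<in> J}. ennreal (limit_density y x) \<partial>lborel) =
      (\<integral>\<^sup>+x. (\<lambda>x. ennreal (limit_density y x) * indicator J x) (- x) \<partial>lborel)"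
    by (intro nn_integral_cong) (simp add: limit_density_uminus indicator_def)
  also have "\<dots> = (\<integral>\<^sup>+x. ennreal (limit_density y x) * indicator J x \<partial>distr lborel borel uminus)"
    using assms unfolding limit_density_def Let_def by (subst nn_integral_distr) auto
  also have "distr lborel borel uminus = (lborel :: real measure)" by (rule lborel_distr_uminus)
  also have "(indicator {x. - x \<in> J} 0 :: ennreal) = indicator J 0" by (simp add: indicator_def)
  finally show ?thesis by (simp add: measure_def img emeasure_limit_law[OF assms])
qed

lemma set_lebesgue_integral_diff_le:
  fixes f g :: "real \<Rightarrow> real"
  assumes f: "set_integrable lborel J f" and g: "set_integrable lborel J g"
    and J: "J \<in> sets borel" "bounded J" and close: "\<And>x. x \<in> J \<Longrightarrow> \<bar>f x - g x\<bar> \<le> \<kappa>"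
  shows "\<bar>(LINT x:J|lborel. f x) - (LINT x:J|lborel. g x)\<bar> \<le> \<kappa> * measure lborel J"
proof -
  have fin: "emeasure lborel J < \<infinity>" using J(2) by (rule emeasure_bounded_finite)
  have d: "set_integrable lborel J (\<lambda>x. f x - g x)" using f g by (rule set_integral_diff(1))
  have "(LINT x:J|lborel. f x) - (LINT x:J|lborel. g x) = (LINT x:J|lborel. f x - g x)"
    using f g by (rule set_integral_diff(2)[symmetric])
  also have "\<bar>\<dots>\<bar> \<le> (LINT x|lborel. \<bar>indicator J x *\<^sub>R (f x - g x)\<bar>)"
    unfolding set_lebesgue_integral_def by (rule integral_abs_bound)
  also have "\<dots> \<le> (LINT x|lborel. \<kappa> * indicator J x)"
  proof (rule integral_mono)
    show "integrable lborel (\<lambda>x. \<bar>indicator J x *\<^sub>R (f x - g x)\<bar>)"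
      using d unfolding set_integrable_def by (rule integrable_abs)
    show "integrable lborel (\<lambda>x. \<kappa> * indicator J x)"
      using J fin by (intro integrable_mult_right integrable_real_indicator) auto
  qed (use close in \<open>auto simp: indicator_def\<close>)
  also have "\<dots> = \<kappa> * measure lborel J" using J(1) by simp
  finally show ?thesis .
qed

section \<open>The deterministic bound for a single graph with few bad vertices\<close>

locale biregular_bound =
  fixes m n p q D b :: nat and E :: "nat set set" and y \<epsilon> :: real
  assumes E: "E \<in> biregular_graphs m n (Suc p) (Suc q)"
    and deg: "m * Suc p = n * Suc q" "p \<le> q" "16 \<le> p * q" "n > 0" and D: "D \<ge> 1"
    and bad: "card {v. \<exists>k. 1 \<le> k \<and> k \<le> 4 * D \<and> closed_nbwalk E k v} \<le> b"
    and y: "y \<ge> 1" and eps: "\<epsilon> > 0"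
begin

definition s :: real where "s = sqrt (real p / real q)"
definition e :: real where "e = 1 / sqrt (real p * real q)"
definition s' :: real where "s' = y powr (-1/2)"
text \<open>The prefactor of the density after removal of the weight and renormalisation from
  \<open>n\<close> to \<open>m + n\<close>. In the theorem \<open>s^2\<close> tends to
  \<open>1 / y\<close> and \<open>n / (m + n)\<close> to \<open>1 / (1 + y)\<close>, so it tends to
  \<open>a'\<close>.\<close>

definition a :: real where "a = real n / real (m + n) * (1 + 1 / real q) / s\<^sup>2"
definition a' :: real where "a' = y / (1 + y)"
definition err :: real where
  "err = quadrature_error (1 + 1 / real q) e (real b * real D * (1 + real q) ^ (4 * D) / real n) D"
text \<open>The error of the density per unit length, in contrast to \<open>err\<close>, which does
  not depend on the length of the interval.\<close>

definition \<kappa> :: real where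
  "\<kappa> = (4 * a * e + 2 * \<bar>a - a'\<bar> + a' * sqrt (12 * \<bar>s\<^sup>2 - s'\<^sup>2\<bar>)) / \<epsilon>"

abbreviation "\<mu> \<equiv> empirical_spectral_distribution (real q powr (-1/2) \<cdot>\<^sub>m adjacency_matrix (m + n) E)"

lemma pq_pos: "p > 0" "q > 0"
  using deg(3) by (auto intro: Nat.gr0I)

lemma s_bounds: "0 < s" "s \<le> 1" "s\<^sup>2 = real p / real q"
  using pq_pos deg(2) by (auto simp: s_def)

lemma spectrum:
  obtains bs where "mset bs = eigenvalue_mset (adjacency_matrix (m + n) E)" "length bs = m + n"
    "image_mset uminus (mset bs) = mset bs"
    "\<And>J. measure \<mu> J = real (card {i. i < m + n \<and> real q powr (-1/2) * bs ! i \<in> J}) / real (m + n)"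
proof -
  let ?A = "adjacency_matrix (m + n) E"
  note A = adjacency_matrix_carrier[of "m + n" E] and sym = transpose_adjacency_matrix'[of "m + n" E]
  obtain bs where bs: "mset bs = eigenvalue_mset ?A" by (metis ex_mset)
  have len: "length bs = m + n" using size_eigenvalues_symmetric[OF A sym] bs by (metis size_mset)
  have "image_mset uminus (eigenvalue_mset ?A) = eigenvalue_mset ?A"
  proof (rule eigenvalue_mset_bipartite[OF A sym])
    fix i j assume "i < m + n" "j < m + n" "?A $$ (i, j) \<noteq> 0"
    then have "{i, j} \<in> E" by (auto simp: adjacency_matrix_def split: if_splits)
    then show "(i < m) \<noteq> (j < m)" using biregular_graphs_edge[OF E] by fastforce
  qed
  moreover have "eigenvalue_mset (real q powr (-1/2) \<cdot>\<^sub>m ?A) = mset (map ((*) (real q powr (-1/2))) bs)"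
    using eigenvalue_mset_smult[OF A sym] bs by simp
  then have "measure \<mu> J = real (card {i. i < m + n \<and> real q powr (-1/2) * bs ! i \<in> J}) / real (m + n)" for J
  proof -
    assume *: "eigenvalue_mset (real q powr (-1/2) \<cdot>\<^sub>m ?A) = mset (map ((*) (real q powr (-1/2))) bs)"
    have "map ((*) (real q powr (-1/2))) bs \<noteq> []" using len deg(4) by auto
    from measure_empirical_spectral_distribution[OF * this, of J]
    have "measure \<mu> J = real (card {i. i < m + n \<and> map ((*) (real q powr (-1/2))) bs ! i \<in> J}) / real (m + n)"
      by (simp only: length_map len)
    moreover have "{i. i < m + n \<and> map ((*) (real q powr (-1/2))) bs ! i \<in> J} =
        {i. i < m + n \<and> real q powr (-1/2) * bs ! i \<in> J}" using len by auto
    ultimately show ?thesis by simp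
  qed
  ultimately show ?thesis using that[of bs] bs len by simp
qed

lemma measure_uminus: "measure \<mu> (uminus ` J) = measure \<mu> J"
proof -
  obtain bs where bs: "length bs = m + n" "image_mset uminus (mset bs) = mset bs"
    "\<And>J. measure \<mu> J = real (card {i. i < m + n \<and> real q powr (-1/2) * bs ! i \<in> J}) / real (m + n)"
    by (rule spectrum) blast
  have "x \<in> uminus ` J \<longleftrightarrow> - x \<in> J" for x by force
  then show ?thesis
    using card_eigenvalues_uminus[OF bs(2), of "\<lambda>x. real q powr (-1/2) * x \<in> J"] bs(1) unfolding bs(3) by simp
qed

text \<open>Eigenvalues of both signs are folded to \<open>l = \<bar>c * b\<bar>\<close>. Zero
  eigenvalues have weight 0 and never fall into \<open>J\<close>; all others have
  \<open>w / l^2 = 1 / (2 * n)\<close>, so the weighted sum counts the eigenvalues in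
  \<open>J\<close>.\<close>

lemma positive_interval:
  assumes J: "is_interval J" "bounded J" "J \<subseteq> {\<epsilon><..}"
  shows "\<bar>measure \<mu> J - measure (limit_law y) J\<bar> \<le> 2 * err / \<epsilon>\<^sup>2 + \<kappa> * measure lborel J"
proof -
  obtain bs where bs: "mset bs = eigenvalue_mset (adjacency_matrix (m + n) E)" "length bs = m + n"
    "image_mset uminus (mset bs) = mset bs"
    "\<And>J. measure \<mu> J = real (card {i. i < m + n \<and> real q powr (-1/2) * bs ! i \<in> J}) / real (m + n)"
    by (rule spectrum) blast
  define c where "c = real q powr (-1/2)"
  have c: "c > 0" "c\<^sup>2 = 1 / real q"
  proof -
    show "c > 0" using pq_pos by (simp add: c_def)
    have "c\<^sup>2 = real q powr (- 1 / 2 + - 1 / 2)" by (simp only: c_def power2_eq_square powr_add)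
    also have "\<dots> = 1 / real q" using pq_pos by (simp add: powr_minus_divide)
    finally show "c\<^sup>2 = 1 / real q" .
  qed
  define l where "l i = \<bar>c * bs ! i\<bar>" for i
  define w where "w i = (bs ! i)\<^sup>2 / (2 * real n * real q)" for i
  let ?I = "{..<m + n}"
  have coord: "((bs ! i)\<^sup>2 - (real p + real q)) / sqrt (real p * real q) = semicircle_coord s (l i)" for i
  proof -
    have "semicircle_coord s (l i) = ((bs ! i)\<^sup>2 / real q - 1 - real p / real q) / s"
      using c by (simp add: semicircle_coord_def l_def s_bounds(3) power_mult_distrib)
    also have "\<dots> = ((bs ! i)\<^sup>2 - (real p + real q)) / (real q * s)"
      using pq_pos s_bounds by (simp add: field_simps)
    also have "real q * s = sqrt (real p * real q)"
      using pq_pos unfolding s_def by (simp add: real_sqrt_divide real_sqrt_mult field_simps)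
    finally show ?thesis ..
  qed
  have ns: "near_semicircle ?I w (\<lambda>i. semicircle_coord s (l i)) (1 + 1 / real q) e
      (real b * real D * (1 + real q) ^ (4 * D) / real n) D"
    using near_semicircle_spectrum[OF E bs(1) deg D bad] unfolding bs(2) coord w_def[symmetric] e_def .
  have pos: "0 \<notin> J" "x \<in> J \<Longrightarrow> x > 0" for x using J(3) eps by auto
  have "(\<Sum>i\<in>{i\<in>?I. l i \<in> J}. w i / (l i)\<^sup>2) = (\<Sum>i\<in>{i\<in>?I. l i \<in> J}. 1 / (2 * real n))"
  proof (intro sum.cong refl)
    fix i assume "i \<in> {i\<in>?I. l i \<in> J}"
    then have "bs ! i \<noteq> 0" using pos(1) by (auto simp: l_def)
    then show "w i / (l i)\<^sup>2 = 1 / (2 * real n)"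
      using pq_pos c by (simp add: w_def l_def power_mult_distrib)
  qed
  also have "\<dots> = real (card {i\<in>?I. l i \<in> J}) / (2 * real n)" by simp
  \<comment> \<open>The spectrum is symmetric, so each eigenvalue in \<open>J\<close> is counted
    along with its negative; this cancels the 2 in \<open>2 * n\<close>.\<close>
  also have "card {i\<in>?I. l i \<in> J} = 2 * card {i. i < m + n \<and> c * bs ! i \<in> J}"
  proof -
    have "{i\<in>?I. l i \<in> J} = {i. i < m + n \<and> c * bs ! i \<in> J} \<union> {i. i < m + n \<and> c * (- bs ! i) \<in> J}"
      using pos(2) unfolding l_def by (auto simp: abs_if split: if_splits) (force, force)
    moreover have "{i. i < m + n \<and> c * bs ! i \<in> J} \<inter> {i. i < m + n \<and> c * (- bs ! i) \<in> J} = {}"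
    proof -
      have False if "c * bs ! i \<in> J" "c * - bs ! i \<in> J" for i
        using pos(2)[OF that(1)] pos(2)[OF that(2)] by simp
      then show ?thesis by blast
    qed
    moreover have "card {i. i < m + n \<and> c * (- bs ! i) \<in> J} = card {i. i < m + n \<and> c * bs ! i \<in> J}"
      using card_eigenvalues_uminus[OF bs(3), of "\<lambda>x. c * x \<in> J"] bs(2) by simp
    ultimately show ?thesis by (simp add: card_Un_disjoint)
  qed
  finally have count: "(\<Sum>i\<in>{i\<in>?I. l i \<in> J}. w i / (l i)\<^sup>2) = measure \<mu> J * real (m + n) / real n"
    using deg(4) unfolding bs(4) c_def by simp
  let ?f = "\<lambda>x. perturbed_density e s x / x\<^sup>2" and ?r = "real n / real (m + n)"
  have W: "\<bar>measure \<mu> J * real (m + n) / real n - (1 + 1 / real q) * (LINT x:J|lborel. ?f x)\<bar> \<le> 2 * err / \<epsilon>\<^sup>2"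
    and fint: "set_integrable lborel J ?f"
    using near_semicircle_weighted[OF ns s_bounds(1) _ J eps] unfolding count err_def by (auto simp: l_def)
  have r: "0 < ?r" "?r \<le> 1" using deg(4) by auto
  have "\<bar>measure \<mu> J - (LINT x:J|lborel. ?r * (1 + 1 / real q) * ?f x)\<bar> =
      ?r * \<bar>measure \<mu> J * real (m + n) / real n - (1 + 1 / real q) * (LINT x:J|lborel. ?f x)\<bar>"
  proof -
    have "measure \<mu> J - (LINT x:J|lborel. ?r * (1 + 1 / real q) * ?f x) =
        ?r * (measure \<mu> J * real (m + n) / real n - (1 + 1 / real q) * (LINT x:J|lborel. ?f x))"
    proof (subst set_integral_mult_right)
      have "?r * (X * real (m + n) / real n) = X" for X :: real using deg(4) by simp
      then show "measure \<mu> J - ?r * (1 + 1 / real q) * (LINT x:J|lborel. ?f x) =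
          ?r * (measure \<mu> J * real (m + n) / real n - (1 + 1 / real q) * (LINT x:J|lborel. ?f x))"
        by (simp only: right_diff_distrib mult.assoc)
    qed
    then show ?thesis using r(1) by (simp only: abs_mult abs_of_pos)
  qed
  also have "\<dots> \<le> 1 * (2 * err / \<epsilon>\<^sup>2)" using W r by (intro mult_mono) auto
  finally have 1: "\<bar>measure \<mu> J - (LINT x:J|lborel. ?r * (1 + 1 / real q) * ?f x)\<bar> \<le> 2 * err / \<epsilon>\<^sup>2" by simp
  have 2: "\<bar>(LINT x:J|lborel. ?r * (1 + 1 / real q) * ?f x) - (LINT x:J|lborel. limit_density y x)\<bar> \<le>
      \<kappa> * measure lborel J"
  proof (rule set_lebesgue_integral_diff_le)
    show "set_integrable lborel J (\<lambda>x. ?r * (1 + 1 / real q) * ?f x)"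
      using fint by (rule set_integrable_mult_right[rotated]) 
    show "set_integrable lborel J (limit_density y)" by (rule measure_limit_law(2)[OF y J eps])
    fix x assume x: "x \<in> J"
    have x0: "x > 0" "\<epsilon> < x" using pos(2)[OF x] x J(3) by auto
    have "?r * (1 + 1 / real q) * ?f x = a * (1 + e * semicircle_coord s x) / (pi * x) * band s x"
      unfolding perturbed_density_band[OF s_bounds(1) x0(1)] a_def by (simp add: field_simps)
    moreover have "limit_density y x = a' / (pi * x) * band s' x"
      unfolding limit_density_band[OF y x0(1)] a'_def s'_def ..
    moreover have "0 < s'" "s' \<le> 1" using y powr_mono2'[of "-1/2" 1 y] by (auto simp: s'_def)
    moreover have "0 \<le> a" "0 \<le> a'" "0 \<le> e" using y by (auto simp: a_def a'_def e_def)
    ultimately show "\<bar>?r * (1 + 1 / real q) * ?f x - limit_density y x\<bar> \<le> \<kappa>"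
      unfolding \<kappa>_def using density_difference[of s s' \<epsilon> x a a' e] s_bounds eps x0 by simp
  qed (use J is_interval_borel in auto)
  have "\<bar>measure \<mu> J - (LINT x:J|lborel. limit_density y x)\<bar> \<le> 2 * err / \<epsilon>\<^sup>2 + \<kappa> * measure lborel J"
    using 1 2 by linarith
  then show ?thesis unfolding measure_limit_law(1)[OF y J eps] .
qed

text \<open>Such an interval lies on one side of 0, and reflection leaves the spectrum, the limit
  law and the length unchanged.\<close>

lemma interval_away_from_zero:
  assumes J: "is_interval J" "bounded J" "J \<inter> {-\<epsilon>..\<epsilon>} = {}"
  shows "\<bar>measure \<mu> J - measure (limit_law y) J\<bar> \<le> 2 * err / \<epsilon>\<^sup>2 + \<kappa> * measure lborel J"
proof -
  consider "J \<subseteq> {\<epsilon><..}" | "J \<subseteq> {..<-\<epsilon>}"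
  proof -
    have "False" if "x \<in> J" "z \<in> J" "x < -\<epsilon>" "z > \<epsilon>" for x z
    proof -
      have "0 \<in> J" using J(1) that eps unfolding is_interval_1 by (meson less_imp_le less_trans neg_less_0_iff_less)
      then show False using J(3) eps by auto
    qed
    moreover have "x < -\<epsilon> \<or> x > \<epsilon>" if "x \<in> J" for x using J(3) that by (metis Int_iff atLeastAtMost_iff empty_iff not_le)
    ultimately show ?thesis using that by (metis greaterThan_iff lessThan_iff subsetI)
  qed
  then show ?thesis
  proof cases
    case 1
    then show ?thesis using J by (intro positive_interval)
  next
    case 2
    have sJ: "J \<in> sets borel" by (rule is_interval_borel[OF J(1)])
    have img: "uminus ` J = {x. - x \<in> J}" by force
    have "is_interval (uminus ` J)"
      unfolding is_interval_1 img
    proof (intro ballI allI impI)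
      fix x z u assume "x \<in> {x. - x \<in> J}" "z \<in> {x. - x \<in> J}" "x \<le> u \<and> u \<le> z"
      then have "- x \<in> J" "- z \<in> J" "- z \<le> - u \<and> - u \<le> - x" by auto
      then show "u \<in> {x. - x \<in> J}" using J(1) unfolding is_interval_1 by blast
    qed
    moreover have "bounded (uminus ` J)" 
      by (rule bounded_linear_image[OF J(2) bounded_linear_minus[OF bounded_linear_ident]])
    moreover have "uminus ` J \<subseteq> {\<epsilon><..}" using 2 by auto
    ultimately have "\<bar>measure \<mu> (uminus ` J) - measure (limit_law y) (uminus ` J)\<bar> \<le>
        2 * err / \<epsilon>\<^sup>2 + \<kappa> * measure lborel (uminus ` J)"
      by (rule positive_interval)
    moreover have "measure lborel (uminus ` J) = measure lborel J"
    proof -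
      have "measure lborel J = measure (distr lborel borel uminus) J" by (simp add: lborel_distr_uminus)
      also have "\<dots> = measure lborel (uminus -` J)" using sJ by (subst measure_distr) auto
      also have "uminus -` J = uminus ` J" by force
      finally show ?thesis ..
    qed
    ultimately show ?thesis by (simp only: measure_uminus measure_limit_law_uminus[OF sJ])
  qed
qed

end

section \<open>Choice of the depth\<close>

text \<open>Eta equals \<open>2 * sinh (1 / (2 * a))\<close>. The crude bound suffices: an interval
  of length \<open>2 * eta\<close> is at least \<open>1 / a\<close> long.\<close>

lemma scale_eta_ge:
  assumes "n \<ge> 2" "d \<ge> 2"
  shows "scale_a n d > 0" "1 / (2 * scale_a n d) \<le> scale_eta n d"
proof -
  show a: "scale_a n d > 0" using assms by (simp add: scale_a_def)
  define x where "x = 1 / scale_a n d / 2"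
  have "x \<ge> 0" using a by (simp add: x_def)
  have "scale_eta n d = exp x - exp (- x)"
    by (simp add: scale_eta_def scale_r_def x_def powr_def mult.commute)
  moreover have "exp x \<ge> 1 + x" by (rule exp_ge_add_one_self)
  moreover have "exp (- x) \<le> 1" using \<open>x \<ge> 0\<close> by simp
  ultimately have "x \<le> scale_eta n d" by linarith
  then show "1 / (2 * scale_a n d) \<le> scale_eta n d" by (simp add: x_def mult.commute)
qed

text \<open>
  The exponents are such that \<open>(4 * d) ^ (8 * D) * D\<^sup>2\<close> is small compared with \<open>T\<^sup>2 / n\<close>, for the
  failure probability, and \<open>d ^ (12 * D) * T\<close> is small compared with \<open>n\<close>, for the moment error.
\<close>

locale depth =
  fixes n d :: nat and D T :: nat
  assumes n: "n \<ge> 3" and d: "d \<ge> 4" and dn: "real d \<le> real n powr (1/100)"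
    and D_def: "D = nat \<lfloor>ln (real n) / (100 * ln (real d))\<rfloor>" and T_def: "T = nat \<lceil>real n powr (3/4)\<rceil>"
begin

lemma ln_n: "ln (real n) \<ge> 1"
proof -
  have "exp 1 \<le> real n" using exp_le n by linarith
  then show ?thesis using n by (subst ln_ge_iff) auto
qed

lemma ln_d: "ln (real d) \<ge> 1"
proof -
  have "exp 1 \<le> real d" using exp_le d by linarith
  then show ?thesis using d by (subst ln_ge_iff) auto
qed

lemma D_bounds: "1 \<le> D" "real D \<le> ln (real n) / (100 * ln (real d))" "ln (real n) / (100 * ln (real d)) \<le> real (Suc D)"
proof -
  have "ln (real d) \<le> ln (real n powr (1/100))" using dn d n by (subst ln_le_cancel_iff) auto
  then have "100 * ln (real d) \<le> ln (real n)" using n by (simp add: ln_powr)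
  then have "1 \<le> ln (real n) / (100 * ln (real d))" using ln_d by simp
  then show "1 \<le> D" "real D \<le> ln (real n) / (100 * ln (real d))" "ln (real n) / (100 * ln (real d)) \<le> real (Suc D)"
    unfolding D_def by linarith+
qed

lemma D_le: "real D \<le> ln (real n)"
proof -
  have "ln (real n) / (100 * ln (real d)) \<le> ln (real n) / 1"
    using ln_n ln_d by (intro divide_left_mono) auto
  then show ?thesis using D_bounds(2) by simp
qed

lemma power_le: "real d ^ (k * D) \<le> real n powr (real k / 100)"
proof -
  have "real d ^ (k * D) = real d powr real (k * D)"
    using d by (subst powr_realpow) auto
  also have "\<dots> = exp (real k * (real D * ln (real d)))" using d by (simp add: powr_def mult_ac)
  also have "\<dots> \<le> exp (real k * (ln (real n) / 100))"
  proof (subst exp_le_cancel_iff, rule mult_left_mono)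
    have "real D * ln (real d) \<le> ln (real n) / (100 * ln (real d)) * ln (real d)"
      using D_bounds(2) ln_d by (intro mult_right_mono) auto
    then show "real D * ln (real d) \<le> ln (real n) / 100" using ln_d by simp
  qed simp
  also have "\<dots> = real n powr (real k / 100)" using n by (simp add: powr_def)
  finally show ?thesis .
qed

lemma T_bounds: "real T \<ge> real n powr (3/4)" "real T \<le> 2 * real n powr (3/4)" "T > 0"
proof -
  have "real n powr (3/4) \<ge> 1" using n by (intro ge_one_powr_ge_zero) auto
  then show "real T \<ge> real n powr (3/4)" "real T \<le> 2 * real n powr (3/4)" "T > 0"
    unfolding T_def by linarith+
qed

lemma failure_le:
  "(real (4 * D) * (4 * real d) ^ (4 * D) / real T)\<^sup>2 \<le> 16 * ln (real n) ^ 2 * real n powr (- 134 / 100)"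
proof -
  have "real (4 * D) * (4 * real d) ^ (4 * D) / real T \<le> 4 * ln (real n) * real n powr (8 / 100) / real n powr (3/4)"
  proof (intro frac_le mult_mono)
    \<comment> \<open>Here \<open>4 \<le> d\<close> is used to replace \<open>4 * d\<close> by
      \<open>d^2\<close>, which turns the exponent \<open>4 * D\<close> into
      \<open>8 * D\<close>.\<close>
    have "(4 * real d) ^ (4 * D) \<le> (real d * real d) ^ (4 * D)"
      using d by (intro power_mono mult_right_mono) auto
    also have "\<dots> = real d ^ (8 * D)" by (simp add: power_mult_distrib flip: power_add)
    also have "\<dots> \<le> real n powr (8 / 100)" using power_le[of 8] by simp
    finally show "(4 * real d) ^ (4 * D) \<le> real n powr (8 / 100)" .
  qed (use D_le T_bounds n ln_n in auto)
  also have "\<dots> = 4 * ln (real n) * real n powr (- 67 / 100)"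
  proof -
    have "real n powr (8 / 100) / real n powr (3/4) = real n powr (- 67 / 100)"
      by (simp only: powr_diff[symmetric]) simp
    then show ?thesis by (simp only: times_divide_eq_right[symmetric])
  qed
  finally have "(real (4 * D) * (4 * real d) ^ (4 * D) / real T)\<^sup>2 \<le> (4 * ln (real n) * real n powr (- 67 / 100))\<^sup>2"
    by (intro power_mono) auto
  also have "\<dots> = 16 * ln (real n) ^ 2 * real n powr (- 134 / 100)"
  proof -
    have "(real n powr (- 67 / 100))\<^sup>2 = real n powr (- 67 / 100 + - 67 / 100)"
      by (simp only: powr_add power2_eq_square)
    then show ?thesis by (simp add: power_mult_distrib)
  qed
  finally show ?thesis .
qed

text \<open>The contribution of bad vertices to \<open>quadrature_error\<close>; the last factor
  \<open>d\<close> is in place of \<open>scale_a\<close>, which it dominates. The exponents add up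
  as 12/100 + 1/100 + 3/4 - 1 = - 12/100.\<close>

lemma bad_vertices_le:
  "5 * (real D)\<^sup>2 * (real (T * (4 * D) * (1 + d) ^ (4 * D)) * real D * real d ^ (4 * D) / real n) * real d \<le>
    40 * ln (real n) ^ 4 * real n powr (- 12 / 100)"
proof -
  have "(1 + real d) ^ (4 * D) * real d ^ (4 * D) * real d \<le> real n powr (12 / 100) * real n powr (1 / 100)"
  proof (rule mult_mono)
    have "1 + real d \<le> 2 * real d" using d by simp
    also have "\<dots> \<le> real d * real d" using d by (intro mult_right_mono) auto
    finally have "(1 + real d) ^ (4 * D) * real d ^ (4 * D) \<le> (real d * real d) ^ (4 * D) * real d ^ (4 * D)"
      by (intro mult_right_mono power_mono) auto
    also have "\<dots> = real d ^ (12 * D)" by (simp add: power_mult_distrib flip: power_add)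
    also have "\<dots> \<le> real n powr (12 / 100)" using power_le[of 12] by simp
    finally show "(1 + real d) ^ (4 * D) * real d ^ (4 * D) \<le> real n powr (12 / 100)" .
  qed (use dn in auto)
  then have 1: "(1 + real d) ^ (4 * D) * real d ^ (4 * D) * real d \<le> real n powr (13 / 100)"
    by (simp flip: powr_add)
  have "5 * (real D)\<^sup>2 * (real (T * (4 * D) * (1 + d) ^ (4 * D)) * real D * real d ^ (4 * D) / real n) * real d =
      20 * real D ^ 4 * real T * ((1 + real d) ^ (4 * D) * real d ^ (4 * D) * real d) / real n"
    by (simp add: power4_eq_xxxx power2_eq_square)
  also have "\<dots> \<le> 20 * ln (real n) ^ 4 * (2 * real n powr (3/4)) * real n powr (13 / 100) / real n"
    using 1 D_le T_bounds ln_n by (intro divide_right_mono mult_mono power_mono) auto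
  also have "\<dots> = 40 * ln (real n) ^ 4 * (real n powr (3/4) * real n powr (13 / 100) * real n powr (- 1))"
  proof -
    have "real n powr (- 1) = 1 / real n" using n by (simp add: powr_minus_divide)
    then show ?thesis by simp
  qed
  also have "real n powr (3/4) * real n powr (13 / 100) * real n powr (- 1) = real n powr (- 12 / 100)"
    by (simp only: powr_add[symmetric]) simp
  finally show ?thesis .
qed

lemma small_degree:
  assumes "dL \<le> d" "4 * real n powr (2/100) + 16 * ln (real n) \<le> real n"
  shows "4 * dL * d + 4 * (4 * D) \<le> n * d"
proof -
  have "real d * real d \<le> real n powr (1/100) * real n powr (1/100)" using dn by (intro mult_mono) auto
  then have "real d * real d \<le> real n powr (2/100)" by (simp flip: powr_add)
  moreover have "real (4 * dL * d) \<le> 4 * (real d * real d)" using assms(1) by (simp add: mult_right_mono)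
  moreover have "real (4 * (4 * D)) \<le> 16 * ln (real n)" using D_le by simp
  ultimately have "real (4 * dL * d + 4 * (4 * D)) \<le> real n" using assms(2) by simp
  also have "\<dots> \<le> real n * real d" using mult_left_mono[of 1 "real d" "real n"] d by simp
  finally show ?thesis by (simp only: of_nat_le_iff flip: of_nat_mult)
qed

text \<open>The error is small compared with \<open>1 / a\<close>, and both parts of the minimum in
  \<open>a\<close> serve. As \<open>a\<close> is at most \<open>ln n / (9 * (ln d)^2)\<close> while
  \<open>D + 1\<close> is at least \<open>ln n / (100 * ln d)\<close>, the ratio
  \<open>a / (D + 1)\<close> is O(1 / ln d). As \<open>a\<close> is at most \<open>d\<close>, the
  term \<open>a * e^2\<close> is O(1 / p).\<close>

lemma error_scaled_le:
  assumes p: "p \<ge> 1" and q: "d = Suc q"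
  shows "quadrature_error (1 + 1 / real q) (1 / sqrt (real p * real q))
      (real (T * (4 * D) * (1 + d) ^ (4 * D)) * real D * (1 + real q) ^ (4 * D) / real n) D * scale_a n d \<le>
    600 / ln (real d) + 32 / real p + 40 * ln (real n) ^ 4 * real n powr (- 12 / 100)"
proof -
  let ?A = "1 + 1 / real q" and ?a = "scale_a n d"
  let ?E = "real (T * (4 * D) * (1 + d) ^ (4 * D)) * real D * real d ^ (4 * D) / real n"
  have a0: "?a > 0" using scale_eta_ge[of n d] n d by simp
  have a1: "?a \<le> ln (real n) / (9 * (ln (real d))\<^sup>2)" "?a \<le> real d" by (simp_all add: scale_a_def)
  have A: "?A \<le> 2" "?A \<ge> 0" using q d by auto
  have "?A * (26 / real (Suc D)) * ?a \<le> 2 * (26 / real (Suc D)) * ?a"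
    using A a0 by (intro mult_right_mono) auto
  also have "\<dots> = 52 * (?a / real (Suc D))" by simp
  also have "?a / real (Suc D) \<le> (ln (real n) / (9 * (ln (real d))\<^sup>2)) / (ln (real n) / (100 * ln (real d)))"
    using a1 a0 D_bounds(3) ln_n ln_d d by (intro frac_le divide_pos_pos) auto
  also have "\<dots> = 100 / (9 * ln (real d))" using ln_n ln_d by (simp add: power2_eq_square)
  also have "52 * (100 / (9 * ln (real d))) \<le> 600 / ln (real d)"
    using ln_d by (simp add: field_simps)
  finally have t1: "?A * (26 / real (Suc D)) * ?a \<le> 600 / ln (real d)" by simp
  have "8 * ?A * (1 / sqrt (real p * real q))\<^sup>2 * ?a = 8 * ?A * (?a / (real p * real q))"
    by (simp add: power_divide)
  also have "\<dots> \<le> 16 * (?a / (real p * real q))"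
    using A a0 by (intro mult_right_mono) auto
  also have "?a / (real p * real q) \<le> (2 * real q) / (real p * real q)"
    using a1(2) q d p by (intro divide_right_mono) auto
  also have "(2 * real q) / (real p * real q) = 2 / real p" using q d by simp
  finally have t2: "8 * ?A * (1 / sqrt (real p * real q))\<^sup>2 * ?a \<le> 32 / real p" by simp
  have "5 * (real D)\<^sup>2 * ?E * ?a \<le> 5 * (real D)\<^sup>2 * ?E * real d"
    using a1(2) by (intro mult_left_mono) auto
  also have "\<dots> \<le> 40 * ln (real n) ^ 4 * real n powr (- 12 / 100)" by (rule bad_vertices_le)
  finally have t3: "5 * (real D)\<^sup>2 * ?E * ?a \<le> 40 * ln (real n) ^ 4 * real n powr (- 12 / 100)" .
  have "1 + real q = real d" using q by simp
  then show ?thesis using t1 t2 t3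
    by (simp only: quadrature_error_def distrib_right[of _ _ ?a])
qed

end

lemma rate_limits:
  "(\<lambda>n. 16 * ln (real n) ^ 2 * real n powr (- 134 / 100)) \<in> o(\<lambda>n. 1 / real n)"
  "(\<lambda>n. 40 * ln (real n) ^ 4 * real n powr (- 12 / 100)) \<longlonglongrightarrow> 0"
  "\<forall>\<^sub>F n in sequentially. 4 * real n powr (2/100) + 16 * ln (real n) \<le> real n"
  by real_asymp+

text \<open>This isolates the randomness: what remains is an implication for single graphs.\<close>

lemma prob_few_disjoint_cycles:
  assumes G: "G = biregular_graphs m n dL dR" "G \<noteq> {}"
    and deg: "m * dL = n * dR" "dL \<le> dR" "n > 0" "dR > 0" and small: "4 * dL * dR + 4 * K \<le> n * dR" and T: "T > 0"
    and X: "\<And>E. E \<in> G \<Longrightarrow> card (disjoint_cycle_pairs K E) < T\<^sup>2 \<Longrightarrow> E \<in> X"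
  shows "measure_pmf.prob (random_biregular_graph m n dL dR) X \<ge> 1 - (real K * (4 * real dR) ^ K / real T)\<^sup>2"
proof -
  define B where "B = {E \<in> G. T\<^sup>2 \<le> card (disjoint_cycle_pairs K E)}"
  have fin: "finite G" by (simp add: G finite_biregular_graphs)
  have g: "real (card G) > 0" using fin G(2) by (simp add: card_gt_0_iff)
  have "real (card B) \<le> real (card G) * (real K * (4 * real dR) ^ K / real T)\<^sup>2"
    unfolding B_def by (rule card_many_disjoint_cycle_pairs_le[OF G(1) deg small T])
  then have "real (card B) / real (card G) \<le> (real K * (4 * real dR) ^ K / real T)\<^sup>2"
    using g by (simp add: divide_le_eq mult.commute)
  moreover have "measure_pmf.prob (random_biregular_graph m n dL dR) X = real (card (G \<inter> X)) / real (card G)"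
    unfolding random_biregular_graph_def G(1)[symmetric] using fin G(2) by (simp add: measure_pmf_of_set)
  moreover have "real (card (G - B)) / real (card G) \<le> real (card (G \<inter> X)) / real (card G)"
    using fin by (intro divide_right_mono of_nat_mono card_mono) (auto simp: B_def not_le intro: X)
  moreover have "real (card (G - B)) / real (card G) = 1 - real (card B) / real (card G)"
  proof -
    have "B \<subseteq> G" by (auto simp: B_def)
    then have "card (G - B) = card G - card B" "card B \<le> card G"
      using fin by (auto intro: card_Diff_subset card_mono finite_subset)
    then show ?thesis using g by (simp add: of_nat_diff diff_divide_distrib)
  qed
  ultimately show ?thesis by linarith
qed

section \<open>Passage to the limit\<close>

lemma tendsto_at_top_ratio:
  fixes f g :: "nat \<Rightarrow> nat"
  assumes "filterlim f at_top F" "((\<lambda>n. real (f n) / real (g n)) \<longlongrightarrow> y) F" "\<forall>\<^sub>F n in F. g n > 0"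
  shows "filterlim (\<lambda>n. real (g n)) at_top F"
proof (rule filterlim_at_top_mono)
  show "filterlim (\<lambda>n. inverse (\<bar>y\<bar> + 1) * real (f n)) at_top F"
    using assms(1) by (intro filterlim_tendsto_pos_mult_at_top[OF tendsto_const])
      (auto intro: filterlim_compose[OF filterlim_real_sequentially])
  have "\<forall>\<^sub>F n in F. real (f n) / real (g n) < \<bar>y\<bar> + 1"
    using assms(2) by (rule order_tendstoD) linarith
  then show "\<forall>\<^sub>F n in F. inverse (\<bar>y\<bar> + 1) * real (f n) \<le> real (g n)"
    using assms(3) by eventually_elim (simp add: field_simps)
qed

theorem theorem3:
  fixes S :: "nat set" and F :: "nat filter" and m dL dR :: "nat \<Rightarrow> nat" and y \<epsilon> :: real
  assumes "infinite S" and "F = inf sequentially (principal S)"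
    and "\<And>n. n \<in> S \<Longrightarrow> dL n \<le> dR n"
    and "\<And>n. n \<in> S \<Longrightarrow> m n * dL n = n * dR n"
    and "\<And>n. n \<in> S \<Longrightarrow> biregular_graphs (m n) n (dL n) (dR n) \<noteq> {}"
    and "filterlim dR at_top F"
    and "\<And>\<epsilon>'. \<epsilon>' > 0 \<Longrightarrow> (\<lambda>n. real (dR n)) \<in> o[F](\<lambda>n. real n powr \<epsilon>')"
    and "((\<lambda>n. real (dR n) / real (dL n)) \<longlongrightarrow> y) F" and "1 \<le> y"
    and "\<exists>h \<in> o[F](\<lambda>_. 1). \<forall>\<^sub>F n in F. real (dR n) = exp (h n * sqrt (ln (real n)))"
    and "\<epsilon> > 0"
  shows "\<exists>C :: real. \<forall>\<delta> > 0. \<exists>p \<in> o[F](\<lambda>n. 1 / real n). \<forall>\<^sub>F n in F. \<forall>I :: real set.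
    is_interval I \<longrightarrow> bounded I \<longrightarrow> I \<inter> {-\<epsilon>..\<epsilon>} = {} \<longrightarrow>
    measure lborel I \<ge> max (2 * scale_eta n (dR n)) (scale_eta n (dR n) / (- \<delta> * ln \<delta>)) \<longrightarrow>
    measure_pmf.prob (random_biregular_graph (m n) n (dL n) (dR n))
      {E. \<bar>measure (empirical_spectral_distribution
              ((real (dR n) - 1) powr (-1/2) \<cdot>\<^sub>m adjacency_matrix (m n + n) E)) I
            - measure (limit_law y) I\<bar> < \<delta> * C * measure lborel I}
      \<ge> 1 - p n"
proof -
  have F_le: "F \<le> sequentially" unfolding assms(2) by simp
  have seq: "\<forall>\<^sub>F n in F. P n" if "\<forall>\<^sub>F n in sequentially. P n" for P
    using F_le that by (rule filter_leD)
  have ev_S: "\<forall>\<^sub>F n in F. n \<in> S" unfolding assms(2) by (simp add: eventually_inf_principal)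
  have ev_n: "\<forall>\<^sub>F n in F. n \<ge> 3" by (rule seq[OF eventually_ge_at_top])
  have ev_d: "\<forall>\<^sub>F n in F. dR n \<ge> c" for c using assms(6) by (simp add: filterlim_at_top)
  have ev_L0: "\<forall>\<^sub>F n in F. dL n > 0"
    using ev_S ev_n ev_d[of 1] by eventually_elim (use assms(4) in \<open>force intro: Nat.gr0I\<close>)
  have lim_L: "filterlim (\<lambda>n. real (dL n)) at_top F"
    by (rule tendsto_at_top_ratio[OF assms(6,8) ev_L0])
  have lim_R: "filterlim (\<lambda>n. real (dR n)) at_top F"
    using assms(6) by (rule filterlim_compose[OF filterlim_real_sequentially])
  have ev_dn: "\<forall>\<^sub>F n in F. real (dR n) \<le> real n powr (1/100)"
    using landau_o.smallD[OF assms(7)[of "1/100"], of 1] by simp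
  define P where "P n = real (dL n - 1)" for n
  define Q where "Q n = real (dR n - 1)" for n
  have ev_P: "\<forall>\<^sub>F n in F. P n = real (dL n) - 1" using ev_L0 by eventually_elim (simp add: P_def)
  have ev_Q: "\<forall>\<^sub>F n in F. Q n = real (dR n) - 1" using ev_d[of 1] by eventually_elim (simp add: Q_def)
  have lim_P: "filterlim P at_top F"
    by (subst filterlim_cong[OF refl refl ev_P])
      (use filterlim_tendsto_add_at_top[OF tendsto_const[of "-1"] lim_L] in simp)
  have lim_Q: "filterlim Q at_top F"
    by (subst filterlim_cong[OF refl refl ev_Q])
      (use filterlim_tendsto_add_at_top[OF tendsto_const[of "-1"] lim_R] in simp)
  have inv0: "((\<lambda>n. c / f n) \<longlongrightarrow> 0) F" if "filterlim f at_top F" for f :: "nat \<Rightarrow> real" and c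
    using that by (intro tendsto_divide_0[OF tendsto_const] filterlim_at_top_imp_at_infinity)
  have y0: "y > 0" using assms(9) by simp
  have lim_LR: "((\<lambda>n. real (dL n) / real (dR n)) \<longlongrightarrow> 1 / y) F"
    using tendsto_inverse[OF assms(8)] y0 by (simp add: inverse_eq_divide)
  have lim_s: "((\<lambda>n. P n / Q n) \<longlongrightarrow> 1 / y) F"
  proof (rule Lim_transform_eventually)
    have "((\<lambda>n. (real (dL n) / real (dR n) - 1 / real (dR n)) / (1 - 1 / real (dR n))) \<longlongrightarrow> (1 / y - 0) / (1 - 0)) F"
      by (intro tendsto_intros lim_LR inv0 lim_R) simp
    then show "((\<lambda>n. (real (dL n) / real (dR n) - 1 / real (dR n)) / (1 - 1 / real (dR n))) \<longlongrightarrow> 1 / y) F" by simp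
    show "\<forall>\<^sub>F n in F. (real (dL n) / real (dR n) - 1 / real (dR n)) / (1 - 1 / real (dR n)) = P n / Q n"
      using ev_P ev_Q ev_d[of 2]
    proof eventually_elim
      case (elim n)
      have "(real (dL n) / real (dR n) - 1 / real (dR n)) = (real (dL n) - 1) / real (dR n)"
        "1 - 1 / real (dR n) = (real (dR n) - 1) / real (dR n)" using elim by (auto simp: field_simps)
      then show ?case using elim by simp
    qed
  qed
  \<comment> \<open>From here on the constants of \<open>biregular_bound\<close> appear as sequences
    in \<open>n\<close>, with \<open>s2\<close> for the square of \<open>s\<close>.\<close>
  define s2 where "s2 n = P n / Q n" for n
  define a where "a n = real n / real (m n + n) * (1 + 1 / Q n) / s2 n" for n
  define e where "e n = 1 / sqrt (P n * Q n)" for n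
  define a' where "a' = y / (1 + y)"
  define \<kappa> where "\<kappa> n = (4 * a n * e n + 2 * \<bar>a n - a'\<bar> + a' * sqrt (12 * \<bar>s2 n - (y powr (-1/2))\<^sup>2\<bar>)) / \<epsilon>" for n
  have lim_e: "(e \<longlongrightarrow> 0) F"
  proof -
    have "filterlim (\<lambda>n. sqrt (P n * Q n)) at_top F"
      by (intro filterlim_compose[OF sqrt_at_top] filterlim_at_top_mult_at_top lim_P lim_Q)
    then show ?thesis unfolding e_def[abs_def] by (rule inv0)
  qed
  have lim_frac: "((\<lambda>n. real n / real (m n + n)) \<longlongrightarrow> 1 / (y + 1)) F"
  proof (rule Lim_transform_eventually)
    show "((\<lambda>n. 1 / (real (dR n) / real (dL n) + 1)) \<longlongrightarrow> 1 / (y + 1)) F"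
      using y0 by (intro tendsto_intros assms(8)) simp
    show "\<forall>\<^sub>F n in F. 1 / (real (dR n) / real (dL n) + 1) = real n / real (m n + n)"
      using ev_S ev_L0 ev_n
    proof eventually_elim
      case (elim n)
      have "real (m n) * real (dL n) = real n * real (dR n)"
        using assms(4)[OF elim(1)] by (simp flip: of_nat_mult)
      then have "real (m n) = real n * (real (dR n) / real (dL n))" using elim by (simp add: field_simps)
      then have "real (m n + n) = real n * (real (dR n) / real (dL n) + 1)" by (simp add: distrib_left)
      then show ?case using elim by simp
    qed
  qed
  have lim_a: "(a \<longlongrightarrow> a') F"
  proof -
    have "(a \<longlongrightarrow> 1 / (y + 1) * (1 + 0) / (1 / y)) F"
      unfolding a_def[abs_def] s2_def using y0 by (intro tendsto_intros lim_frac lim_s inv0 lim_Q) simp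
    then show ?thesis using y0 by (simp add: a'_def add.commute)
  qed
  have sy: "(y powr (-1/2))\<^sup>2 = 1 / y"
  proof -
    have "(y powr (-1/2))\<^sup>2 = y powr (-1/2 + -1/2)" by (simp only: power2_eq_square powr_add)
    then show ?thesis using y0 by (simp add: powr_minus_divide)
  qed
  have lim_\<kappa>: "(\<kappa> \<longlongrightarrow> 0) F"
  proof -
    have "(\<kappa> \<longlongrightarrow> (4 * a' * 0 + 2 * \<bar>a' - a'\<bar> + a' * sqrt (12 * \<bar>1 / y - 1 / y\<bar>)) / \<epsilon>) F"
      unfolding \<kappa>_def[abs_def] sy s2_def using assms(11) by (intro tendsto_intros lim_a lim_e lim_s) simp
    then show ?thesis by simp
  qed
  define D where "D n = nat \<lfloor>ln (real n) / (100 * ln (real (dR n)))\<rfloor>" for n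
  define T where "T n = nat \<lceil>real n powr (3/4)\<rceil>" for n
  define g where "g n = 600 / ln (real (dR n)) + 32 / P n + 40 * ln (real n) ^ 4 * real n powr (- 12 / 100)" for n
  have lim_g: "(g \<longlongrightarrow> 0) F"
  proof -
    have "filterlim (\<lambda>n. ln (real (dR n))) at_top F" by (rule filterlim_compose[OF ln_at_top lim_R])
    then have "(g \<longlongrightarrow> 0 + 0 + 0) F"
      unfolding g_def[abs_def]
      by (intro tendsto_add inv0 lim_P tendsto_mono[OF F_le rate_limits(2)])
    then show ?thesis by simp
  qed
  have ev_depth: "\<forall>\<^sub>F n in F. depth n (dR n) (D n) (T n)"
    using ev_n ev_d[of 4] ev_dn by eventually_elim (simp add: depth_def D_def T_def)
  \<comment> \<open>The failure probability depends only on \<open>n\<close>, since the exceptional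
    event knows neither the interval nor \<open>\<delta>\<close>.\<close>
  define p where "p n = (real (4 * D n) * (4 * real (dR n)) ^ (4 * D n) / real (T n))\<^sup>2" for n
  have p_small: "p \<in> o[F](\<lambda>n. 1 / real n)"
  proof (rule landau_o.big_small_trans)
    show "(\<lambda>n. 16 * ln (real n) ^ 2 * real n powr (- 134 / 100)) \<in> o[F](\<lambda>n. 1 / real n)"
      by (rule landau_o.small.filter_mono[OF F_le rate_limits(1)])
    show "p \<in> O[F](\<lambda>n. 16 * ln (real n) ^ 2 * real n powr (- 134 / 100))"
    proof (rule bigoI[where c = 1])
      show "\<forall>\<^sub>F n in F. norm (p n) \<le> 1 * norm (16 * ln (real n) ^ 2 * real n powr (- 134 / 100))"
        using ev_depth by eventually_elim (use depth.failure_le in \<open>simp add: p_def\<close>)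
    qed
  qed
  show ?thesis
  \<comment> \<open>The constant is 1, as both contributions to the difference are o(1) times the
    length of the interval.\<close>
  proof (intro exI[of _ 1] allI impI bexI[OF _ p_small])
    fix \<delta> :: real assume \<delta>: "\<delta> > 0"
    \<comment> \<open>The thresholds are chosen such that \<open>2 * err / \<epsilon>^2\<close> is
      at most \<open>\<delta> / 8\<close> times the length and the density error at most
      \<open>\<delta> / 4\<close> times the length; together they stay below
      \<open>\<delta>\<close>.\<close>
    have ev_g: "\<forall>\<^sub>F n in F. g n < \<delta> * \<epsilon>\<^sup>2 / 16"
      using lim_g \<delta> assms(11) by (intro order_tendstoD) auto
    have ev_\<kappa>: "\<forall>\<^sub>F n in F. \<kappa> n < \<delta> / 4" using lim_\<kappa> \<delta> by (intro order_tendstoD) auto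
    have ev_PQ: "\<forall>\<^sub>F n in F. P n \<ge> 4" "\<forall>\<^sub>F n in F. Q n \<ge> 4"
      using lim_P lim_Q by (auto simp: filterlim_at_top)
    show "\<forall>\<^sub>F n in F. \<forall>I :: real set.
      is_interval I \<longrightarrow> bounded I \<longrightarrow> I \<inter> {-\<epsilon>..\<epsilon>} = {} \<longrightarrow>
      measure lborel I \<ge> max (2 * scale_eta n (dR n)) (scale_eta n (dR n) / (- \<delta> * ln \<delta>)) \<longrightarrow>
      measure_pmf.prob (random_biregular_graph (m n) n (dL n) (dR n))
        {E. \<bar>measure (empirical_spectral_distribution
                ((real (dR n) - 1) powr (-1/2) \<cdot>\<^sub>m adjacency_matrix (m n + n) E)) I
              - measure (limit_law y) I\<bar> < \<delta> * 1 * measure lborel I}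
        \<ge> 1 - p n"
      using ev_S ev_n ev_L0 ev_PQ ev_\<kappa> ev_g ev_depth seq[OF rate_limits(3)]
    proof eventually_elim
      case (elim n)
      interpret depth n "dR n" "D n" "T n" by (rule elim(8))
      define pn where "pn = dL n - 1"
      define qn where "qn = dR n - 1"
      have dLn: "dL n = Suc pn" and dRn: "dR n = Suc qn" using elim(3) d by (auto simp: pn_def qn_def)
      have PQ: "P n = real pn" "Q n = real qn" by (auto simp: P_def Q_def pn_def qn_def)
      have "4 * 4 \<le> pn * qn" using elim(4,5) unfolding PQ by (intro mult_le_mono) auto
      note deg = assms(4)[OF elim(1)] assms(3)[OF elim(1)]
      have small: "4 * dL n * dR n + 4 * (4 * D n) \<le> n * dR n"
        by (rule small_degree[OF deg(2) elim(9)])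
      show ?case
      proof (intro allI impI)
        fix I :: "real set"
        assume I: "is_interval I" "bounded I" "I \<inter> {-\<epsilon>..\<epsilon>} = {}"
          and len: "measure lborel I \<ge> max (2 * scale_eta n (dR n)) (scale_eta n (dR n) / (- \<delta> * ln \<delta>))"
        have eta: "scale_a n (dR n) > 0" "1 / (2 * scale_a n (dR n)) \<le> scale_eta n (dR n)"
          using scale_eta_ge[of n "dR n"] n d by auto
        \<comment> \<open>This converts an error that is small compared with \<open>1 / a\<close>
          into one that is small compared with the length.\<close>
        have len1: "measure lborel I \<ge> 1 / scale_a n (dR n)" using len eta by simp
        show "measure_pmf.prob (random_biregular_graph (m n) n (dL n) (dR n))
          {E. \<bar>measure (empirical_spectral_distribution
                  ((real (dR n) - 1) powr (-1/2) \<cdot>\<^sub>m adjacency_matrix (m n + n) E)) I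
                - measure (limit_law y) I\<bar> < \<delta> * 1 * measure lborel I} \<ge> 1 - p n"
          unfolding p_def
        proof (rule prob_few_disjoint_cycles[OF refl assms(5)[OF elim(1)] deg _ _ small])
          \<comment> \<open>From here on the argument is deterministic: every graph with few pairs
            of disjoint short cycles satisfies the bound.\<close>
          fix E assume E: "E \<in> biregular_graphs (m n) n (dL n) (dR n)"
            and few: "card (disjoint_cycle_pairs (4 * D n) E) < (T n)\<^sup>2"
          define b where "b = T n * (4 * D n) * (1 + dR n) ^ (4 * D n)"
          interpret bb: biregular_bound "m n" n pn qn "D n" b E y \<epsilon>
          proof
            show "E \<in> biregular_graphs (m n) n (Suc pn) (Suc qn)" using E dLn dRn by simp
            show "m n * Suc pn = n * Suc qn" "pn \<le> qn" using deg dLn dRn by auto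
            show "card {v. \<exists>k. 1 \<le> k \<and> k \<le> 4 * D n \<and> closed_nbwalk E k v} \<le> b"
              unfolding b_def by (rule card_closed_nbwalk_le[OF E deg(2) few])
          qed (use \<open>4 * 4 \<le> pn * qn\<close> n D_bounds assms in auto)
          have \<kappa>: "bb.\<kappa> < \<delta> / 4"
            using elim(6) bb.s_bounds(3)
            unfolding \<kappa>_def bb.\<kappa>_def bb.a_def bb.a'_def bb.e_def bb.s'_def a_def a'_def e_def s2_def PQ by simp
          have "bb.err * scale_a n (dR n) \<le> g n"
            unfolding bb.err_def bb.e_def unfolding g_def PQ b_def
            using bb.pq_pos by (intro error_scaled_le[OF _ dRn]) simp
          then have "bb.err * scale_a n (dR n) \<le> \<delta> * \<epsilon>\<^sup>2 / 16" using elim(7) by linarith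
          then have "bb.err \<le> \<delta> * \<epsilon>\<^sup>2 / 16 * (1 / scale_a n (dR n))"
            using eta(1) by (simp add: field_simps)
          also have "\<dots> \<le> \<delta> * \<epsilon>\<^sup>2 / 16 * measure lborel I"
            using len1 \<delta> by (intro mult_left_mono) auto
          finally have err: "2 * bb.err / \<epsilon>\<^sup>2 \<le> \<delta> / 8 * measure lborel I"
            using assms(11) by (simp add: field_simps)
          have pos: "measure lborel I > 0" using len1 eta(1) by (smt (verit) divide_pos_pos)
          have "\<bar>measure bb.\<mu> I - measure (limit_law y) I\<bar> \<le> 2 * bb.err / \<epsilon>\<^sup>2 + bb.\<kappa> * measure lborel I"
            by (rule bb.interval_away_from_zero[OF I])
          also have "\<dots> \<le> \<delta> / 8 * measure lborel I + \<delta> / 4 * measure lborel I"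
            using err \<kappa> pos by (intro add_mono mult_right_mono) auto
          also have "\<dots> < \<delta> * 1 * measure lborel I" using \<delta> pos by simp
          finally show "E \<in> {E. \<bar>measure (empirical_spectral_distribution
                  ((real (dR n) - 1) powr (-1/2) \<cdot>\<^sub>m adjacency_matrix (m n + n) E)) I
                - measure (limit_law y) I\<bar> < \<delta> * 1 * measure lborel I}"
            using dRn by simp
        qed (use n d T_bounds in auto)
      qed
    qed
  qed
qed

end
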